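(* For any $k\geq 1$ and any $\mathcal F^k_t$-measurable random variable $Y$, written as $$Y=\sum_{v_1,\ldots,v_k\in N(t)\cup\{\Delta\}}Y(v_1,\ldots,v_k)\,\mathbf 1_{\{\psi^1_t=v_1,\ldots,\psi^k_t=v_k\}},$$ where each $Y(v_1,\ldots,v_k)$ is $\mathcal F_t$-measurable, one has $$\mathbb P_x\Bigg[\sum_{v_1,\ldots,v_k\in N(t)}Y(v_1,\ldots,v_k)\,\mathbf 1_{\{\zeta(X_{v_i},t)>0\ \forall i=1,\ldots,k\}}\Bigg] =\mathbb Q^k_x\Bigg[Y\prod_{v\in \mathrm{skel}(t)}\frac{\zeta(X_v,\sigma_v(t))}{\zeta(X_v,\tau_v(t))}\exp\left(\int_{\sigma_v(t)}^{\tau_v(t)}\alpha_{D(v)}(X_v(s))\,ds\right)\Bigg].$$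
   Context: Notation: for a probability measure $\mathbb P$ and a random variable $W$, $\mathbb P[W]$ denotes the expectation of $W$. **Branching process.** $(J,\mathcal B)$ is a measurable space, $\mathcal M$ is the generator of a Markov process on $J$, $R(y)\ge 0$ is a branching rate for each $y\in J$, and for each $y\in J$, $\mu^{(y)}$ is a probability distribution on $\{0,1,2,\ldots\}$. Under $\mathbb P_x$ there is initially one particle at $x\in J$. It moves as a Markov process with generator $\mathcal M$ and branches at rate $R(y)$ when at $y$ (the probability that it has not branched by time $t$ is $e^{-\int_0^tR(X(s))ds}$, where $X(s)$ is its position at time $s$). When it branches at position $y$ it dies and gives birth to a random number of new particles with law $\mu^{(y)}$. Each of these independently repeats the stochastic behaviour of its parent from its starting point. Particles are labelled by the Ulam–Harris labels $\Omega=\{\emptyset\}\cup\bigcup_{n\ge1}\mathbb N^n$. $\sigma_v,\tau_v$ are the birth and death times of $v$, $\sigma_v(t)=\sigma_v\wedge t$, $\tau_v(t)=\tau_v\wedge t$, $A_v$ is the number of children of $v$, $N(t)$ is the set of particles alive at time $t$, and $X_v(s)$ is the position at time $s$ of the unique ancestor of $v$ (possibly $v$ itself) alive at time $s$. $\Delta\notin J$ is a graveyard state. $\mathcal F_t$ is the natural filtration of the branching process. **Spines.** Under $\mathbb P^k_x$ the branching process has the same law as under $\mathbb P_x$, and in addition there are $k$ marks $1,\ldots,k$, all initially carried by the initial particle. When a particle carrying $j$ marks branches into $a\ge1$ children, the $j$ marks each choose a child to follow, independently and uniformly at random from the $a$ available. If a particle carrying marks dies and is replaced by $0$ particles, its marks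 remain with it as it moves to the graveyard state $\Delta$. $\psi^i_t\in N(t)\cup\{\Delta\}$ is the particle carrying mark $i$ at time $t$, and $\xi^i_t$ is its position. $\mathcal F^k_t$ is the natural filtration of the branching process together with the $k$ spines $\psi^1,\ldots,\psi^k$. $\mathrm{skel}(t)$ (the skeleton) is the set of $u\in\Omega$ with $u=\psi^j_s$ for some $s\le t$, $j\le k$, and $D(v)=\#\{j\le k:\exists s\text{ with }\psi^j_s=v\}$ is the number of marks carried by $v$. **Weights.** $m_n(y)=\sum_{a\ge0}a^n\mu^{(y)}(a)$ and $\alpha_n(y)=(m_n(y)-1)R(y)$. $\zeta(X,t)$ is a functional of a process $(X_t)_{t\ge0}$ such that if $X$ is a Markov process with generator $\mathcal M$ then $\zeta(X,t)$ is a non-negative unit-mean martingale with respect to the natural filtration of $X$ (so $\zeta(X,t)$ depends only on $(X_s)_{s\le t}$). **The measure $\mathbb Q^k_x$.** Set $$\tilde\zeta^k(t)=\mathbf 1_{\{\zeta(\xi^i,t)>0\ \forall i=1,\ldots,k\}}\prod_{v\in\mathrm{skel}(t)}\left(\frac{\zeta(X_v,\tau_v(t))}{\zeta(X_v,\sigma_v(t))}\exp\Big(-\int_{\sigma_v(t)}^{\tau_v(t)}\alpha_{D(v)}(X_v(s))ds\Big)\right)\prod_{v\in\mathrm{skel}(t)\setminus N(t)}A_v^{D(v)},$$ where $\zeta$ is set to $0$ at the death of a particle with no children. $\mathbb Q^k_x$ is the measure defined by $\frac{d\mathbb Q^k_x}{d\mathbb P^k_x}\big|_{\mathcal F^k_t}=\tilde\zeta^k(t)$.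 (Descriptively, under $\mathbb Q^k_x$ a particle with mark $i$ moves as if under the law of the Markov process weighted by $\zeta(\xi^i,t)$; a particle at $y$ carrying $j\ge1$ marks branches at rate $m_j(y)R(y)$ into a number of children with size-biased law $a^j\mu^{(y)}(a)/m_j(y)$, its marks choosing children independently and uniformly; particles with no marks behave as under $\mathbb P_x$.) *)

theory Defs
  imports "HOL-Probability.Probability" "HOL-Library.Sublist"
begin

section \<open>Paths and Markov processes\<close>

text \<open>
  A path is a function of time of which only the values at times \<open>s \<ge> 0\<close> are observed; \<open>W\<close> is the
  set of admissible paths (for instance all cadlag paths) in the state space \<open>J\<close>.
\<close>

definition path_space :: "'a measure \<Rightarrow> (real \<Rightarrow> 'a) set \<Rightarrow> (real \<Rightarrow> 'a) measure" where
  "path_space J W = sigma W {{w \<in> W. w s \<in> B} | s B. 0 \<le> s \<and> B \<in> sets J}"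

definition path_filtration ::
    "'a measure \<Rightarrow> (real \<Rightarrow> 'a) set \<Rightarrow> real \<Rightarrow> (real \<Rightarrow> 'a) measure" where
  "path_filtration J W t = sigma W {{w \<in> W. w s \<in> B} | s B. 0 \<le> s \<and> s \<le> t \<and> B \<in> sets J}"

text \<open>
  Regularity of the path set: pasting a path at time \<open>r\<close> to a path that starts where the first one
  is at that time gives a path, and the coordinate process is progressively measurable, so that
  integrals over time of functions of the position are random variables.
\<close>

definition admissible_paths :: "'a measure \<Rightarrow> (real \<Rightarrow> 'a) set \<Rightarrow> bool" where
  "admissible_paths J W \<longleftrightarrow>
     (\<forall>w\<in>W. \<forall>s\<ge>0. w s \<in> space J) \<and>
     (\<forall>w\<in>W. \<forall>w'\<in>W. \<forall>r\<ge>0. w' 0 = w r \<longrightarrow> (\<lambda>s. if s < r then w s else w' (s - r)) \<in> W) \<and>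
     (\<forall>t\<ge>0. (\<lambda>(s, w). w s) \<in> restrict_space borel {0..t} \<Otimes>\<^sub>M path_filtration J W t \<rightarrow>\<^sub>M J)"

text \<open>
  \<open>K y\<close> is the law of the motion started at \<open>y\<close>. A generator serves only to specify this
  (time-homogeneous) Markov family of laws.
\<close>

definition markov_family ::
    "'a measure \<Rightarrow> (real \<Rightarrow> 'a) set \<Rightarrow> ('a \<Rightarrow> (real \<Rightarrow> 'a) measure) \<Rightarrow> bool" where
  "markov_family J W K \<longleftrightarrow>
     admissible_paths J W \<and>
     K \<in> J \<rightarrow>\<^sub>M prob_algebra (path_space J W) \<and>
     (\<forall>y\<in>space J. AE w in K y. w 0 = y) \<and>
     (\<forall>y\<in>space J. \<forall>s\<ge>0. \<forall>u\<ge>0. \<forall>A\<in>sets (path_filtration J W s). \<forall>B\<in>sets J.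
        emeasure (K y) (A \<inter> {w \<in> W. w (s + u) \<in> B}) =
        (\<integral>\<^sup>+w\<in>A. emeasure (K (w s)) {w' \<in> W. w' u \<in> B} \<partial>K y))"

definition martingale_wrt :: "'b measure \<Rightarrow> (real \<Rightarrow> 'b measure) \<Rightarrow> (real \<Rightarrow> 'b \<Rightarrow> real) \<Rightarrow> bool" where
  "martingale_wrt M F Z \<longleftrightarrow>
     (\<forall>t\<ge>0. subalgebra M (F t) \<and> Z t \<in> borel_measurable (F t) \<and> integrable M (Z t)) \<and>
     (\<forall>s\<ge>0. \<forall>t\<ge>s. AE w in M. real_cond_exp M (F s) (Z t) w = Z s w)"

text \<open>
  Progressive measurability makes \<open>\<zeta> w t\<close> depend on \<open>w\<close> only through its values on \<open>[0, t]\<close>, and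
  allows \<open>\<zeta>\<close> to be evaluated at random times.
\<close>

definition unit_martingale_functional ::
    "'a measure \<Rightarrow> (real \<Rightarrow> 'a) set \<Rightarrow> ('a \<Rightarrow> (real \<Rightarrow> 'a) measure) \<Rightarrow>
     ((real \<Rightarrow> 'a) \<Rightarrow> real \<Rightarrow> real) \<Rightarrow> bool" where
  "unit_martingale_functional J W K \<zeta> \<longleftrightarrow>
     (\<forall>t\<ge>0. (\<lambda>(s, w). \<zeta> w s)
        \<in> restrict_space borel {0..t} \<Otimes>\<^sub>M path_filtration J W t \<rightarrow>\<^sub>M borel) \<and>
     (\<forall>w\<in>W. \<forall>t\<ge>0. 0 \<le> \<zeta> w t) \<and>
     (\<forall>y\<in>space J. martingale_wrt (K y) (path_filtration J W) (\<lambda>t w. \<zeta> w t) \<and>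
        (\<forall>t\<ge>0. (\<integral>w. \<zeta> w t \<partial>K y) = 1))"


section \<open>Marked trees\<close>

text \<open>
  Ulam-Harris labels, with the children of \<open>v\<close> being \<open>v @ [0], \<dots>, v @ [A - 1]\<close>. An outcome assigns
  to each label \<open>v\<close> the motion as a function of the age (it is the motion of the particle only up to
  its death; the continuation after that is an auxiliary device), the lifetime, the number of
  children, and, for each mark \<open>i\<close>, the child of \<open>v\<close> that the mark follows if \<open>v\<close> carries it. Labels
  that are never born and marks not carried by a particle have no influence on what follows.
\<close>

type_synonym label = "nat list"

datatype 'a tree = Tree
  (motion: "label \<Rightarrow> real \<Rightarrow> 'a")
  (lifetime: "label \<Rightarrow> ennreal")
  (offspring: "label \<Rightarrow> nat")
  (choice: "nat \<Rightarrow> label \<Rightarrow> nat")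

definition birth :: "'a tree \<Rightarrow> label \<Rightarrow> ennreal" where
  "birth \<omega> v = (\<Sum>n<length v. lifetime \<omega> (take n v))"

definition death :: "'a tree \<Rightarrow> label \<Rightarrow> ennreal" where
  "death \<omega> v = birth \<omega> v + lifetime \<omega> v"

definition birth_upto :: "'a tree \<Rightarrow> real \<Rightarrow> label \<Rightarrow> real" where
  "birth_upto \<omega> t v = enn2real (min (birth \<omega> v) (ennreal t))"

definition death_upto :: "'a tree \<Rightarrow> real \<Rightarrow> label \<Rightarrow> real" where
  "death_upto \<omega> t v = enn2real (min (death \<omega> v) (ennreal t))"

definition born :: "'a tree \<Rightarrow> label \<Rightarrow> bool" where
  "born \<omega> v \<longleftrightarrow>
     (\<forall>n<length v. lifetime \<omega> (take n v) < \<infinity> \<and> v ! n < offspring \<omega> (take n v))"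

definition alive :: "'a tree \<Rightarrow> real \<Rightarrow> label set" where
  "alive \<omega> t = {v. born \<omega> v \<and> birth \<omega> v \<le> ennreal t \<and> ennreal t < death \<omega> v}"

text \<open>
  Position at time \<open>s\<close> of the ancestor of \<open>v\<close> (possibly \<open>v\<close>) that is alive at time \<open>s\<close>, namely the
  longest prefix of \<open>v\<close> that is born by time \<open>s\<close>; from the death of \<open>v\<close> on, the continuation of its
  motion.
\<close>

definition position :: "'a tree \<Rightarrow> label \<Rightarrow> real \<Rightarrow> 'a" where
  "position \<omega> v s =
     (let u = take (Max {n. n \<le> length v \<and> birth \<omega> (take n v) \<le> ennreal s}) v
      in motion \<omega> u (s - enn2real (birth \<omega> u)))"

definition start :: "'a \<Rightarrow> 'a tree \<Rightarrow> label \<Rightarrow> 'a" where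
  "start x \<omega> v =
     (if v = [] then x else motion \<omega> (butlast v) (enn2real (lifetime \<omega> (butlast v))))"

definition trees :: "(real \<Rightarrow> 'a) set \<Rightarrow> 'a \<Rightarrow> 'a tree set" where
  "trees W x = {\<omega>. \<forall>v. motion \<omega> v \<in> W \<and> 0 < lifetime \<omega> v \<and>
     (born \<omega> v \<longrightarrow> motion \<omega> v 0 = start x \<omega> v) \<and>
     (0 < offspring \<omega> v \<longrightarrow> (\<forall>i. choice \<omega> i v < offspring \<omega> v))}"

text \<open>The events determined by the particles with labels in \<open>U\<close>.\<close>

definition tree_events ::
    "'a measure \<Rightarrow> (real \<Rightarrow> 'a) set \<Rightarrow> 'a \<Rightarrow> label set \<Rightarrow> 'a tree measure" where
  "tree_events J W x U = sigma (trees W x)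
     ({{\<omega> \<in> trees W x. motion \<omega> u \<in> B} | u B. u \<in> U \<and> B \<in> sets (path_space J W)} \<union>
      {{\<omega> \<in> trees W x. lifetime \<omega> u \<le> c} | u c. u \<in> U} \<union>
      {{\<omega> \<in> trees W x. offspring \<omega> u = a} | u a. u \<in> U})"

abbreviation tree_algebra :: "'a measure \<Rightarrow> (real \<Rightarrow> 'a) set \<Rightarrow> 'a \<Rightarrow> 'a tree measure" where
  "tree_algebra J W x \<equiv> tree_events J W x UNIV"

definition spine_algebra ::
    "'a measure \<Rightarrow> (real \<Rightarrow> 'a) set \<Rightarrow> 'a \<Rightarrow> nat \<Rightarrow> 'a tree measure" where
  "spine_algebra J W x k = sigma (trees W x)
     (sets (tree_algebra J W x) \<union>
      {{\<omega> \<in> trees W x. choice \<omega> i v = c} | i v c. i < k})"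


section \<open>The law of the branching process\<close>

text \<open>\<open>exp (- \<integral>\<^sub>0\<^sup>t R (w s) ds)\<close>, with value \<open>0\<close> if the integral is infinite.\<close>

definition survival :: "('a \<Rightarrow> real) \<Rightarrow> (real \<Rightarrow> 'a) \<Rightarrow> real \<Rightarrow> real" where
  "survival R w t =
     (let h = (\<integral>\<^sup>+s\<in>{0..t}. ennreal (R (w s)) \<partial>lborel)
      in if h = \<infinity> then 0 else exp (- enn2real h))"

text \<open>
  Continuity is what makes \<open>survival R w\<close> the tail of the law of a random time; it only excludes
  that the integral of the rate jumps to infinity.
\<close>

definition branching_mechanism ::
    "'a measure \<Rightarrow> ('a \<Rightarrow> (real \<Rightarrow> 'a) measure) \<Rightarrow> ('a \<Rightarrow> real) \<Rightarrow> ('a \<Rightarrow> nat pmf) \<Rightarrow> bool" where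
  "branching_mechanism J K R \<mu> \<longleftrightarrow>
     R \<in> borel_measurable J \<and> (\<forall>y\<in>space J. 0 \<le> R y) \<and>
     (\<forall>y\<in>space J. AE w in K y. continuous_on {0..} (survival R w)) \<and>
     (\<forall>a. (\<lambda>y. pmf (\<mu> y) a) \<in> borel_measurable J)"

text \<open>
  The defining property of the law of the branching process started at \<open>x\<close>: given all particles
  that are not \<open>v\<close> or a descendant of \<open>v\<close>, and provided that \<open>v\<close> is born, \<open>v\<close> moves according to the
  Markov law from its starting point; given its motion, its lifetime has the survival function
  above; and given both of these, its number of children has law \<open>\<mu>\<close> at the position of its death.
\<close>

definition branching_law ::
    "'a measure \<Rightarrow> (real \<Rightarrow> 'a) set \<Rightarrow> ('a \<Rightarrow> (real \<Rightarrow> 'a) measure) \<Rightarrow> ('a \<Rightarrow> real) \<Rightarrow>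
     ('a \<Rightarrow> nat pmf) \<Rightarrow> 'a \<Rightarrow> 'a tree measure \<Rightarrow> bool" where
  "branching_law J W K R \<mu> x P \<longleftrightarrow>
     prob_space P \<and> space P = trees W x \<and> sets P = sets (tree_algebra J W x) \<and>
     (\<forall>v. \<forall>A\<in>sets (tree_events J W x {u. \<not> prefix v u}). \<forall>B\<in>sets (path_space J W).
        A \<subseteq> {\<omega>. born \<omega> v} \<longrightarrow>
        emeasure P (A \<inter> {\<omega>. motion \<omega> v \<in> B}) =
          (\<integral>\<^sup>+\<omega>\<in>A. emeasure (K (start x \<omega> v)) B \<partial>P) \<and>
        (\<forall>t\<ge>0. emeasure P (A \<inter> {\<omega>. motion \<omega> v \<in> B} \<inter> {\<omega>. ennreal t < lifetime \<omega> v}) =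
          (\<integral>\<^sup>+\<omega>\<in>A \<inter> {\<omega>. motion \<omega> v \<in> B}. ennreal (survival R (motion \<omega> v) t) \<partial>P)) \<and>
        (\<forall>t\<ge>0. \<forall>a.
          emeasure P (A \<inter> {\<omega>. motion \<omega> v \<in> B} \<inter> {\<omega>. lifetime \<omega> v \<le> ennreal t}
                        \<inter> {\<omega>. offspring \<omega> v = a}) =
          (\<integral>\<^sup>+\<omega>\<in>A \<inter> {\<omega>. motion \<omega> v \<in> B} \<inter> {\<omega>. lifetime \<omega> v \<le> ennreal t}.
              ennreal (pmf (\<mu> (motion \<omega> v (enn2real (lifetime \<omega> v)))) a) \<partial>P)))"

text \<open>Natural filtration of the branching process: who is alive, and where, up to time \<open>t\<close>.\<close>

definition branching_filtration ::
    "'a measure \<Rightarrow> (real \<Rightarrow> 'a) set \<Rightarrow> 'a \<Rightarrow> real \<Rightarrow> 'a tree measure" where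
  "branching_filtration J W x t = sigma (trees W x)
     {{\<omega> \<in> trees W x. v \<in> alive \<omega> s \<and> position \<omega> v s \<in> B} | v s B.
        0 \<le> s \<and> s \<le> t \<and> B \<in> sets J}"


section \<open>Spines\<close>

text \<open>
  The marks are \<open>0, \<dots>, k - 1\<close>. Given the branching process, the choices of the marks are
  independent, and uniform among the children of the branching particle.
\<close>

definition spine_law ::
    "'a measure \<Rightarrow> (real \<Rightarrow> 'a) set \<Rightarrow> 'a \<Rightarrow> nat \<Rightarrow> 'a tree measure \<Rightarrow> 'a tree measure \<Rightarrow> bool" where
  "spine_law J W x k P Pk \<longleftrightarrow>
     prob_space Pk \<and> space Pk = trees W x \<and> sets Pk = sets (spine_algebra J W x k) \<and>
     (\<forall>E\<in>sets P. emeasure Pk E = emeasure P E) \<and>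
     (\<forall>I c. \<forall>E\<in>sets P.
        finite I \<longrightarrow> I \<subseteq> {..<k} \<times> UNIV \<longrightarrow>
        E \<subseteq> {\<omega>. \<forall>(i, v)\<in>I. born \<omega> v \<and> lifetime \<omega> v < \<infinity> \<and> c i v < offspring \<omega> v} \<longrightarrow>
        emeasure Pk (E \<inter> {\<omega>. \<forall>(i, v)\<in>I. choice \<omega> i v = c i v}) =
          (\<integral>\<^sup>+\<omega>\<in>E. ennreal (\<Prod>(i, v)\<in>I. 1 / real (offspring \<omega> v)) \<partial>P))"

definition follows :: "'a tree \<Rightarrow> nat \<Rightarrow> label \<Rightarrow> bool" where
  "follows \<omega> i v \<longleftrightarrow> (\<forall>n<length v. choice \<omega> i (take n v) = v ! n)"

text \<open>
  The particle carrying mark \<open>i\<close> at time \<open>t\<close>; \<open>None\<close> is the graveyard. (It is also the value after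
  an explosion along the line of descent followed by the mark.)
\<close>

definition spine :: "'a tree \<Rightarrow> nat \<Rightarrow> real \<Rightarrow> label option" where
  "spine \<omega> i t =
     (if \<exists>v\<in>alive \<omega> t. follows \<omega> i v then Some (THE v. v \<in> alive \<omega> t \<and> follows \<omega> i v) else None)"

definition spine_filtration ::
    "'a measure \<Rightarrow> (real \<Rightarrow> 'a) set \<Rightarrow> 'a \<Rightarrow> nat \<Rightarrow> real \<Rightarrow> 'a tree measure" where
  "spine_filtration J W x k t = sigma (trees W x)
     (sets (branching_filtration J W x t) \<union>
      {{\<omega> \<in> trees W x. spine \<omega> i s = z} | i s z. i < k \<and> 0 \<le> s \<and> s \<le> t})"

definition skeleton :: "'a tree \<Rightarrow> nat \<Rightarrow> real \<Rightarrow> label set" where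
  "skeleton \<omega> k t = {v. \<exists>i<k. \<exists>s. 0 \<le> s \<and> s \<le> t \<and> spine \<omega> i s = Some v}"

definition marks :: "'a tree \<Rightarrow> nat \<Rightarrow> label \<Rightarrow> nat" where
  "marks \<omega> k v = card {i. i < k \<and> (\<exists>s\<ge>0. spine \<omega> i s = Some v)}"


section \<open>Weights and the change of measure\<close>

definition moment :: "('a \<Rightarrow> nat pmf) \<Rightarrow> nat \<Rightarrow> 'a \<Rightarrow> real" where
  "moment \<mu> n y = (\<Sum>a. real a ^ n * pmf (\<mu> y) a)"

definition moment_rate :: "('a \<Rightarrow> real) \<Rightarrow> ('a \<Rightarrow> nat pmf) \<Rightarrow> nat \<Rightarrow> 'a \<Rightarrow> real" where
  "moment_rate R \<mu> n y = (moment \<mu> n y - 1) * R y"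

text \<open>\<open>\<zeta>\<close> along the ancestral line of \<open>v\<close>, set to \<open>0\<close> when \<open>v\<close> dies without children.\<close>

definition particle_zeta ::
    "((real \<Rightarrow> 'a) \<Rightarrow> real \<Rightarrow> real) \<Rightarrow> 'a tree \<Rightarrow> label \<Rightarrow> real \<Rightarrow> real" where
  "particle_zeta \<zeta> \<omega> v s =
     (if offspring \<omega> v = 0 \<and> death \<omega> v \<le> ennreal s then 0 else \<zeta> (position \<omega> v) s)"

text \<open>
  The spine position up to time \<open>t\<close> is the ancestral path of the particle carrying the mark at
  time \<open>t\<close>.
\<close>

definition spine_zeta ::
    "((real \<Rightarrow> 'a) \<Rightarrow> real \<Rightarrow> real) \<Rightarrow> 'a tree \<Rightarrow> nat \<Rightarrow> real \<Rightarrow> real" where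
  "spine_zeta \<zeta> \<omega> i t =
     (case spine \<omega> i t of None \<Rightarrow> 0 | Some v \<Rightarrow> particle_zeta \<zeta> \<omega> v t)"

definition rate_integral ::
    "('a \<Rightarrow> real) \<Rightarrow> ('a \<Rightarrow> nat pmf) \<Rightarrow> 'a tree \<Rightarrow> nat \<Rightarrow> real \<Rightarrow> label \<Rightarrow> real" where
  "rate_integral R \<mu> \<omega> k t v =
     (LBINT s:{birth_upto \<omega> t v..death_upto \<omega> t v}.
        moment_rate R \<mu> (marks \<omega> k v) (position \<omega> v s))"

definition spine_density ::
    "('a \<Rightarrow> real) \<Rightarrow> ('a \<Rightarrow> nat pmf) \<Rightarrow> ((real \<Rightarrow> 'a) \<Rightarrow> real \<Rightarrow> real) \<Rightarrow> nat \<Rightarrow> real \<Rightarrow>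
     'a tree \<Rightarrow> real" where
  "spine_density R \<mu> \<zeta> k t \<omega> =
     of_bool (\<forall>i<k. 0 < spine_zeta \<zeta> \<omega> i t) *
     (\<Prod>v\<in>skeleton \<omega> k t.
        particle_zeta \<zeta> \<omega> v (death_upto \<omega> t v) / particle_zeta \<zeta> \<omega> v (birth_upto \<omega> t v) *
        exp (- rate_integral R \<mu> \<omega> k t v)) *
     (\<Prod>v\<in>skeleton \<omega> k t - alive \<omega> t. real (offspring \<omega> v) ^ marks \<omega> k v)"

text \<open>\<open>Q\<close> has density \<open>spine_density\<close> with respect to \<open>Pk\<close> on the spine filtration at each time.\<close>

definition tilted_measure ::
    "'a measure \<Rightarrow> (real \<Rightarrow> 'a) set \<Rightarrow> ('a \<Rightarrow> real) \<Rightarrow> ('a \<Rightarrow> nat pmf) \<Rightarrow>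
     ((real \<Rightarrow> 'a) \<Rightarrow> real \<Rightarrow> real) \<Rightarrow> 'a \<Rightarrow> nat \<Rightarrow> 'a tree measure \<Rightarrow> 'a tree measure \<Rightarrow> bool" where
  "tilted_measure J W R \<mu> \<zeta> x k Pk Q \<longleftrightarrow>
     (\<forall>t\<ge>0. subalgebra Q (spine_filtration J W x k t) \<and>
        restr_to_subalg Q (spine_filtration J W x k t) =
          density (restr_to_subalg Pk (spine_filtration J W x k t))
            (\<lambda>\<omega>. ennreal (spine_density R \<mu> \<zeta> k t \<omega>)))"

definition tuples :: "nat \<Rightarrow> 'b set \<Rightarrow> 'b list set" where
  "tuples k V = {vs. length vs = k \<and> set vs \<subseteq> V}"

end

theory Submission
  imports Defs
begin

text \<open>
  On the event that mark \<open>i\<close> is carried by \<open>v\<^sub>i\<close> at time \<open>t\<close> for every \<open>i\<close>, the weight multiplied by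
  the density of \<open>Q\<close> is the product of \<open>A\<^sub>v ^ D(v)\<close> over the dead part of the skeleton. Given the
  branching process, this event has as its probability the reciprocal of that product, so the two
  cancel and summation over \<open>(v\<^sub>1, \<dots>, v\<^sub>k)\<close> gives the theorem. The density is adapted because, on that
  event, the skeleton consists of the prefixes of the \<open>v\<^sub>i\<close>, and their birth times and numbers of
  children are determined by who is alive at rational times and at time \<open>t\<close>.

  The cancellation needs \<open>\<zeta>\<close> to be nonzero at the birth times along an ancestral line on which it is
  positive at time \<open>t\<close>. A nonnegative martingale that is \<open>0\<close> at a fixed time stays \<open>0\<close>, almost surely;
  without any regularity of \<open>\<zeta>\<close> in time this can be used at the birth times only because lifetimes
  have densities: by induction along the line of descent, the pair of a birth time and the ancestral
  path does not charge a set whose sections at all fixed times are null for a single motion.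
\<close>

section \<open>Genealogy\<close>

text \<open>\<open>tilted_measure\<close> fixes \<open>Q\<close> only on the spine filtration at
  time \<open>t\<close>, while the weight is a product over a skeleton that may be infinite. The
  remedy is a countable partition by the positions of all marks at time \<open>t\<close>: on each
  piece the skeleton and the numbers of marks are constants, so all products are finite and
  measurability can be checked factor by factor. Where a mark is lost the density is
  \<open>0\<close>, so \<open>Q\<close> does not charge that event.

  Division by \<open>0\<close> gives \<open>0\<close>. If \<zeta> vanished at a birth and were
  positive at time \<open>t\<close>, the density would be \<open>0\<close> while the tuple still
  counted under \<open>P\<close>; hence this case has to be excluded almost surely. The exponential
  factors, in contrast, are inverse to each other whatever value the integral in the exponent takes,
  even if moments diverge.

  The laws of motion and lifetime are given on product events only. They are extended to joint
  events by writing both sides as measures (\<open>bind\<close> with a kernel,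
  \<open>density\<close>, \<open>distr\<close>) and comparing these on a generator closed under
  intersection.\<close>

lemma birth_Nil [simp]: "birth \<omega> [] = 0"
  by (simp add: birth_def)

lemma birth_snoc [simp]: "birth \<omega> (v @ [j]) = death \<omega> v"
  by (simp add: birth_def death_def)

lemma born_Nil [simp]: "born \<omega> []"
  by (simp add: born_def)

lemma born_snoc: "born \<omega> (v @ [j]) \<longleftrightarrow> born \<omega> v \<and> lifetime \<omega> v < \<infinity> \<and> j < offspring \<omega> v"
  by (auto simp: born_def less_Suc_eq nth_append)

lemma birth_le_death: "birth \<omega> v \<le> death \<omega> v"
  by (simp add: death_def)

lemma birth_prefix_mono: "prefix u v \<Longrightarrow> birth \<omega> u \<le> birth \<omega> v"
proof (induction v rule: rev_induct)
  case (snoc j v)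
  then show ?case
    using birth_le_death[of \<omega> v] by (auto intro: order_trans)
qed simp

lemma death_le_birth: "strict_prefix u v \<Longrightarrow> death \<omega> u \<le> birth \<omega> v"
proof (induction v rule: rev_induct)
  case (snoc j v)
  then have "prefix u v" by (auto simp: strict_prefix_def)
  then show ?case
    using snoc.IH birth_le_death[of \<omega> v] by (cases "u = v") (auto simp: strict_prefix_def)
qed simp

lemma born_prefix: "prefix u v \<Longrightarrow> born \<omega> v \<Longrightarrow> born \<omega> u"
  by (induction v rule: rev_induct) (auto simp: born_snoc)

lemma born_strict_prefix:
  assumes "strict_prefix u v" "born \<omega> v"
  shows "lifetime \<omega> u < \<infinity>" "v ! length u < offspring \<omega> u"
proof -
  have "length u < length v" "take (length u) v = u"
    using assms(1) by (auto simp: strict_prefix_def prefix_def)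
  then show "lifetime \<omega> u < \<infinity>" "v ! length u < offspring \<omega> u"
    using assms(2) by (auto simp: born_def)
qed

lemma birth_finite: "born \<omega> v \<Longrightarrow> birth \<omega> v < \<infinity>"
  by (induction v rule: rev_induct) (auto simp: born_snoc death_def)

lemma trees_motion: "\<omega> \<in> trees W x \<Longrightarrow> motion \<omega> v \<in> W"
  and trees_lifetime: "\<omega> \<in> trees W x \<Longrightarrow> 0 < lifetime \<omega> v"
  and trees_start: "\<omega> \<in> trees W x \<Longrightarrow> born \<omega> v \<Longrightarrow> motion \<omega> v 0 = start x \<omega> v"
  by (auto simp: trees_def)

lemma birth_less_death: "\<omega> \<in> trees W x \<Longrightarrow> born \<omega> v \<Longrightarrow> birth \<omega> v < death \<omega> v"
  using birth_finite[of \<omega> v] trees_lifetime[of \<omega> W x v]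
  by (cases "birth \<omega> v"; cases "lifetime \<omega> v")
     (auto simp: death_def ennreal_plus[symmetric] ennreal_less_iff simp del: ennreal_plus)

section \<open>Positions along a line of descent\<close>

lemma position_ge_birth:
  assumes "birth \<omega> v \<le> ennreal s"
  shows "position \<omega> v s = motion \<omega> v (s - enn2real (birth \<omega> v))"
proof -
  have "Max {n. n \<le> length v \<and> birth \<omega> (take n v) \<le> ennreal s} = length v"
    by (rule Max_eqI) (use assms in auto)
  then show ?thesis by (simp add: position_def)
qed

lemma position_Nil: "position \<omega> [] = motion \<omega> []"
  by (rule ext) (simp add: position_def cong: conj_cong)

lemma position_snoc_less:
  assumes "ennreal s < death \<omega> v"
  shows "position \<omega> (v @ [j]) s = position \<omega> v s"
proof -
  have "{n. n \<le> length (v @ [j]) \<and> birth \<omega> (take n (v @ [j])) \<le> ennreal s} =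
        {n. n \<le> length v \<and> birth \<omega> (take n v) \<le> ennreal s}" (is "?L = ?R")
  proof -
    have "n \<in> ?L \<longleftrightarrow> n \<in> ?R" for n
    proof (cases "n \<le> length v")
      case False
      then show ?thesis using assms by (auto simp: le_Suc_eq)
    qed auto
    then show ?thesis by blast
  qed
  moreover have "Max ?R \<le> length v"
    by (subst Max_le_iff) (auto intro: exI[of _ 0])
  ultimately show ?thesis by (simp add: position_def Let_def)
qed

text \<open>In this form, the parent's path pasted at its death to a new motion, the Markov property
  can act on ancestral paths.\<close>

lemma position_snoc:
  assumes "\<omega> \<in> trees W x" "born \<omega> (v @ [j])"
  shows "position \<omega> (v @ [j]) =
    (\<lambda>s. if s < enn2real (death \<omega> v) then position \<omega> v s
         else motion \<omega> (v @ [j]) (s - enn2real (death \<omega> v)))"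
proof (rule ext)
  fix s
  have fin: "death \<omega> v < \<infinity>" using birth_finite[OF assms(2)] by simp
  \<comment> \<open>At negative \<open>s\<close> the function \<open>ennreal\<close> returns
    \<open>0\<close>, and the parent's branch is then right only because the death time is strictly
    positive.\<close>
  have pos: "0 < death \<omega> v"
    using birth_less_death[OF assms(1), of v] assms(2) by (auto simp: born_snoc intro: le_less_trans[OF zero_le])
  obtain d where d: "death \<omega> v = ennreal d" "0 < d"
    using fin pos by (cases "death \<omega> v") auto
  show "position \<omega> (v @ [j]) s = (if s < enn2real (death \<omega> v) then position \<omega> v s
         else motion \<omega> (v @ [j]) (s - enn2real (death \<omega> v)))"
  proof (cases "s < d")
    case True
    then have "ennreal s < death \<omega> v"
      using d by (cases "0 \<le> s") (auto simp: ennreal_less_iff ennreal_neg)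
    from position_snoc_less[OF this] show ?thesis using True d by simp
  next
    case False
    then have "birth \<omega> (v @ [j]) \<le> ennreal s" using d by simp
    from position_ge_birth[OF this] show ?thesis using False d by simp
  qed
qed

text \<open>The time of death itself is included, since a child starts where its parent's motion
  ended. Hence \<zeta> at a death time and integrals over closed life intervals can be read from the
  path of a living descendant.\<close>

lemma position_prefix:
  assumes "\<omega> \<in> trees W x" "born \<omega> v" "prefix u v" "u = v \<or> ennreal s \<le> death \<omega> u"
  shows "position \<omega> u s = position \<omega> v s"
  using assms(2-)
proof (induction v rule: rev_induct)
  case (snoc j v)
  show ?case
  proof (cases "u = v @ [j]")
    case False
    then have p: "prefix u v" and s: "ennreal s \<le> death \<omega> u" using snoc.prems by auto
    have b: "born \<omega> v" using snoc.prems by (simp add: born_snoc)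
    have "position \<omega> u s = position \<omega> v s"
      using snoc.IH b p s by blast
    moreover have "ennreal s \<le> death \<omega> v"
    proof (cases "u = v")
      case False
      then have "death \<omega> u \<le> birth \<omega> v" using p by (intro death_le_birth) auto
      then show ?thesis using s birth_le_death[of \<omega> v] by (meson order_trans)
    qed (use s in simp)
    then have "position \<omega> v s = position \<omega> (v @ [j]) s"
    proof (cases "ennreal s < death \<omega> v")
      case False
      with \<open>ennreal s \<le> death \<omega> v\<close> have e: "ennreal s = death \<omega> v" by simp
      have l: "lifetime \<omega> v < \<infinity>" "birth \<omega> v < \<infinity>"
        using snoc.prems birth_finite[OF b] by (auto simp: born_snoc)
      have s0: "0 \<le> s"
        using e birth_less_death[OF assms(1) b] by (metis ennreal_neg linorder_linear not_less_zero)
      have sr: "s = enn2real (death \<omega> v)" using e s0 by (metis enn2real_ennreal)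
      have dr: "enn2real (death \<omega> v) - enn2real (birth \<omega> v) = enn2real (lifetime \<omega> v)"
        using l by (simp add: death_def enn2real_plus)
      have "position \<omega> (v @ [j]) s = motion \<omega> (v @ [j]) 0"
        using position_ge_birth[of \<omega> "v @ [j]" s] e sr by simp
      also have "\<dots> = motion \<omega> v (enn2real (lifetime \<omega> v))"
        using trees_start[OF assms(1) snoc.prems(1)] by (simp add: start_def)
      also have "\<dots> = position \<omega> v s"
        using position_ge_birth[of \<omega> v s] e birth_le_death[of \<omega> v] sr dr by simp
      finally show ?thesis by simp
    qed (simp add: position_snoc_less)
    ultimately show ?thesis by simp
  qed simp
qed simp

text \<open>A born child starts at its parent's place of death, so the two pieces meet and closure
  of \<open>W\<close> under pasting applies along the line of descent.\<close>

lemma position_in_paths: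
  assumes "admissible_paths J W" "\<omega> \<in> trees W x" "born \<omega> v"
  shows "position \<omega> v \<in> W"
  using assms(3)
proof (induction v rule: rev_induct)
  case Nil
  then show ?case using assms(2) by (simp add: position_Nil trees_motion)
next
  case (snoc j v)
  have b: "born \<omega> v" using snoc.prems by (simp add: born_snoc)
  let ?d = "enn2real (death \<omega> v)"
  have "death \<omega> v < \<infinity>" using birth_finite[OF snoc.prems] by simp
  then have e: "ennreal ?d = death \<omega> v" by simp
  have "position \<omega> (v @ [j]) ?d = motion \<omega> (v @ [j]) 0"
    using position_ge_birth[of \<omega> "v @ [j]" ?d] e by simp
  moreover have "position \<omega> (v @ [j]) ?d = position \<omega> v ?d"
    using position_prefix[OF assms(2) snoc.prems, of v ?d] e by simp
  ultimately have "motion \<omega> (v @ [j]) 0 = position \<omega> v ?d" by simp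
  then have "(\<lambda>s. if s < ?d then position \<omega> v s else motion \<omega> (v @ [j]) (s - ?d)) \<in> W"
    using assms(1) snoc.IH[OF b] trees_motion[OF assms(2), of "v @ [j]"]
    unfolding admissible_paths_def by simp
  then show ?case using position_snoc[OF assms(2) snoc.prems] by simp
qed

section \<open>Particles alive at a given time\<close>

lemma aliveD:
  "v \<in> alive \<omega> t \<Longrightarrow> born \<omega> v"
  "v \<in> alive \<omega> t \<Longrightarrow> birth \<omega> v \<le> ennreal t"
  "v \<in> alive \<omega> t \<Longrightarrow> ennreal t < death \<omega> v"
  by (auto simp: alive_def)

lemma alive_antichain: "u \<in> alive \<omega> t \<Longrightarrow> v \<in> alive \<omega> t \<Longrightarrow> prefix u v \<Longrightarrow> u = v"
  using death_le_birth[of u v \<omega>] by (fastforce dest: aliveD)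

lemma alive_ancestor:
  assumes "born \<omega> v" "ennreal s < death \<omega> v"
  obtains u where "prefix u v" "u \<in> alive \<omega> s"
proof -
  have "\<exists>u. prefix u v \<and> u \<in> alive \<omega> s"
    using assms
  proof (induction v rule: rev_induct)
    case Nil
    then show ?case by (auto simp: alive_def)
  next
    case (snoc j v)
    then show ?case
    proof (cases "birth \<omega> (v @ [j]) \<le> ennreal s")
      case True
      then show ?thesis using snoc.prems by (auto simp: alive_def simp del: birth_snoc)
    next
      case False
      then show ?thesis using snoc by (auto simp: born_snoc not_le)
    qed
  qed
  then show ?thesis using that by blast
qed

text \<open>Lifetimes are strictly positive, so no born label is skipped over. This supplies the
  witness time for membership in the skeleton.\<close>

lemma alive_at_birth:
  assumes "\<omega> \<in> trees W x" "born \<omega> v"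
  shows "v \<in> alive \<omega> (enn2real (birth \<omega> v))"
  using birth_less_death[OF assms] birth_finite[OF assms(2)] assms(2) by (simp add: alive_def)

section \<open>Spines and the skeleton\<close>

lemma follows_prefix: "follows \<omega> i v \<Longrightarrow> prefix u v \<Longrightarrow> follows \<omega> i u"
proof -
  assume "follows \<omega> i v" "prefix u v"
  then obtain w where v: "v = u @ w" and f: "\<And>n. n < length v \<Longrightarrow> choice \<omega> i (take n v) = v ! n"
    by (auto simp: follows_def prefix_def)
  have "choice \<omega> i (take n u) = u ! n" if "n < length u" for n
    using f[of n] that by (simp add: v nth_append)
  then show ?thesis by (simp add: follows_def)
qed

text \<open>The choices of one mark determine the successive letters, so the labels it follows form
  a chain.\<close>

lemma follows_comparable:
  assumes "follows \<omega> i u" "follows \<omega> i v" "length u \<le> length v"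
  shows "prefix u v"
proof -
  have "n \<le> length u \<Longrightarrow> take n u = take n v" for n
  proof (induction n)
    case (Suc n)
    then show ?case using assms
      by (simp add: take_Suc_conv_app_nth follows_def)
        (metis Suc_le_lessD order_less_le_trans)
  qed simp
  from this[of "length u"] show ?thesis by (metis order_refl take_all take_is_prefix)
qed

lemma alive_follows_unique:
  assumes "u \<in> alive \<omega> t" "v \<in> alive \<omega> t" "follows \<omega> i u" "follows \<omega> i v"
  shows "u = v"
  using assms follows_comparable[of \<omega> i u v] follows_comparable[of \<omega> i v u]
    alive_antichain[of u \<omega> t v] alive_antichain[of v \<omega> t u]
  by (cases "length u \<le> length v") auto

lemma spine_eq_Some: "spine \<omega> i t = Some v \<longleftrightarrow> v \<in> alive \<omega> t \<and> follows \<omega> i v"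
proof
  assume "spine \<omega> i t = Some v"
  then have ex: "\<exists>v\<in>alive \<omega> t. follows \<omega> i v" and v: "v = (THE v. v \<in> alive \<omega> t \<and> follows \<omega> i v)"
    by (auto simp: spine_def split: if_splits)
  from ex have "\<exists>!v. v \<in> alive \<omega> t \<and> follows \<omega> i v"
    using alive_follows_unique by blast
  from theI'[OF this] show "v \<in> alive \<omega> t \<and> follows \<omega> i v" using v by simp
next
  assume v: "v \<in> alive \<omega> t \<and> follows \<omega> i v"
  then have "(THE v. v \<in> alive \<omega> t \<and> follows \<omega> i v) = v"
    using alive_follows_unique by blast
  then show "spine \<omega> i t = Some v" using v by (auto simp: spine_def)
qed

text \<open>Only positions outside the graveyard are recorded. For \<open>vs\<close> of length
  \<open>k\<close> these events are disjoint, and off their union the density vanishes.\<close>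

definition spines_at :: "'a tree \<Rightarrow> real \<Rightarrow> label list \<Rightarrow> bool" where
  "spines_at \<omega> t vs \<longleftrightarrow> (\<forall>i<length vs. spine \<omega> i t = Some (vs ! i))"

definition prefix_set :: "label list \<Rightarrow> label set" where
  "prefix_set vs = (\<Union>v\<in>set vs. {u. prefix u v})"

text \<open>The value of D(v) when the marks are at \<open>vs\<close>: it depends on the labels
  alone, whereas \<open>marks\<close> refers to the whole future of the marks.\<close>

definition mark_count :: "label list \<Rightarrow> label \<Rightarrow> nat" where
  "mark_count vs v = card {i. i < length vs \<and> prefix v (vs ! i)}"

lemma finite_prefix_set [simp]: "finite (prefix_set vs)"
  by (simp add: prefix_set_def flip: set_prefixes_eq)

lemma spines_at_alive: "spines_at \<omega> t vs \<Longrightarrow> set vs \<subseteq> alive \<omega> t"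
  by (auto simp: spines_at_def spine_eq_Some set_conv_nth)

lemma spines_at_unique: "spines_at \<omega> t vs \<Longrightarrow> spines_at \<omega> t vs' \<Longrightarrow> length vs = length vs' \<Longrightarrow> vs = vs'"
  by (auto simp: spines_at_def intro!: nth_equalityI)

text \<open>A label carried by time \<open>t\<close> that is not a prefix of \<open>vs ! i\<close>
  would strictly extend it, and \<open>vs ! i\<close> would be dead at \<open>t\<close>. Conversely,
  each ancestor is carried at its own birth time.\<close>

lemma skeleton_eq:
  assumes "\<omega> \<in> trees W x" "0 \<le> t" "spines_at \<omega> t vs"
  shows "skeleton \<omega> (length vs) t = prefix_set vs"
proof (intro set_eqI iffI)
  fix v assume "v \<in> skeleton \<omega> (length vs) t"
  then obtain i s where i: "i < length vs" "0 \<le> s" "s \<le> t" "v \<in> alive \<omega> s" "follows \<omega> i v"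
    by (auto simp: skeleton_def spine_eq_Some)
  have vi: "vs ! i \<in> alive \<omega> t" "follows \<omega> i (vs ! i)"
    using assms(3) i by (auto simp: spines_at_def spine_eq_Some)
  have "prefix v (vs ! i)"
  proof (cases "length v \<le> length (vs ! i)")
    case True
    then show ?thesis using follows_comparable i vi by blast
  next
    case False
    then have "strict_prefix (vs ! i) v"
      using follows_comparable[OF vi(2) i(5)] by (auto simp: strict_prefix_def)
    from death_le_birth[OF this] have "death \<omega> (vs ! i) \<le> ennreal s"
      using aliveD(2)[OF i(4)] by (meson order_trans)
    also have "\<dots> \<le> ennreal t" using i by (simp add: ennreal_leI)
    finally show ?thesis using aliveD(3)[OF vi(1)] by simp
  qed
  then show "v \<in> prefix_set vs" using i by (auto simp: prefix_set_def)
next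
  fix v assume "v \<in> prefix_set vs"
  then obtain i where i: "i < length vs" "prefix v (vs ! i)"
    by (auto simp: prefix_set_def set_conv_nth)
  then have vi: "vs ! i \<in> alive \<omega> t" "follows \<omega> i (vs ! i)"
    using assms(3) by (auto simp: spines_at_def spine_eq_Some)
  have b: "born \<omega> v" using born_prefix[OF i(2) aliveD(1)[OF vi(1)]] .
  have "birth \<omega> v \<le> ennreal t"
    using birth_prefix_mono[OF i(2)] aliveD(2)[OF vi(1)] by (meson order_trans)
  then have "enn2real (birth \<omega> v) \<le> t"
    using assms(2) by (metis enn2real_ennreal enn2real_mono ennreal_less_top)
  then show "v \<in> skeleton \<omega> (length vs) t"
    using alive_at_birth[OF assms(1) b] follows_prefix[OF vi(2) i(2)] i(1)
    by (auto simp: skeleton_def spine_eq_Some intro!: exI[of _ i] exI[of _ "enn2real (birth \<omega> v)"])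
qed

text \<open>\<open>marks\<close> looks at all times, also after \<open>t\<close>. A mark that
  reached \<open>v\<close> only after \<open>t\<close> would be at time \<open>t\<close> on a strict
  ancestor of \<open>v\<close>, hence on a strict ancestor of the living \<open>vs ! j\<close>, but
  living labels are incomparable.\<close>

lemma marks_eq:
  assumes "\<omega> \<in> trees W x" "0 \<le> t" "spines_at \<omega> t vs" "v \<in> prefix_set vs"
  shows "marks \<omega> (length vs) v = mark_count vs v"
proof -
  obtain j where j: "j < length vs" "prefix v (vs ! j)"
    using assms(4) by (auto simp: prefix_set_def set_conv_nth)
  have vi: "vs ! i \<in> alive \<omega> t" "follows \<omega> i (vs ! i)" if "i < length vs" for i
    using assms(3) that by (auto simp: spines_at_def spine_eq_Some)
  have b: "born \<omega> v" using born_prefix[OF j(2) aliveD(1)[OF vi(1)[OF j(1)]]] .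
  have "(\<exists>s\<ge>0. spine \<omega> i s = Some v) \<longleftrightarrow> prefix v (vs ! i)" if "i < length vs" for i
  proof
    assume "\<exists>s\<ge>0. spine \<omega> i s = Some v"
    then have f: "follows \<omega> i v" by (auto simp: spine_eq_Some)
    show "prefix v (vs ! i)"
    proof (cases "length v \<le> length (vs ! i)")
      case True
      then show ?thesis using follows_comparable f vi that by blast
    next
      case False
      then have "strict_prefix (vs ! i) v"
        using follows_comparable[OF vi(2)[OF that] f] by (auto simp: strict_prefix_def)
      then have "strict_prefix (vs ! i) (vs ! j)" using j
        by (meson prefix_order.less_le_trans)
      then show ?thesis using alive_antichain[OF vi(1)[OF that] vi(1)[OF j(1)]]
        by (auto simp: strict_prefix_def)
    qed
  next
    assume "prefix v (vs ! i)"
    then show "\<exists>s\<ge>0. spine \<omega> i s = Some v"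
      using alive_at_birth[OF assms(1) b] follows_prefix[OF vi(2)[OF that]]
      by (auto simp: spine_eq_Some intro!: exI[of _ "enn2real (birth \<omega> v)"])
  qed
  then show ?thesis unfolding marks_def mark_count_def by (metis (lifting))
qed

lemma prefix_set_alive:
  assumes "set vs \<subseteq> alive \<omega> t" "v \<in> prefix_set vs"
  shows "v \<in> alive \<omega> t \<longleftrightarrow> v \<in> set vs"
  using assms alive_antichain by (fastforce simp: prefix_set_def)

lemma spine_density_eq:
  assumes "\<omega> \<in> trees W x" "0 \<le> t" "spines_at \<omega> t vs"
  shows "spine_density R \<mu> \<zeta> (length vs) t \<omega> =
    of_bool (\<forall>v\<in>set vs. 0 < particle_zeta \<zeta> \<omega> v t) *
     (\<Prod>v\<in>prefix_set vs.
        particle_zeta \<zeta> \<omega> v (death_upto \<omega> t v) / particle_zeta \<zeta> \<omega> v (birth_upto \<omega> t v) *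
        exp (- rate_integral R \<mu> \<omega> (length vs) t v)) *
     (\<Prod>v\<in>prefix_set vs - set vs. real (offspring \<omega> v) ^ mark_count vs v)"
proof -
  have "(\<forall>i<length vs. 0 < spine_zeta \<zeta> \<omega> i t) \<longleftrightarrow> (\<forall>v\<in>set vs. 0 < particle_zeta \<zeta> \<omega> v t)"
    using assms(3) by (simp add: spine_zeta_def spines_at_def all_set_conv_all_nth)
  moreover have "prefix_set vs - alive \<omega> t = prefix_set vs - set vs"
    using prefix_set_alive[OF spines_at_alive[OF assms(3)]] by blast
  moreover have "(\<Prod>v\<in>prefix_set vs - set vs. real (offspring \<omega> v) ^ marks \<omega> (length vs) v) =
      (\<Prod>v\<in>prefix_set vs - set vs. real (offspring \<omega> v) ^ mark_count vs v)"
    using marks_eq[OF assms] by (intro prod.cong) auto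
  ultimately show ?thesis
    using skeleton_eq[OF assms] by (simp add: spine_density_def)
qed

text \<open>Some mark is then in the graveyard; its \<open>spine_zeta\<close> is \<open>0\<close>,
  and the indicator in the density fails.\<close>

lemma spine_density_eq_0:
  assumes "\<And>vs. length vs = k \<Longrightarrow> \<not> spines_at \<omega> t vs"
  shows "spine_density R \<mu> \<zeta> k t \<omega> = 0"
proof -
  have "\<exists>i<k. spine \<omega> i t = None"
  proof (rule ccontr)
    assume "\<not> ?thesis"
    then have "spines_at \<omega> t (map (\<lambda>i. the (spine \<omega> i t)) [0..<k])"
      by (auto simp: spines_at_def)
    then show False using assms by simp
  qed
  then show ?thesis by (force simp: spine_density_def spine_zeta_def)
qed

section \<open>Measurability on path space\<close>

lemma space_path_space [simp]: "space (path_space J W) = W"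
  by (simp add: path_space_def space_measure_of_conv)

lemma space_path_filtration [simp]: "space (path_filtration J W t) = W"
  by (simp add: path_filtration_def space_measure_of_conv)

lemma sets_path_space:
  "sets (path_space J W) = sigma_sets W {{w \<in> W. w s \<in> B} | s B. 0 \<le> s \<and> B \<in> sets J}"
  by (auto simp: path_space_def intro!: sets_measure_of)

lemma sets_path_filtration:
  "sets (path_filtration J W t) = sigma_sets W {{w \<in> W. w s \<in> B} | s B. 0 \<le> s \<and> s \<le> t \<and> B \<in> sets J}"
  by (auto simp: path_filtration_def intro!: sets_measure_of)

lemma sets_path_filtration_mono: "s \<le> t \<Longrightarrow> sets (path_filtration J W s) \<subseteq> sets (path_filtration J W t)"
  unfolding sets_path_filtration by (rule sigma_sets_mono') force

lemma sets_path_filtration_le: "sets (path_filtration J W t) \<subseteq> sets (path_space J W)"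
  unfolding sets_path_filtration sets_path_space by (rule sigma_sets_mono') force

lemma measurable_path_spaceI:
  assumes "\<And>z. z \<in> space M \<Longrightarrow> f z \<in> W"
    and "\<And>s. 0 \<le> s \<Longrightarrow> (\<lambda>z. f z s) \<in> M \<rightarrow>\<^sub>M J"
  shows "f \<in> M \<rightarrow>\<^sub>M path_space J W"
  unfolding path_space_def
proof (rule measurable_measure_of)
  fix A assume "A \<in> {{w \<in> W. w s \<in> B} |s B. 0 \<le> s \<and> B \<in> sets J}"
  then obtain s B where A: "A = {w \<in> W. w s \<in> B}" "0 \<le> s" "B \<in> sets J" by auto
  have "f -` A \<inter> space M = (\<lambda>z. f z s) -` B \<inter> space M" using A assms(1) by auto
  then show "f -` A \<inter> space M \<in> sets M" using measurable_sets[OF assms(2)] A by simp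
qed (use assms(1) in auto)

lemma measurable_path_filtrationI:
  assumes "\<And>z. z \<in> space M \<Longrightarrow> f z \<in> W"
    and "\<And>s. 0 \<le> s \<Longrightarrow> s \<le> t \<Longrightarrow> (\<lambda>z. f z s) \<in> M \<rightarrow>\<^sub>M J"
  shows "f \<in> M \<rightarrow>\<^sub>M path_filtration J W t"
  unfolding path_filtration_def
proof (rule measurable_measure_of)
  fix A assume "A \<in> {{w \<in> W. w s \<in> B} |s B. 0 \<le> s \<and> s \<le> t \<and> B \<in> sets J}"
  then obtain s B where A: "A = {w \<in> W. w s \<in> B}" "0 \<le> s" "s \<le> t" "B \<in> sets J" by auto
  have "f -` A \<inter> space M = (\<lambda>z. f z s) -` B \<inter> space M" using A assms(1) by auto
  then show "f -` A \<inter> space M \<in> sets M" using measurable_sets[OF assms(2)] A by simp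
qed (use assms(1) in auto)

text \<open>By induction over its generation, no set of the sigma-algebra separates paths that agree
  up to \<open>t\<close>; this is applied to a level set of \<open>f\<close>.\<close>

lemma path_filtration_cong:
  fixes f :: "(real \<Rightarrow> 'a) \<Rightarrow> real"
  assumes f: "f \<in> borel_measurable (path_filtration J W t)"
    and w: "w \<in> W" "w' \<in> W" and eq: "\<And>s. 0 \<le> s \<Longrightarrow> s \<le> t \<Longrightarrow> w s = w' s"
  shows "f w = f w'"
proof -
  have "w \<in> A \<longleftrightarrow> w' \<in> A" if "A \<in> sets (path_filtration J W t)" for A
    using that unfolding sets_path_filtration
    by (induction rule: sigma_sets.induct) (use w eq in auto)
  moreover have "{v \<in> space (path_filtration J W t). f v = f w} \<in> sets (path_filtration J W t)"
    using f by measurable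
  ultimately show ?thesis using w by (metis (mono_tags, lifting) mem_Collect_eq space_path_filtration)
qed

section \<open>Evaluation of paths at random times\<close>

locale paths =
  fixes J :: "'a measure" and W :: "(real \<Rightarrow> 'a) set"
  assumes admissible: "admissible_paths J W"
begin

abbreviation "PS \<equiv> path_space J W"
abbreviation "PF \<equiv> path_filtration J W"

lemma path_in_space: "w \<in> W \<Longrightarrow> 0 \<le> s \<Longrightarrow> w s \<in> space J"
  using admissible by (auto simp: admissible_paths_def)

lemma eval_measurable: "0 \<le> s \<Longrightarrow> (\<lambda>w. w s) \<in> PS \<rightarrow>\<^sub>M J"
proof (rule measurableI)
  fix A assume "0 \<le> s" "A \<in> sets J"
  then have "{w \<in> W. w s \<in> A} \<in> sets PS"
    unfolding sets_path_space by (intro sigma_sets.Basic) auto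
  moreover have "(\<lambda>w. w s) -` A \<inter> space PS = {w \<in> W. w s \<in> A}" by auto
  ultimately show "(\<lambda>w. w s) -` A \<inter> space PS \<in> sets PS" by simp
qed (simp add: path_in_space)

lemma id_PS_PF: "(\<lambda>w. w) \<in> PS \<rightarrow>\<^sub>M PF t"
  using sets_path_filtration_le[of J W t] by (auto simp: measurable_def Int_absorb2 dest: sets.sets_into_space)

text \<open>Clamping the time to \<open>[0, t]\<close> turns a map on a restricted time interval
  into one on all of \<open>borel\<close>, which can be composed with random times.\<close>

lemma clamp_PF:
  assumes f: "(\<lambda>(s, w). f s w) \<in> restrict_space borel {0..t} \<Otimes>\<^sub>M PF t \<rightarrow>\<^sub>M N" and t: "0 \<le> t"
  shows "(\<lambda>(s, w). f (max 0 (min s t)) w) \<in> borel \<Otimes>\<^sub>M PF t \<rightarrow>\<^sub>M N"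
proof -
  have "(\<lambda>(s, w). (max 0 (min s t), w)) \<in> borel \<Otimes>\<^sub>M PF t \<rightarrow>\<^sub>M restrict_space borel {0..t} \<Otimes>\<^sub>M PF t"
    unfolding split_beta using t
    by (intro measurable_Pair measurable_restrict_space2 measurable_snd) (auto intro!: borel_measurable_max borel_measurable_min)
  from measurable_compose[OF this f] show ?thesis by (simp add: split_beta)
qed

text \<open>Progressive measurability is given for each horizon separately; the pieces
  \<open>s \<le> n\<close> cover all times and are glued.\<close>

lemma clamp_PS:
  assumes f: "\<And>t. 0 \<le> t \<Longrightarrow> (\<lambda>(s, w). f s w) \<in> restrict_space borel {0..t} \<Otimes>\<^sub>M PF t \<rightarrow>\<^sub>M N"
  shows "(\<lambda>(s, w). f (max 0 s) w) \<in> borel \<Otimes>\<^sub>M PS \<rightarrow>\<^sub>M N"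
proof (rule measurable_piecewise_restrict[where C="range (\<lambda>n::nat. {z. fst z \<le> real n})"])
  show "space (borel \<Otimes>\<^sub>M PS) \<subseteq> \<Union> (range (\<lambda>n::nat. {z. fst z \<le> real n}))"
    by (auto intro: real_arch_simple)
  fix A :: "(real \<times> (real \<Rightarrow> 'a)) set" assume "A \<in> range (\<lambda>n::nat. {z. fst z \<le> real n})"
  then obtain n :: nat where A: "A = {z. fst z \<le> real n}" by auto
  show "A \<inter> space (borel \<Otimes>\<^sub>M PS) \<in> sets (borel \<Otimes>\<^sub>M PS)"
  proof -
    have "A \<inter> space (borel \<Otimes>\<^sub>M PS) = {z \<in> space (borel \<Otimes>\<^sub>M PS). fst z \<le> real n}"
      unfolding A by auto
    also have "\<dots> \<in> sets (borel \<Otimes>\<^sub>M PS)" by measurable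
    finally show ?thesis .
  qed
  have "(\<lambda>(s, w). (s, w)) \<in> borel \<Otimes>\<^sub>M PS \<rightarrow>\<^sub>M borel \<Otimes>\<^sub>M PF (real n)"
    unfolding split_beta by (intro measurable_Pair measurable_fst measurable_compose[OF measurable_snd id_PS_PF])
  from measurable_compose[OF this clamp_PF[OF f[of "real n"]]]
  have "(\<lambda>(s, w). f (max 0 (min s (real n))) w) \<in> borel \<Otimes>\<^sub>M PS \<rightarrow>\<^sub>M N" by (simp add: split_beta)
  from measurable_restrict_space1[OF this, of A]
  show "(\<lambda>(s, w). f (max 0 s) w) \<in> restrict_space (borel \<Otimes>\<^sub>M PS) A \<rightarrow>\<^sub>M N"
    by (rule measurable_cong[THEN iffD1, rotated]) (auto simp: space_restrict_space A min_def)
qed simp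

lemma eval_progressive:
  "0 \<le> t \<Longrightarrow> (\<lambda>(s, w). w s) \<in> restrict_space borel {0..t} \<Otimes>\<^sub>M PF t \<rightarrow>\<^sub>M J"
  using admissible unfolding admissible_paths_def by blast

lemma eval_joint: "(\<lambda>(s, w). w (max 0 s)) \<in> borel \<Otimes>\<^sub>M PS \<rightarrow>\<^sub>M J"
  by (rule clamp_PS[of "\<lambda>s w. w s"]) (rule eval_progressive)

lemma eval_joint_PF: "0 \<le> t \<Longrightarrow> (\<lambda>(s, w). w (max 0 (min s t))) \<in> borel \<Otimes>\<^sub>M PF t \<rightarrow>\<^sub>M J"
  by (rule clamp_PF[of "\<lambda>s w. w s"]) (rule eval_progressive)

lemma eval_measurable2:
  assumes "f \<in> borel_measurable M" "g \<in> M \<rightarrow>\<^sub>M PS" "\<And>z. z \<in> space M \<Longrightarrow> 0 \<le> f z"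
  shows "(\<lambda>z. g z (f z)) \<in> M \<rightarrow>\<^sub>M J"
proof -
  have "(\<lambda>z. g z (max 0 (f z))) \<in> M \<rightarrow>\<^sub>M J"
    using measurable_compose[OF measurable_Pair[OF assms(1,2)] eval_joint] by simp
  then show ?thesis
    by (rule measurable_cong[THEN iffD1, rotated]) (simp add: assms(3) max_def)
qed

end

section \<open>Measurability on trees\<close>

lemma space_tree_events [simp]: "space (tree_events J W x U) = trees W x"
  by (simp add: tree_events_def space_measure_of_conv)

lemma sets_tree_events:
  "sets (tree_events J W x U) = sigma_sets (trees W x)
     ({{\<omega> \<in> trees W x. motion \<omega> u \<in> B} | u B. u \<in> U \<and> B \<in> sets (path_space J W)} \<union>
      {{\<omega> \<in> trees W x. lifetime \<omega> u \<le> c} | u c. u \<in> U} \<union>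
      {{\<omega> \<in> trees W x. offspring \<omega> u = a} | u a. u \<in> U})"
  by (auto simp: tree_events_def intro!: sets_measure_of)

lemma sets_tree_events_mono: "U \<subseteq> V \<Longrightarrow> sets (tree_events J W x U) \<subseteq> sets (tree_events J W x V)"
  unfolding sets_tree_events by (intro sigma_sets_mono' Un_mono) auto

lemma tree_events_le: "U \<subseteq> V \<Longrightarrow> f \<in> tree_events J W x U \<rightarrow>\<^sub>M N \<Longrightarrow> f \<in> tree_events J W x V \<rightarrow>\<^sub>M N"
  using sets_tree_events_mono[of U V J W x] by (auto simp: measurable_def)

lemma measurable_motion: "u \<in> U \<Longrightarrow> (\<lambda>\<omega>. motion \<omega> u) \<in> tree_events J W x U \<rightarrow>\<^sub>M path_space J W"
proof (rule measurableI)
  fix B assume "u \<in> U" "B \<in> sets (path_space J W)"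
  then have "{\<omega> \<in> trees W x. motion \<omega> u \<in> B} \<in> sets (tree_events J W x U)"
    unfolding sets_tree_events
    by (intro sigma_sets.Basic, intro UnI1 CollectI exI[of _ u] exI[of _ B]) simp
  then show "(\<lambda>\<omega>. motion \<omega> u) -` B \<inter> space (tree_events J W x U) \<in> sets (tree_events J W x U)"
    by (rule back_subst[of "\<lambda>A. A \<in> _"]) auto
qed (simp add: trees_motion)

lemma measurable_lifetime: "u \<in> U \<Longrightarrow> (\<lambda>\<omega>. lifetime \<omega> u) \<in> borel_measurable (tree_events J W x U)"
proof (rule borel_measurableI_le)
  fix c assume u: "u \<in> U"
  show "{\<omega> \<in> space (tree_events J W x U). lifetime \<omega> u \<le> c} \<in> sets (tree_events J W x U)"
    unfolding sets_tree_events space_tree_events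
    by (intro sigma_sets.Basic, rule UnI1, rule UnI2) (auto intro!: exI[of _ u] exI[of _ c] simp: u)
qed

lemma measurable_offspring:
  assumes "u \<in> U"
  shows "(\<lambda>\<omega>. offspring \<omega> u) \<in> tree_events J W x U \<rightarrow>\<^sub>M count_space UNIV"
proof -
  have "(\<lambda>\<omega>. offspring \<omega> u) -` {a} \<inter> space (tree_events J W x U) \<in> sets (tree_events J W x U)" for a
  proof -
    have "{\<omega> \<in> trees W x. offspring \<omega> u = a} \<in> sets (tree_events J W x U)"
      unfolding sets_tree_events using assms
      by (intro sigma_sets.Basic, intro UnI2 CollectI exI[of _ u] exI[of _ a]) simp
    then show ?thesis by (rule back_subst[of "\<lambda>A. A \<in> _"]) auto
  qed
  then show ?thesis by (simp add: measurable_count_space_eq2_countable)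
qed

lemma measurable_birth:
  assumes "{u. strict_prefix u v} \<subseteq> U"
  shows "(\<lambda>\<omega>. birth \<omega> v) \<in> borel_measurable (tree_events J W x U)"
  unfolding birth_def
proof (intro borel_measurable_sum measurable_lifetime)
  fix n assume "n \<in> {..<length v}"
  then have "strict_prefix (take n v) v"
    by (auto simp: strict_prefix_def take_is_prefix)
  then show "take n v \<in> U" using assms by auto
qed

lemma measurable_death:
  assumes "{u. prefix u v} \<subseteq> U"
  shows "(\<lambda>\<omega>. death \<omega> v) \<in> borel_measurable (tree_events J W x U)"
  unfolding death_def
  by (intro borel_measurable_add measurable_birth measurable_lifetime) (use assms in auto)

lemma measurable_born:
  assumes "{u. strict_prefix u v} \<subseteq> U"
  shows "Measurable.pred (tree_events J W x U) (\<lambda>\<omega>. born \<omega> v)"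
  unfolding born_def
proof (rule pred_intros_countable, rule pred_intros_imp'(1), rule pred_intros_logic)
  fix n assume "n < length v"
  then have "strict_prefix (take n v) v"
    by (auto simp: strict_prefix_def take_is_prefix)
  then have u: "take n v \<in> U" using assms by auto
  show "Measurable.pred (tree_events J W x U) (\<lambda>\<omega>. lifetime \<omega> (take n v) < \<infinity>)"
    using measurable_lifetime[OF u, of J W x] by measurable
  show "Measurable.pred (tree_events J W x U) (\<lambda>\<omega>. v ! n < offspring \<omega> (take n v))"
    using measurable_compose[OF measurable_offspring[OF u, of J W x], of "\<lambda>a. v ! n < a" "count_space UNIV"]
    by simp
qed

lemma measurable_alive:
  assumes "{u. prefix u v} \<subseteq> U"
  shows "Measurable.pred (tree_events J W x U) (\<lambda>\<omega>. v \<in> alive \<omega> t)"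
proof -
  have [measurable]: "Measurable.pred (tree_events J W x U) (\<lambda>\<omega>. born \<omega> v)"
    "(\<lambda>\<omega>. birth \<omega> v) \<in> borel_measurable (tree_events J W x U)"
    "(\<lambda>\<omega>. death \<omega> v) \<in> borel_measurable (tree_events J W x U)"
    using assms by (auto intro!: measurable_born measurable_birth measurable_death)
  show ?thesis unfolding alive_def by measurable
qed

context paths
begin

lemma measurable_start:
  assumes "v \<noteq> [] \<Longrightarrow> butlast v \<in> U" "x \<in> space J"
  shows "(\<lambda>\<omega>. start x \<omega> v) \<in> tree_events J W x U \<rightarrow>\<^sub>M J"
proof (cases "v = []")
  case False
  then have "(\<lambda>\<omega>. motion \<omega> (butlast v) (enn2real (lifetime \<omega> (butlast v)))) \<in> tree_events J W x U \<rightarrow>\<^sub>M J"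
    using assms
    by (intro eval_measurable2 measurable_motion borel_measurable_enn2real measurable_lifetime) auto
  then show ?thesis using False by (simp add: start_def)
qed (simp add: start_def assms)

text \<open>The sigma-algebra is abstract because the lemma serves \<open>tree_events\<close> as
  well as the information available before the lifetime of \<open>v\<close> is drawn; so only
  lifetimes of strict ancestors may be assumed measurable. Restriction to born labels puts the
  values in \<open>W\<close>.\<close>

lemma measurable_position_general:
  assumes "space M = trees W x"
    and "\<And>u. strict_prefix u v \<Longrightarrow> (\<lambda>\<omega>. lifetime \<omega> u) \<in> borel_measurable M"
    and "\<And>u. prefix u v \<Longrightarrow> (\<lambda>\<omega>. motion \<omega> u) \<in> M \<rightarrow>\<^sub>M PS"
  shows "(\<lambda>\<omega>. position \<omega> v) \<in> restrict_space M {\<omega>. born \<omega> v} \<rightarrow>\<^sub>M PS"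
  using assms(2,3)
proof (induction v rule: rev_induct)
  case Nil
  then show ?case
    by (simp add: position_Nil measurable_restrict_space1)
next
  case (snoc j v)
  let ?M = "restrict_space M {\<omega>. born \<omega> (v @ [j])}"
  have l: "(\<lambda>\<omega>. lifetime \<omega> u) \<in> borel_measurable M" if "prefix u v" for u
    by (rule snoc.prems(1)) (use that in \<open>auto simp: strict_prefix_def\<close>)
  have "(\<lambda>\<omega>. death \<omega> v) \<in> borel_measurable M"
    unfolding death_def birth_def
    by (intro borel_measurable_add borel_measurable_sum l) (auto simp: take_is_prefix)
  then have d: "(\<lambda>\<omega>. enn2real (death \<omega> v)) \<in> borel_measurable ?M"
    by (intro measurable_restrict_space1 borel_measurable_enn2real)
  show ?case
  proof (rule measurable_path_spaceI)
    fix \<omega> assume "\<omega> \<in> space ?M"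
    then show "position \<omega> (v @ [j]) \<in> W"
      using position_in_paths[OF admissible, of \<omega> x] by (simp add: space_restrict_space assms(1))
  next
    fix s :: real assume s: "0 \<le> s"
    have p: "(\<lambda>\<omega>. position \<omega> v) \<in> ?M \<rightarrow>\<^sub>M PS"
    proof (rule measurable_restrict_mono)
      show "(\<lambda>\<omega>. position \<omega> v) \<in> restrict_space M {\<omega>. born \<omega> v} \<rightarrow>\<^sub>M PS"
        by (rule snoc.IH) (use l snoc.prems(2) in \<open>auto simp: strict_prefix_def\<close>)
    qed (auto simp: born_snoc)
    have m: "(\<lambda>\<omega>. motion \<omega> (v @ [j])) \<in> ?M \<rightarrow>\<^sub>M PS"
      using snoc.prems(2) by (intro measurable_restrict_space1) simp
    have "(\<lambda>\<omega>. motion \<omega> (v @ [j]) (max 0 (s - enn2real (death \<omega> v)))) \<in> ?M \<rightarrow>\<^sub>M J"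
      by (rule eval_measurable2) (use d m in \<open>auto intro!: borel_measurable_max\<close>)
    moreover have "(\<lambda>\<omega>. position \<omega> v s) \<in> ?M \<rightarrow>\<^sub>M J"
      using measurable_compose[OF p eval_measurable[OF s]] .
    ultimately have "(\<lambda>\<omega>. if s < enn2real (death \<omega> v) then position \<omega> v s
       else motion \<omega> (v @ [j]) (max 0 (s - enn2real (death \<omega> v)))) \<in> ?M \<rightarrow>\<^sub>M J"
      by (intro measurable_If borel_measurable_less borel_measurable_const d)
    then show "(\<lambda>\<omega>. position \<omega> (v @ [j]) s) \<in> ?M \<rightarrow>\<^sub>M J"
      by (rule measurable_cong[THEN iffD1, rotated])
        (auto simp: space_restrict_space assms(1) position_snoc[of _ W x])
  qed
qed

lemma measurable_position:
  assumes "{u. prefix u v} \<subseteq> U"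
  shows "(\<lambda>\<omega>. position \<omega> v) \<in> restrict_space (tree_events J W x U) {\<omega>. born \<omega> v} \<rightarrow>\<^sub>M PS"
  by (intro measurable_position_general measurable_lifetime measurable_motion) (use assms in auto)

end

section \<open>The filtrations inside the algebra of all events\<close>

lemma space_branching_filtration [simp]: "space (branching_filtration J W x t) = trees W x"
  by (simp add: branching_filtration_def space_measure_of_conv)

lemma sets_branching_filtration:
  "sets (branching_filtration J W x t) = sigma_sets (trees W x)
     {{\<omega> \<in> trees W x. v \<in> alive \<omega> s \<and> position \<omega> v s \<in> B} | v s B.
        0 \<le> s \<and> s \<le> t \<and> B \<in> sets J}"
  by (auto simp: branching_filtration_def intro!: sets_measure_of)

lemma space_spine_algebra [simp]: "space (spine_algebra J W x k) = trees W x"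
  by (simp add: spine_algebra_def space_measure_of_conv)

lemma sets_spine_algebra:
  "sets (spine_algebra J W x k) = sigma_sets (trees W x) (sets (tree_algebra J W x) \<union>
      {{\<omega> \<in> trees W x. choice \<omega> i v = c} | i v c. i < k})"
  unfolding spine_algebra_def
  by (intro sets_measure_of) (use sets.space_closed[of "tree_algebra J W x"] in auto)

lemma space_spine_filtration [simp]: "space (spine_filtration J W x k t) = trees W x"
  by (simp add: spine_filtration_def space_measure_of_conv)

lemma sets_spine_filtration:
  "sets (spine_filtration J W x k t) = sigma_sets (trees W x) (sets (branching_filtration J W x t) \<union>
      {{\<omega> \<in> trees W x. spine \<omega> i s = z} | i s z. i < k \<and> 0 \<le> s \<and> s \<le> t})"
  unfolding spine_filtration_def
  by (intro sets_measure_of) (use sets.space_closed[of "branching_filtration J W x t"] in auto)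

lemma branching_filtration_le_spine:
  "sets (branching_filtration J W x t) \<subseteq> sets (spine_filtration J W x k t)"
  unfolding sets_spine_filtration by (auto intro: sigma_sets.Basic)

lemma tree_algebra_le_spine: "sets (tree_algebra J W x) \<subseteq> sets (spine_algebra J W x k)"
  unfolding sets_spine_algebra by (auto intro: sigma_sets.Basic)

context paths
begin

lemma branching_filtration_le: "sets (branching_filtration J W x t) \<subseteq> sets (tree_algebra J W x)"
  unfolding sets_branching_filtration
proof (rule sigma_sets_le_sets_iff[THEN iffD2] sets.sigma_sets_subset'; (intro subsetI)?)
  fix A assume "A \<in> {{\<omega> \<in> trees W x. v \<in> alive \<omega> s \<and> position \<omega> v s \<in> B} | v s B.
        0 \<le> s \<and> s \<le> t \<and> B \<in> sets J}"
  then obtain v s B where A: "A = {\<omega> \<in> trees W x. v \<in> alive \<omega> s \<and> position \<omega> v s \<in> B}"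
      "0 \<le> s" "B \<in> sets J" by auto
  let ?M = "restrict_space (tree_algebra J W x) {\<omega>. born \<omega> v}"
  have "(\<lambda>\<omega>. position \<omega> v s) \<in> ?M \<rightarrow>\<^sub>M J"
    using measurable_compose[OF measurable_position eval_measurable[OF A(2)]] by simp
  from measurable_sets[OF this A(3)]
  have 1: "(\<lambda>\<omega>. position \<omega> v s) -` B \<inter> space ?M \<in> sets (tree_algebra J W x)"
    using measurable_born[where v=v and U=UNIV and J=J and W=W and x=x]
    by (subst (asm) sets_restrict_space_iff) (auto simp: pred_def Int_def conj_commute)
  have 2: "{\<omega> \<in> space (tree_algebra J W x). v \<in> alive \<omega> s} \<in> sets (tree_algebra J W x)"
    using measurable_alive[where v=v and U=UNIV and J=J and W=W and x=x and t=s] by (simp add: pred_def)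
  have "A = ((\<lambda>\<omega>. position \<omega> v s) -` B \<inter> space ?M) \<inter> {\<omega> \<in> space (tree_algebra J W x). v \<in> alive \<omega> s}"
    using A by (auto simp: space_restrict_space alive_def)
  then show "A \<in> sets (tree_algebra J W x)" using 1 2 by auto
qed (use sets.top[of "tree_algebra J W x"] in auto)

lemma alive_sets_spine_algebra: "{\<omega> \<in> trees W x. v \<in> alive \<omega> s} \<in> sets (spine_algebra J W x k)"
proof -
  have "{\<omega> \<in> space (tree_algebra J W x). v \<in> alive \<omega> s} \<in> sets (tree_algebra J W x)"
    using measurable_alive[where v=v and U=UNIV and J=J and W=W and x=x and t=s] by (simp add: pred_def)
  then show ?thesis by (simp add: subsetD[OF tree_algebra_le_spine])
qed

lemma spine_Some_sets:
  assumes "i < k"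
  shows "{\<omega> \<in> trees W x. spine \<omega> i s = Some v} \<in> sets (spine_algebra J W x k)"
proof -
  have c: "{\<omega> \<in> space (spine_algebra J W x k). choice \<omega> i u = c} \<in> sets (spine_algebra J W x k)" for u c
    unfolding sets_spine_algebra using assms by (auto intro!: sigma_sets.Basic)
  have "{\<omega> \<in> space (spine_algebra J W x k). \<forall>n\<in>{..<length v}. choice \<omega> i (take n v) = v ! n}
      \<in> sets (spine_algebra J W x k)"
    by (rule sets.sets_Collect_finite_All) (use c in auto)
  from sets.Int[OF this alive_sets_spine_algebra[of x v s]]
  show ?thesis
    by (rule back_subst[of "\<lambda>A. A \<in> _"]) (auto simp: spine_eq_Some follows_def)
qed

lemma spine_filtration_le: "sets (spine_filtration J W x k t) \<subseteq> sets (spine_algebra J W x k)"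
  unfolding sets_spine_filtration
proof (rule sets.sigma_sets_subset', intro Un_least subsetI)
  fix A assume "A \<in> {{\<omega> \<in> trees W x. spine \<omega> i s = z} | i s z. i < k \<and> 0 \<le> s \<and> s \<le> t}"
  then obtain i s z where A: "A = {\<omega> \<in> trees W x. spine \<omega> i s = z}" "i < k" by auto
  show "A \<in> sets (spine_algebra J W x k)"
  proof (cases z)
    case None
    \<comment> \<open>The graveyard event is the complement of countably many events, one for each
      label.\<close>
    have "(\<Union>v. {\<omega> \<in> trees W x. spine \<omega> i s = Some v}) \<in> sets (spine_algebra J W x k)"
      using spine_Some_sets[OF A(2)] by (intro sets.countable_UN) blast
    moreover have "A = space (spine_algebra J W x k) - (\<Union>v. {\<omega> \<in> trees W x. spine \<omega> i s = Some v})"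
      using A None by auto
    ultimately show ?thesis by (simp del: space_spine_algebra)
  qed (use spine_Some_sets A in auto)
next
  fix A assume "A \<in> sets (branching_filtration J W x t)"
  then show "A \<in> sets (spine_algebra J W x k)"
    by (rule subsetD[OF order_trans[OF branching_filtration_le tree_algebra_le_spine]])
qed (use sets.top[of "spine_algebra J W x k"] in auto)

end

section \<open>Adaptedness of the change of measure\<close>

lemma birth_upto_eq: "0 \<le> t \<Longrightarrow> birth \<omega> v \<le> ennreal t \<Longrightarrow> birth_upto \<omega> t v = enn2real (birth \<omega> v)"
  by (simp add: birth_upto_def min_absorb1)

lemma ennreal_birth_upto: "birth \<omega> v \<le> ennreal t \<Longrightarrow> ennreal (birth_upto \<omega> t v) = birth \<omega> v"
  by (simp add: birth_upto_def min_absorb1 le_less_trans[OF _ ennreal_less_top])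

lemma birth_upto_bounds: "0 \<le> t \<Longrightarrow> 0 \<le> birth_upto \<omega> t v \<and> birth_upto \<omega> t v \<le> t"
  unfolding birth_upto_def
  by (metis enn2real_ennreal enn2real_mono enn2real_nonneg ennreal_less_top min.cobounded2)

lemma death_upto_bounds: "0 \<le> t \<Longrightarrow> 0 \<le> death_upto \<omega> t v \<and> death_upto \<omega> t v \<le> t"
  unfolding death_upto_def
  by (metis enn2real_ennreal enn2real_mono enn2real_nonneg ennreal_less_top min.cobounded2)

lemma death_upto_alive: "0 \<le> t \<Longrightarrow> v \<in> alive \<omega> t \<Longrightarrow> death_upto \<omega> t v = t"
  by (simp add: death_upto_def min_absorb2 aliveD(3) less_imp_le)

lemma death_upto_snoc: "death_upto \<omega> t v = birth_upto \<omega> t (v @ [j])"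
  by (simp add: death_upto_def birth_upto_def)

lemma strict_prefix_snocE:
  assumes "strict_prefix v u"
  obtains j where "prefix (v @ [j]) u"
  using assms by (elim strict_prefixE') (simp add: prefix_def)

lemma alive_birth_le: "prefix v u \<Longrightarrow> u \<in> alive \<omega> t \<Longrightarrow> birth \<omega> v \<le> ennreal t"
  using birth_prefix_mono[of v u \<omega>] aliveD(2)[of u \<omega> t] by (rule order_trans)

context paths
begin

abbreviation "BF \<equiv> branching_filtration J W"
text \<open>On the survival of \<open>u\<close>, the births, deaths and numbers of children of its
  strict ancestors can be recovered from who is alive up to time \<open>t\<close>.\<close>

abbreviation "BFA x t u \<equiv> restrict_space (branching_filtration J W x t) {\<omega>. u \<in> alive \<omega> t}"

lemma position_space: "\<omega> \<in> trees W x \<Longrightarrow> born \<omega> v \<Longrightarrow> 0 \<le> s \<Longrightarrow> position \<omega> v s \<in> space J"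
  using position_in_paths[OF admissible] path_in_space by blast

lemma alive_position_sets:
  assumes "0 \<le> s" "s \<le> t" "B \<in> sets J"
  shows "{\<omega> \<in> trees W x. v \<in> alive \<omega> s \<and> position \<omega> v s \<in> B} \<in> sets (BF x t)"
  unfolding sets_branching_filtration using assms by (intro sigma_sets.Basic) blast

lemma alive_sets:
  assumes "0 \<le> s" "s \<le> t"
  shows "{\<omega> \<in> trees W x. v \<in> alive \<omega> s} \<in> sets (BF x t)"
proof -
  have "{\<omega> \<in> trees W x. v \<in> alive \<omega> s} = {\<omega> \<in> trees W x. v \<in> alive \<omega> s \<and> position \<omega> v s \<in> space J}"
    using position_space assms by (auto dest: aliveD(1))
  then show ?thesis using alive_position_sets[OF assms sets.top[of J]] by simp
qed

lemma space_BFA: "space (BFA x t u) = {\<omega> \<in> trees W x. u \<in> alive \<omega> t}"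
  by (auto simp: space_restrict_space)

lemma sets_BFA:
  assumes "0 \<le> t" "A \<in> sets (BF x t)"
  shows "{\<omega> \<in> space (BFA x t u). \<omega> \<in> A} \<in> sets (BFA x t u)"
proof -
  have "{\<omega> \<in> space (BFA x t u). \<omega> \<in> A} = {\<omega>. u \<in> alive \<omega> t} \<inter> A"
    using sets.sets_into_space[OF assms(2)] by (auto simp: space_BFA)
  then show ?thesis using assms by (auto simp: sets_restrict_space)
qed

lemma alive_sets_BFA:
  assumes "0 \<le> s" "s \<le> t"
  shows "{\<omega> \<in> space (BFA x t u). v \<in> alive \<omega> s} \<in> sets (BFA x t u)"
proof -
  have "{\<omega> \<in> space (BFA x t u). \<omega> \<in> {\<omega> \<in> trees W x. v \<in> alive \<omega> s}} \<in> sets (BFA x t u)"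
    using assms by (intro sets_BFA alive_sets) auto
  then show ?thesis by (rule back_subst[of "\<lambda>A. A \<in> _"]) (auto simp: space_BFA)
qed

text \<open>At time \<open>s\<close> the path of \<open>u\<close> is at the position of its ancestor
  alive then, one of finitely many prefixes; so each event is a finite union of traces of
  generators.\<close>

lemma position_adapted:
  assumes "0 \<le> t"
  shows "(\<lambda>\<omega>. position \<omega> u) \<in> BFA x t u \<rightarrow>\<^sub>M PF t"
proof (rule measurable_path_filtrationI)
  fix \<omega> assume "\<omega> \<in> space (BFA x t u)"
  then show "position \<omega> u \<in> W"
    using position_in_paths[OF admissible] by (auto simp: space_BFA dest: aliveD)
next
  fix s :: real assume s: "0 \<le> s" "s \<le> t"
  show "(\<lambda>\<omega>. position \<omega> u s) \<in> BFA x t u \<rightarrow>\<^sub>M J"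
  proof (rule measurableI)
    fix \<omega> assume "\<omega> \<in> space (BFA x t u)"
    then show "position \<omega> u s \<in> space J"
      using position_space s by (auto simp: space_BFA dest: aliveD)
  next
    fix B assume B: "B \<in> sets J"
    let ?E = "\<lambda>v. {\<omega> \<in> space (BFA x t u). \<omega> \<in> {\<omega> \<in> trees W x. v \<in> alive \<omega> s \<and> position \<omega> v s \<in> B}}"
    have "(\<Union>v\<in>set (prefixes u). ?E v) \<in> sets (BFA x t u)"
      using assms s B by (intro sets.finite_UN sets_BFA alive_position_sets) auto
    moreover have "(\<lambda>\<omega>. position \<omega> u s) -` B \<inter> space (BFA x t u) = (\<Union>v\<in>set (prefixes u). ?E v)"
    proof (intro set_eqI iffI)
      fix \<omega> assume "\<omega> \<in> (\<lambda>\<omega>. position \<omega> u s) -` B \<inter> space (BFA x t u)"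
      then have \<omega>: "\<omega> \<in> trees W x" "u \<in> alive \<omega> t" "position \<omega> u s \<in> B" by (auto simp: space_BFA)
      have "ennreal s < death \<omega> u"
        using aliveD(3)[OF \<omega>(2)] s by (meson ennreal_leI le_less_trans)
      from alive_ancestor[OF aliveD(1)[OF \<omega>(2)] this]
      obtain v where v: "prefix v u" "v \<in> alive \<omega> s" by blast
      then have "position \<omega> v s = position \<omega> u s"
        using \<omega> by (intro position_prefix) (auto dest: aliveD simp: less_imp_le)
      then show "\<omega> \<in> (\<Union>v\<in>set (prefixes u). ?E v)" using v \<omega> by (auto simp: space_BFA)
    next
      fix \<omega> assume "\<omega> \<in> (\<Union>v\<in>set (prefixes u). ?E v)"
      then obtain v where \<omega>: "\<omega> \<in> trees W x" "u \<in> alive \<omega> t" "position \<omega> v s \<in> B"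
        and v: "prefix v u" "v \<in> alive \<omega> s" by (auto simp: space_BFA)
      have "position \<omega> v s = position \<omega> u s"
        using \<omega> v by (intro position_prefix) (auto dest: aliveD simp: less_imp_le)
      then show "\<omega> \<in> (\<lambda>\<omega>. position \<omega> u s) -` B \<inter> space (BFA x t u)" using \<omega> by (auto simp: space_BFA)
    qed
    ultimately show "(\<lambda>\<omega>. position \<omega> u s) -` B \<inter> space (BFA x t u) \<in> sets (BFA x t u)" by simp
  qed
qed

text \<open>\<open>v\<close> is born by time \<open>a\<close> exactly when the ancestor of
  \<open>u\<close> alive at \<open>a\<close> is \<open>v\<close> or one of its descendants.\<close>

lemma birth_upto_adapted:
  assumes t: "0 \<le> t" and vu: "prefix v u"
  shows "(\<lambda>\<omega>. birth_upto \<omega> t v) \<in> borel_measurable (BFA x t u)"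
  unfolding borel_measurable_iff_le
proof
  fix a :: real
  consider "a < 0" | "0 \<le> a" "a \<le> t" | "t < a" by linarith
  then show "{\<omega> \<in> space (BFA x t u). birth_upto \<omega> t v \<le> a} \<in> sets (BFA x t u)"
  proof cases
    case 1
    have "\<not> birth_upto \<omega> t v \<le> a" for \<omega> :: "'a tree" using birth_upto_bounds[OF t, of \<omega> v] 1 by linarith
    then show ?thesis by simp
  next
    case 3
    have "birth_upto \<omega> t v \<le> a" for \<omega> :: "'a tree" using birth_upto_bounds[OF t, of \<omega> v] 3 by linarith
    then show ?thesis by simp
  next
    case 2
    have "(\<Union>w\<in>set (filter (prefix v) (prefixes u)). {\<omega> \<in> space (BFA x t u). w \<in> alive \<omega> a})
        \<in> sets (BFA x t u)"
      using 2 by (intro sets.finite_UN alive_sets_BFA finite_set)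
    moreover have "{\<omega> \<in> space (BFA x t u). birth_upto \<omega> t v \<le> a} =
       (\<Union>w\<in>set (filter (prefix v) (prefixes u)). {\<omega> \<in> space (BFA x t u). w \<in> alive \<omega> a})"
    proof -
      have "birth_upto \<omega> t v \<le> a \<longleftrightarrow> (\<exists>w. prefix w u \<and> prefix v w \<and> w \<in> alive \<omega> a)"
        if \<omega>: "\<omega> \<in> space (BFA x t u)" for \<omega>
      proof -
        have u: "u \<in> alive \<omega> t" using \<omega> by (simp add: space_BFA)
        have "birth_upto \<omega> t v \<le> a \<longleftrightarrow> ennreal (birth_upto \<omega> t v) \<le> ennreal a"
          using 2 by (subst ennreal_le_iff) auto
        then have eq: "birth_upto \<omega> t v \<le> a \<longleftrightarrow> birth \<omega> v \<le> ennreal a"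
          using ennreal_birth_upto[OF alive_birth_le[OF vu u]] by simp
        show ?thesis
        proof
          assume "birth_upto \<omega> t v \<le> a"
          then have b: "birth \<omega> v \<le> ennreal a" using eq by simp
          have "ennreal a < death \<omega> u"
            using aliveD(3)[OF u] 2 by (meson ennreal_leI le_less_trans)
          from alive_ancestor[OF aliveD(1)[OF u] this]
          obtain w where w: "prefix w u" "w \<in> alive \<omega> a" by blast
          have "prefix v w"
          proof (rule ccontr)
            assume "\<not> prefix v w"
            then have "strict_prefix w v" using prefix_same_cases[OF vu w(1)] by (auto simp: strict_prefix_def)
            from death_le_birth[OF this, of \<omega>] b have "death \<omega> w \<le> ennreal a" by (rule order_trans)
            then show False using aliveD(3)[OF w(2)] by simp
          qed
          then show "\<exists>w. prefix w u \<and> prefix v w \<and> w \<in> alive \<omega> a" using w by blast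
        next
          assume "\<exists>w. prefix w u \<and> prefix v w \<and> w \<in> alive \<omega> a"
          then show "birth_upto \<omega> t v \<le> a" using eq alive_birth_le by blast
        qed
      qed
      then show ?thesis by auto
    qed
    ultimately show ?thesis by simp
  qed
qed

lemma death_upto_adapted:
  assumes t: "0 \<le> t" and vu: "prefix v u"
  shows "(\<lambda>\<omega>. death_upto \<omega> t v) \<in> borel_measurable (BFA x t u)"
proof (cases "v = u")
  case True
  have "(\<lambda>\<omega>. t) \<in> borel_measurable (BFA x t u)" by simp
  then show ?thesis
    by (rule measurable_cong[THEN iffD1, rotated]) (simp add: True death_upto_alive t space_BFA)
next
  case False
  then have "strict_prefix v u" using vu by (simp add: strict_prefix_def)
  then obtain j where "prefix (v @ [j]) u" by (rule strict_prefix_snocE)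
  from birth_upto_adapted[OF t this] show ?thesis by (simp add: death_upto_snoc[of _ _ _ j])
qed

text \<open>A strict ancestor of a living particle has died by time \<open>t\<close>, so its child
  number \<open>j\<close> exists iff that child is seen alive at some time up to \<open>t\<close>.
  Its lifetime is positive, so countably many observation times suffice.\<close>

lemma offspring_adapted:
  assumes t: "0 \<le> t" and vu: "strict_prefix v u"
  shows "(\<lambda>\<omega>. offspring \<omega> v) \<in> BFA x t u \<rightarrow>\<^sub>M count_space UNIV"
proof -
  \<comment> \<open>A child born exactly at \<open>t\<close> is alive at no earlier time, so
    \<open>t\<close> is added to the rationals.\<close>
  let ?T = "insert t (\<rat> \<inter> {0..t})"
  have *: "{\<omega> \<in> space (BFA x t u). j < offspring \<omega> v} =
     (\<Union>s\<in>?T. {\<omega> \<in> space (BFA x t u). v @ [j] \<in> alive \<omega> s})" for j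
  proof (intro set_eqI iffI)
    fix \<omega> assume "\<omega> \<in> {\<omega> \<in> space (BFA x t u). j < offspring \<omega> v}"
    then have \<omega>: "\<omega> \<in> trees W x" "u \<in> alive \<omega> t" "j < offspring \<omega> v" by (auto simp: space_BFA)
    have bv: "born \<omega> v" using born_prefix[of v u \<omega>] vu aliveD(1)[OF \<omega>(2)] by (auto simp: strict_prefix_def)
    have l: "lifetime \<omega> v < \<infinity>" using born_strict_prefix(1)[OF vu aliveD(1)[OF \<omega>(2)]] .
    have b: "born \<omega> (v @ [j])" using bv l \<omega> by (simp add: born_snoc)
    have le: "death \<omega> v \<le> ennreal t"
      using death_le_birth[OF vu] aliveD(2)[OF \<omega>(2)] by (rule order_trans)
    have lt: "death \<omega> v < death \<omega> (v @ [j])" using birth_less_death[OF \<omega>(1) b] by simp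
    obtain d where d: "death \<omega> v = ennreal d" "0 \<le> d" "d \<le> t"
      using le t by (cases "death \<omega> v") (auto simp: top_unique)
    have "\<exists>s\<in>?T. v @ [j] \<in> alive \<omega> s"
    proof (cases "ennreal t < death \<omega> (v @ [j])")
      case True
      then show ?thesis using b le by (auto simp: alive_def)
    next
      case False
      then obtain d' where d': "death \<omega> (v @ [j]) = ennreal d'" "0 \<le> d'" "d' \<le> t"
        using t by (cases "death \<omega> (v @ [j])") (auto simp: top_unique not_less)
      then have "d < d'" using lt d by (simp add: ennreal_less_iff)
      then obtain q where q: "q \<in> \<rat>" "d < q" "q < d'" using Rats_dense_in_real by blast
      then have "v @ [j] \<in> alive \<omega> q"
        using b d d' by (auto simp: alive_def ennreal_less_iff intro!: ennreal_leI)
      then show ?thesis using q d d' by (intro bexI[of _ q]) auto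
    qed
    then show "\<omega> \<in> (\<Union>s\<in>?T. {\<omega> \<in> space (BFA x t u). v @ [j] \<in> alive \<omega> s})"
      using \<omega> by (auto simp: space_BFA)
  next
    fix \<omega> assume "\<omega> \<in> (\<Union>s\<in>?T. {\<omega> \<in> space (BFA x t u). v @ [j] \<in> alive \<omega> s})"
    then show "\<omega> \<in> {\<omega> \<in> space (BFA x t u). j < offspring \<omega> v}"
      by (auto dest!: aliveD(1) simp: born_snoc)
  qed
  have m: "{\<omega> \<in> space (BFA x t u). j < offspring \<omega> v} \<in> sets (BFA x t u)" for j
    unfolding * using t by (intro sets.countable_UN'' alive_sets_BFA) (auto intro: countable_rat)
  have "(\<lambda>\<omega>. offspring \<omega> v) -` {a} \<inter> space (BFA x t u) \<in> sets (BFA x t u)" for a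
  proof -
    \<comment> \<open>The available events are \<open>j < offspring \<omega> v\<close>; equality
      with \<open>a\<close> is agreement with \<open>j < a\<close> for every
      \<open>j\<close>.\<close>
    have "{\<omega> \<in> space (BFA x t u). \<forall>j. j < offspring \<omega> v \<longleftrightarrow> j < a} \<in> sets (BFA x t u)"
      using m by (intro sets.sets_Collect_countable_All) (auto intro!: sets.sets_Collect_imp simp: iff_conv_conj_imp intro: sets.sets_Collect_conj sets.sets_Collect_const)
    then show ?thesis
      by (rule back_subst[of "\<lambda>A. A \<in> _"]) (auto intro: nat_less_induct, metis linorder_neqE_nat order_less_irrefl)
  qed
  then show ?thesis by (simp add: measurable_count_space_eq2_countable)
qed

text \<open>During its life \<open>v\<close> has the same path as \<open>u\<close>, and that path is
  measurable jointly in time and tree. With the interval written as an indicator, the integral is a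
  parameter integral over the whole line.\<close>

lemma rate_adapted:
  fixes f :: "'a \<Rightarrow> real"
  assumes t: "0 \<le> t" and vu: "prefix v u" and f: "f \<in> borel_measurable J"
  shows "(\<lambda>\<omega>. LBINT s:{birth_upto \<omega> t v..death_upto \<omega> t v}. f (position \<omega> v s)) \<in> borel_measurable (BFA x t u)"
proof -
  note [measurable] = birth_upto_adapted[OF t vu, of x] death_upto_adapted[OF t vu, of x]
  have "(\<lambda>(\<omega>, s). (s, position \<omega> u)) \<in> BFA x t u \<Otimes>\<^sub>M borel \<rightarrow>\<^sub>M borel \<Otimes>\<^sub>M PF t"
    unfolding split_beta
    by (intro measurable_Pair measurable_snd measurable_compose[OF measurable_fst position_adapted[OF t]])
  from measurable_compose[OF measurable_compose[OF this eval_joint_PF[OF t]] f]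
  have [measurable]: "(\<lambda>z. f (position (fst z) u (max 0 (min (snd z) t)))) \<in> borel_measurable (BFA x t u \<Otimes>\<^sub>M borel)"
    by (simp add: split_beta)
  have "(\<lambda>z. if birth_upto (fst z) t v \<le> snd z \<and> snd z \<le> death_upto (fst z) t v
      then f (position (fst z) u (max 0 (min (snd z) t))) else 0)
    \<in> borel_measurable (BFA x t u \<Otimes>\<^sub>M borel)"
    by measurable
  then have "(\<lambda>(\<omega>, s). if birth_upto \<omega> t v \<le> s \<and> s \<le> death_upto \<omega> t v
      then f (position \<omega> u (max 0 (min s t))) else 0) \<in> borel_measurable (BFA x t u \<Otimes>\<^sub>M lborel)"
    by (simp add: split_beta cong: measurable_cong_sets sets_pair_measure_cong)
  from lborel.borel_measurable_lebesgue_integral[OF this]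
  show ?thesis
  proof (rule measurable_cong[THEN iffD1, rotated])
    fix \<omega> assume "\<omega> \<in> space (BFA x t u)"
    then have \<omega>: "\<omega> \<in> trees W x" "u \<in> alive \<omega> t" by (auto simp: space_BFA)
    have "position \<omega> v s = position \<omega> u (max 0 (min s t))"
      if s: "s \<in> {birth_upto \<omega> t v..death_upto \<omega> t v}" for s
    proof -
      have st: "0 \<le> s" "s \<le> t"
        using s birth_upto_bounds[OF t, of \<omega> v] death_upto_bounds[OF t, of \<omega> v] by auto
      have "ennreal s \<le> min (death \<omega> v) (ennreal t)"
        using s unfolding death_upto_def
        by (metis atLeastAtMost_iff ennreal_enn2real ennreal_leI ennreal_less_top min.cobounded2 order_le_less_trans)
      then have "position \<omega> v s = position \<omega> u s"
        using \<omega> vu by (intro position_prefix) (auto dest: aliveD)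
      then show ?thesis using st by simp
    qed
    then show "(\<integral>s. (if birth_upto \<omega> t v \<le> s \<and> s \<le> death_upto \<omega> t v
      then f (position \<omega> u (max 0 (min s t))) else 0) \<partial>lborel) =
      (LBINT s:{birth_upto \<omega> t v..death_upto \<omega> t v}. f (position \<omega> v s))"
      unfolding set_lebesgue_integral_def
      by (intro Bochner_Integration.integral_cong) (auto simp: indicator_def)
  qed
qed

end

lemma moment_rate_measurable:
  assumes "R \<in> borel_measurable J" "\<And>a. (\<lambda>y. pmf (\<mu> y) a) \<in> borel_measurable J"
  shows "moment_rate R \<mu> n \<in> borel_measurable J"
proof -
  note [measurable] = assms
  have "(\<lambda>y. \<Sum>a. real a ^ n * pmf (\<mu> y) a) \<in> borel_measurable J"
    by (intro borel_measurable_suminf borel_measurable_times borel_measurable_const assms)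
  then have [measurable]: "moment \<mu> n \<in> borel_measurable J"
    unfolding moment_def[abs_def] .
  show ?thesis unfolding moment_rate_def[abs_def] by measurable
qed

section \<open>The martingale functional along ancestral lines\<close>

locale weighted_paths = paths J W for J :: "'a measure" and W +
  fixes \<zeta> :: "(real \<Rightarrow> 'a) \<Rightarrow> real \<Rightarrow> real"
  assumes zeta_progressive: "0 \<le> t \<Longrightarrow> (\<lambda>(s, w). \<zeta> w s)
        \<in> restrict_space borel {0..t} \<Otimes>\<^sub>M path_filtration J W t \<rightarrow>\<^sub>M borel"
    and zeta_nonneg: "w \<in> W \<Longrightarrow> 0 \<le> t \<Longrightarrow> 0 \<le> \<zeta> w t"
begin

lemma zeta_measurable2:
  assumes "0 \<le> t" "f \<in> borel_measurable M" "g \<in> M \<rightarrow>\<^sub>M PF t" "\<And>z. z \<in> space M \<Longrightarrow> 0 \<le> f z \<and> f z \<le> t"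
  shows "(\<lambda>z. \<zeta> (g z) (f z)) \<in> borel_measurable M"
proof -
  have "(\<lambda>(s, w). \<zeta> w (max 0 (min s t))) \<in> borel_measurable (borel \<Otimes>\<^sub>M PF t)"
    by (rule clamp_PF[of "\<lambda>s w. \<zeta> w s"]) (use zeta_progressive assms in auto)
  from measurable_compose[OF measurable_Pair[OF assms(2,3)] this]
  have "(\<lambda>z. \<zeta> (g z) (max 0 (min (f z) t))) \<in> borel_measurable M" by simp
  then show ?thesis
    by (rule measurable_cong[THEN iffD1, rotated]) (use assms(4) in \<open>auto simp: max_def min_def\<close>)
qed

lemma zeta_adapted: "0 \<le> t \<Longrightarrow> (\<lambda>w. \<zeta> w t) \<in> borel_measurable (PF t)"
  by (rule zeta_measurable2) auto

lemma zeta_cong: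
  assumes "0 \<le> t" "w \<in> W" "w' \<in> W" "\<And>s. 0 \<le> s \<Longrightarrow> s \<le> t \<Longrightarrow> w s = w' s"
  shows "\<zeta> w t = \<zeta> w' t"
  using path_filtration_cong[OF zeta_adapted[OF assms(1)] assms(2-)] by blast

text \<open>The convention that \<zeta> is \<open>0\<close> at a childless death never applies here:
  \<open>u\<close> has not died by \<open>t\<close>, its strict ancestors have children, and births
  precede deaths.\<close>

lemma particle_zeta_eq:
  assumes t: "0 \<le> t" and \<omega>: "\<omega> \<in> trees W x" "u \<in> alive \<omega> t" and vu: "prefix v u"
  shows "particle_zeta \<zeta> \<omega> v (birth_upto \<omega> t v) = \<zeta> (position \<omega> u) (birth_upto \<omega> t v)"
    and "particle_zeta \<zeta> \<omega> v (death_upto \<omega> t v) = \<zeta> (position \<omega> u) (death_upto \<omega> t v)"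
proof -
  have b: "born \<omega> v" "born \<omega> u" using born_prefix[OF vu] aliveD(1)[OF \<omega>(2)] by auto
  have W: "position \<omega> v \<in> W" "position \<omega> u \<in> W"
    using position_in_paths[OF admissible \<omega>(1)] b by auto
  have eq: "\<zeta> (position \<omega> v) s = \<zeta> (position \<omega> u) s" if "0 \<le> s" "u = v \<or> ennreal s \<le> death \<omega> v" for s
  proof (rule zeta_cong[OF that(1) W])
    fix r assume "0 \<le> r" "r \<le> s"
    then show "position \<omega> v r = position \<omega> u r"
      using that by (intro position_prefix[OF \<omega>(1) b(2) vu]) (auto intro: order_trans ennreal_leI)
  qed
  have eb: "ennreal (birth_upto \<omega> t v) = birth \<omega> v"
    by (rule ennreal_birth_upto[OF alive_birth_le[OF vu \<omega>(2)]])
  have lt: "birth \<omega> v < death \<omega> v" by (rule birth_less_death[OF \<omega>(1) b(1)])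
  then have "particle_zeta \<zeta> \<omega> v (birth_upto \<omega> t v) = \<zeta> (position \<omega> v) (birth_upto \<omega> t v)"
    using eb by (auto simp: particle_zeta_def)
  also have "\<dots> = \<zeta> (position \<omega> u) (birth_upto \<omega> t v)"
    using eb lt birth_upto_bounds[OF t] by (intro eq) auto
  finally show "particle_zeta \<zeta> \<omega> v (birth_upto \<omega> t v) = \<zeta> (position \<omega> u) (birth_upto \<omega> t v)" .
  have d0: "0 \<le> death_upto \<omega> t v" using death_upto_bounds[OF t] by blast
  have ed: "ennreal (death_upto \<omega> t v) = min (death \<omega> v) (ennreal t)"
    unfolding death_upto_def by (simp add: min.strict_coboundedI2)
  have "particle_zeta \<zeta> \<omega> v (death_upto \<omega> t v) = \<zeta> (position \<omega> v) (death_upto \<omega> t v)"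
  proof (cases "u = v")
    case True
    then show ?thesis using aliveD(3)[OF \<omega>(2)] ed by (auto simp: particle_zeta_def min_def)
  next
    case False
    then have "offspring \<omega> v > 0"
      using born_strict_prefix(2)[of v u \<omega>] vu b by (auto simp: strict_prefix_def)
    then show ?thesis by (simp add: particle_zeta_def)
  qed
  also have "\<dots> = \<zeta> (position \<omega> u) (death_upto \<omega> t v)"
    using d0 ed by (intro eq) auto
  finally show "particle_zeta \<zeta> \<omega> v (death_upto \<omega> t v) = \<zeta> (position \<omega> u) (death_upto \<omega> t v)" .
qed

lemma particle_zeta_adapted:
  assumes t: "0 \<le> t" and vu: "prefix v u"
  shows "(\<lambda>\<omega>. particle_zeta \<zeta> \<omega> v (birth_upto \<omega> t v)) \<in> borel_measurable (BFA x t u)"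
    and "(\<lambda>\<omega>. particle_zeta \<zeta> \<omega> v (death_upto \<omega> t v)) \<in> borel_measurable (BFA x t u)"
proof -
  have "(\<lambda>\<omega>. \<zeta> (position \<omega> u) (birth_upto \<omega> t v)) \<in> borel_measurable (BFA x t u)"
    by (intro zeta_measurable2[OF t] birth_upto_adapted position_adapted birth_upto_bounds t vu)
  then show "(\<lambda>\<omega>. particle_zeta \<zeta> \<omega> v (birth_upto \<omega> t v)) \<in> borel_measurable (BFA x t u)"
    by (rule measurable_cong[THEN iffD1, rotated]) (auto simp: space_BFA particle_zeta_eq t vu)
  have "(\<lambda>\<omega>. \<zeta> (position \<omega> u) (death_upto \<omega> t v)) \<in> borel_measurable (BFA x t u)"
    by (intro zeta_measurable2[OF t] death_upto_adapted position_adapted death_upto_bounds t vu)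
  then show "(\<lambda>\<omega>. particle_zeta \<zeta> \<omega> v (death_upto \<omega> t v)) \<in> borel_measurable (BFA x t u)"
    by (rule measurable_cong[THEN iffD1, rotated]) (auto simp: space_BFA particle_zeta_eq t vu)
qed

definition weight :: "('a \<Rightarrow> real) \<Rightarrow> ('a \<Rightarrow> nat pmf) \<Rightarrow> nat \<Rightarrow> real \<Rightarrow> 'a tree \<Rightarrow> real" where
  "weight R \<mu> k t \<omega> = (\<Prod>v\<in>skeleton \<omega> k t.
          particle_zeta \<zeta> \<omega> v (birth_upto \<omega> t v) / particle_zeta \<zeta> \<omega> v (death_upto \<omega> t v) *
          exp (rate_integral R \<mu> \<omega> k t v))"

section \<open>Assembling the density from the positions of the marks\<close>

abbreviation "SF \<equiv> spine_filtration J W"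

lemma spines_at_sets:
  assumes "0 \<le> t" "length vs = k"
  shows "{\<omega> \<in> trees W x. spines_at \<omega> t vs} \<in> sets (SF x k t)"
proof -
  have "{\<omega> \<in> space (SF x k t). \<forall>i\<in>{..<k}. spine \<omega> i t = Some (vs ! i)} \<in> sets (SF x k t)"
  proof (rule sets.sets_Collect_finite_All)
    fix i assume "i \<in> {..<k}"
    then show "{\<omega> \<in> space (SF x k t). spine \<omega> i t = Some (vs ! i)} \<in> sets (SF x k t)"
      unfolding sets_spine_filtration space_spine_filtration using assms
      by (intro sigma_sets.Basic UnI2 CollectI exI[of _ i] exI[of _ t] exI[of _ "Some (vs ! i)"]) auto
  qed simp
  then show ?thesis by (rule back_subst[of "\<lambda>A. A \<in> _"]) (auto simp: spines_at_def assms)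
qed

abbreviation "SFA x t vs \<equiv> restrict_space (spine_filtration J W x (length vs) t) {\<omega>. spines_at \<omega> t vs}"

lemma BFA_SFA:
  assumes f: "f \<in> BFA x t u \<rightarrow>\<^sub>M N" and u: "u \<in> set vs"
  shows "f \<in> SFA x t vs \<rightarrow>\<^sub>M N"
proof -
  have "sets (BFA x t u) \<subseteq> sets (restrict_space (SF x (length vs) t) {\<omega>. u \<in> alive \<omega> t})"
    unfolding sets_restrict_space by (rule image_mono[OF branching_filtration_le_spine])
  moreover have "space (restrict_space (SF x (length vs) t) {\<omega>. u \<in> alive \<omega> t}) = space (BFA x t u)"
    by (simp add: space_restrict_space)
  ultimately have "f \<in> restrict_space (SF x (length vs) t) {\<omega>. u \<in> alive \<omega> t} \<rightarrow>\<^sub>M N"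
    using measurable_from_subalg[OF _ f] by (simp add: subalgebra_def)
  then show ?thesis
  proof (rule measurable_restrict_mono)
    show "{\<omega>. spines_at \<omega> t vs} \<subseteq> {\<omega>. u \<in> alive \<omega> t}"
    proof
      fix \<omega> assume "\<omega> \<in> {\<omega>. spines_at \<omega> t vs}"
      then have "set vs \<subseteq> alive \<omega> t" by (simp add: spines_at_alive)
      then show "\<omega> \<in> {\<omega>. u \<in> alive \<omega> t}" using u by blast
    qed
  qed
qed

text \<open>Lists of labels are countable, so the events \<open>spines_at\<close> and the loss of
  some mark form a countable measurable partition; on the last piece \<open>f\<close> is
  constant.\<close>

lemma measurable_spine_pieces:
  assumes t: "0 \<le> t"
    and f: "\<And>vs. length vs = k \<Longrightarrow> f \<in> SFA x t vs \<rightarrow>\<^sub>M N"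
    and c: "\<And>\<omega>. (\<And>vs. length vs = k \<Longrightarrow> \<not> spines_at \<omega> t vs) \<Longrightarrow> f \<omega> = c" "c \<in> space N"
  shows "f \<in> SF x k t \<rightarrow>\<^sub>M N"
proof -
  let ?E = "\<lambda>vs. {\<omega>. spines_at \<omega> t vs}"
  let ?D = "{\<omega>. \<forall>vs. length vs = k \<longrightarrow> \<not> spines_at \<omega> t vs}"
  show ?thesis
  proof (rule measurable_piecewise_restrict[where C="insert ?D (?E ` {vs. length vs = k})"])
    have E: "?E vs \<inter> space (SF x k t) \<in> sets (SF x k t)" if "length vs = k" for vs
      using spines_at_sets[OF t that, of x] by (rule back_subst[of "\<lambda>A. A \<in> _"]) auto
    have D: "?D \<inter> space (SF x k t) = space (SF x k t) - (\<Union>vs\<in>{vs. length vs = k}. ?E vs \<inter> space (SF x k t))"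
      by auto
    have D': "?D \<inter> space (SF x k t) \<in> sets (SF x k t)"
      unfolding D by (intro sets.Diff sets.top sets.countable_UN'' countableI_type E) simp
    show "\<Omega> \<inter> space (SF x k t) \<in> sets (SF x k t)" if "\<Omega> \<in> insert ?D (?E ` {vs. length vs = k})" for \<Omega>
      using that
    proof (elim insertE imageE)
      fix vs assume \<Omega>: "\<Omega> = ?E vs" and vs: "vs \<in> {vs. length vs = k}"
      from vs have "length vs = k" by simp
      from E[OF this] show ?thesis unfolding \<Omega> .
    next
      assume \<Omega>: "\<Omega> = ?D"
      show ?thesis unfolding \<Omega> by (rule D')
    qed
    show "space (SF x k t) \<subseteq> \<Union> (insert ?D (?E ` {vs. length vs = k}))" by auto
    show "f \<in> restrict_space (SF x k t) \<Omega> \<rightarrow>\<^sub>M N" if "\<Omega> \<in> insert ?D (?E ` {vs. length vs = k})" for \<Omega>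
    proof (cases "\<Omega> = ?D")
      case True
  have "(\<lambda>_. c) \<in> restrict_space (SF x k t) \<Omega> \<rightarrow>\<^sub>M N" using c by simp
      then show ?thesis
        by (rule measurable_cong[THEN iffD1, rotated]) (simp add: space_restrict_space True c(1))
    next
      case False
      then have "\<Omega> \<in> ?E ` {vs. length vs = k}" using that by simp
      then obtain vs where \<Omega>: "\<Omega> = ?E vs" and vs: "vs \<in> {vs. length vs = k}" by (rule imageE)
      from vs have k: "length vs = k" by simp
      show ?thesis using f[OF k] unfolding \<Omega> k .
    qed
  qed auto
qed

context
  fixes R :: "'a \<Rightarrow> real" and \<mu> :: "'a \<Rightarrow> nat pmf" and x :: 'a and t :: real
  assumes R: "R \<in> borel_measurable J" and \<mu>: "\<And>a. (\<lambda>y. pmf (\<mu> y) a) \<in> borel_measurable J" and t: "0 \<le> t"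
begin

lemma SFA_factors:
  assumes v: "v \<in> prefix_set vs"
  shows "(\<lambda>\<omega>. particle_zeta \<zeta> \<omega> v (birth_upto \<omega> t v)) \<in> borel_measurable (SFA x t vs)"
    and "(\<lambda>\<omega>. particle_zeta \<zeta> \<omega> v (death_upto \<omega> t v)) \<in> borel_measurable (SFA x t vs)"
    and "(\<lambda>\<omega>. rate_integral R \<mu> \<omega> (length vs) t v) \<in> borel_measurable (SFA x t vs)"
    and "v \<notin> set vs \<Longrightarrow> (\<lambda>\<omega>. offspring \<omega> v) \<in> SFA x t vs \<rightarrow>\<^sub>M count_space UNIV"
proof -
  obtain u where u: "u \<in> set vs" "prefix v u" using v by (auto simp: prefix_set_def)
  show "(\<lambda>\<omega>. particle_zeta \<zeta> \<omega> v (birth_upto \<omega> t v)) \<in> borel_measurable (SFA x t vs)"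
    "(\<lambda>\<omega>. particle_zeta \<zeta> \<omega> v (death_upto \<omega> t v)) \<in> borel_measurable (SFA x t vs)"
    by (rule BFA_SFA[OF particle_zeta_adapted(1)[OF t u(2)] u(1)] BFA_SFA[OF particle_zeta_adapted(2)[OF t u(2)] u(1)])+
  show "(\<lambda>\<omega>. offspring \<omega> v) \<in> SFA x t vs \<rightarrow>\<^sub>M count_space UNIV" if "v \<notin> set vs"
    by (rule BFA_SFA[OF offspring_adapted[OF t] u(1)]) (use u that in \<open>metis strict_prefixI\<close>)
  \<comment> \<open>With \<open>marks\<close> replaced by the constant
    \<open>mark_count vs v\<close>, the integrand is a fixed function of the position, to which
    \<open>rate_adapted\<close> applies.\<close>
  have "(\<lambda>\<omega>. LBINT s:{birth_upto \<omega> t v..death_upto \<omega> t v}. moment_rate R \<mu> (mark_count vs v) (position \<omega> v s))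
     \<in> borel_measurable (SFA x t vs)"
    by (rule BFA_SFA[OF rate_adapted[OF t u(2) moment_rate_measurable] u(1)]) (use R \<mu> in auto)
  then show "(\<lambda>\<omega>. rate_integral R \<mu> \<omega> (length vs) t v) \<in> borel_measurable (SFA x t vs)"
    by (rule measurable_cong[THEN iffD1, rotated])
      (simp add: rate_integral_def space_restrict_space marks_eq[of _ W x, OF _ t _ v])
qed

text \<open>This is what allows \<open>density\<close> on the spine filtration to be evaluated as an
  integral.\<close>

lemma spine_density_measurable: "spine_density R \<mu> \<zeta> k t \<in> borel_measurable (SF x k t)"
proof (rule measurable_spine_pieces[OF t _ spine_density_eq_0[of k]])
  fix vs :: "label list" assume k: "length vs = k"
  note [measurable] = SFA_factors(1-3)
  have o: "(\<lambda>\<omega>. real (offspring \<omega> v)) \<in> borel_measurable (SFA x t vs)" if "v \<in> prefix_set vs - set vs" for v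
    using measurable_compose[OF SFA_factors(4)[of v vs], of real borel] that by simp
  have z: "(\<lambda>\<omega>. particle_zeta \<zeta> \<omega> v t) \<in> borel_measurable (SFA x t vs)" if "v \<in> set vs" for v
  proof (rule measurable_cong[THEN iffD1, OF _ SFA_factors(2)])
    show "v \<in> prefix_set vs" using that by (auto simp: prefix_set_def)
    fix \<omega> assume "\<omega> \<in> space (SFA x t vs)"
    then have "v \<in> alive \<omega> t" using that spines_at_alive by (auto simp: space_restrict_space)
    from death_upto_alive[OF t this]
    show "particle_zeta \<zeta> \<omega> v (death_upto \<omega> t v) = particle_zeta \<zeta> \<omega> v t" by simp
  qed
  have "(\<lambda>\<omega>. of_bool (\<forall>v\<in>set vs. 0 < particle_zeta \<zeta> \<omega> v t) *
     (\<Prod>v\<in>prefix_set vs.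
        particle_zeta \<zeta> \<omega> v (death_upto \<omega> t v) / particle_zeta \<zeta> \<omega> v (birth_upto \<omega> t v) *
        exp (- rate_integral R \<mu> \<omega> (length vs) t v)) *
     (\<Prod>v\<in>prefix_set vs - set vs. real (offspring \<omega> v) ^ mark_count vs v)) \<in> borel_measurable (SFA x t vs)"
  proof (intro borel_measurable_times)
    have "Measurable.pred (SFA x t vs) (\<lambda>\<omega>. \<forall>v\<in>set vs. 0 < particle_zeta \<zeta> \<omega> v t)"
      by (intro pred_intros_finite) (use z in \<open>auto intro!: borel_measurable_pred_less\<close>)
    then show "(\<lambda>\<omega>. of_bool (\<forall>v\<in>set vs. 0 < particle_zeta \<zeta> \<omega> v t) :: real) \<in> borel_measurable (SFA x t vs)"
      by measurable
  next
    show "(\<lambda>\<omega>. \<Prod>v\<in>prefix_set vs.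
        particle_zeta \<zeta> \<omega> v (death_upto \<omega> t v) / particle_zeta \<zeta> \<omega> v (birth_upto \<omega> t v) *
        exp (- rate_integral R \<mu> \<omega> (length vs) t v)) \<in> borel_measurable (SFA x t vs)"
      by (intro borel_measurable_prod) measurable
    show "(\<lambda>\<omega>. \<Prod>v\<in>prefix_set vs - set vs. real (offspring \<omega> v) ^ mark_count vs v) \<in> borel_measurable (SFA x t vs)"
      by (intro borel_measurable_prod borel_measurable_power o)
  qed
  then show "spine_density R \<mu> \<zeta> k t \<in> borel_measurable (SFA x t vs)"
    by (rule measurable_cong[THEN iffD1, rotated])
      (simp add: space_restrict_space spine_density_eq[of _ W x, OF _ t] flip: k)
qed auto

lemma weight_eq:
  assumes "\<omega> \<in> trees W x" "spines_at \<omega> t vs"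
  shows "weight R \<mu> (length vs) t \<omega> = (\<Prod>v\<in>prefix_set vs.
        particle_zeta \<zeta> \<omega> v (birth_upto \<omega> t v) / particle_zeta \<zeta> \<omega> v (death_upto \<omega> t v) *
        exp (rate_integral R \<mu> \<omega> (length vs) t v))"
  using skeleton_eq[OF assms(1) t assms(2)] by (simp add: weight_def)

text \<open>
  The weight itself is not claimed to be adapted: when a mark is lost, the skeleton may be infinite
  (after an explosion), and the product over it then has the junk value \<open>1\<close>.
\<close>

lemma truncated_weight_measurable:
  assumes Y: "Y \<in> borel_measurable (SF x k t)"
  shows "(\<lambda>\<omega>. if 0 < spine_density R \<mu> \<zeta> k t \<omega> then Y \<omega> * weight R \<mu> k t \<omega> else 0) \<in> borel_measurable (SF x k t)"
proof (rule measurable_spine_pieces[OF t])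
  fix vs :: "label list" assume k: "length vs = k"
  note [measurable] = SFA_factors(1-3)
  have [measurable]: "spine_density R \<mu> \<zeta> k t \<in> borel_measurable (SFA x t vs)" "Y \<in> borel_measurable (SFA x t vs)"
    using spine_density_measurable Y k by (auto intro: measurable_restrict_space1)
  have "(\<lambda>\<omega>. (\<Prod>v\<in>prefix_set vs.
        particle_zeta \<zeta> \<omega> v (birth_upto \<omega> t v) / particle_zeta \<zeta> \<omega> v (death_upto \<omega> t v) *
        exp (rate_integral R \<mu> \<omega> (length vs) t v))) \<in> borel_measurable (SFA x t vs)"
    by (intro borel_measurable_prod) measurable
  then have [measurable]: "weight R \<mu> k t \<in> borel_measurable (SFA x t vs)"
    by (rule measurable_cong[THEN iffD1, rotated])
      (simp add: space_restrict_space weight_eq flip: k)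
  show "(\<lambda>\<omega>. if 0 < spine_density R \<mu> \<zeta> k t \<omega> then Y \<omega> * weight R \<mu> k t \<omega> else 0) \<in> borel_measurable (SFA x t vs)"
    by measurable
next
  fix \<omega> :: "'a tree" assume "\<And>vs. length vs = k \<Longrightarrow> \<not> spines_at \<omega> t vs"
  then have "spine_density R \<mu> \<zeta> k t \<omega> = 0" by (rule spine_density_eq_0)
  then show "(if 0 < spine_density R \<mu> \<zeta> k t \<omega> then Y \<omega> * weight R \<mu> k t \<omega> else 0) = 0" by simp
qed simp

end

end

section \<open>Pasting paths under the Markov property\<close>

definition paste :: "(real \<Rightarrow> 'a) \<Rightarrow> real \<Rightarrow> (real \<Rightarrow> 'a) \<Rightarrow> real \<Rightarrow> 'a" where
  "paste w d w' = (\<lambda>s. if s < d then w s else w' (s - d))"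

text \<open>\<open>B\<close> is indexed by absolute times, and \<open>s\<close> is the clock reading
  at which the path starts. So one family \<open>B\<close> describes a path as well as its restart
  at a later time.\<close>

definition cylinder :: "(real \<Rightarrow> 'a) set \<Rightarrow> real set \<Rightarrow> real \<Rightarrow> (real \<Rightarrow> 'a set) \<Rightarrow> (real \<Rightarrow> 'a) set" where
  "cylinder W F s B = {w \<in> W. \<forall>r\<in>F. w (r - s) \<in> B r}"

lemma sets_path_filtration_single:
  "0 \<le> s \<Longrightarrow> s \<le> t \<Longrightarrow> B \<in> sets J \<Longrightarrow> {w \<in> W. w s \<in> B} \<in> sets (path_filtration J W t)"
  unfolding sets_path_filtration by (intro sigma_sets.Basic CollectI exI[of _ s] exI[of _ B]) simp

lemma cylinder_sets_filtration:
  assumes "finite F" "\<And>r. r \<in> F \<Longrightarrow> s \<le> r \<and> r - s \<le> t" "\<And>r. B r \<in> sets J"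
  shows "cylinder W F s B \<in> sets (path_filtration J W t)"
proof -
  have "{w \<in> space (path_filtration J W t). \<forall>r\<in>F. w (r - s) \<in> B r} \<in> sets (path_filtration J W t)"
    by (rule sets.sets_Collect_finite_All)
      (use assms in \<open>auto intro!: sets_path_filtration_single\<close>)
  then show ?thesis by (simp add: cylinder_def)
qed

lemma cylinder_sets:
  assumes "finite F" "\<And>r. r \<in> F \<Longrightarrow> s \<le> r" "\<And>r. B r \<in> sets J"
  shows "cylinder W F s B \<in> sets (path_space J W)"
proof -
  have "cylinder W F s B \<in> sets (path_filtration J W (Max (insert 0 F) - s))"
    by (rule cylinder_sets_filtration) (use assms in auto)
  then show ?thesis by (rule subsetD[OF sets_path_filtration_le])
qed

lemma path_space_UNIV_generator:
  fixes J :: "'a measure"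
  defines "E \<equiv> {cylinder UNIV F 0 B | F B. finite F \<and> (\<forall>r\<in>F. 0 \<le> r) \<and> (\<forall>r. B r \<in> sets J)}"
  shows "Int_stable E" and "sets (path_space J UNIV) = sigma_sets UNIV E"
proof -
  show "Int_stable E"
  proof (rule Int_stableI)
    fix a b assume "a \<in> E" "b \<in> E"
    then obtain F B F' B' where a: "a = cylinder UNIV F 0 B" "finite F" "\<forall>r\<in>F. 0 \<le> r" "\<forall>r. B r \<in> sets J"
      and b: "b = cylinder UNIV F' 0 B'" "finite F'" "\<forall>r\<in>F'. 0 \<le> r" "\<forall>r. B' r \<in> sets J"
      by (auto simp: E_def)
    let ?B = "\<lambda>r. if r \<in> F \<and> r \<in> F' then B r \<inter> B' r else if r \<in> F then B r else B' r"
    have "a \<inter> b = cylinder UNIV (F \<union> F') 0 ?B"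
      unfolding a b cylinder_def by (auto split: if_splits)
    moreover have "\<forall>r. ?B r \<in> sets J" using a b by auto
    ultimately show "a \<inter> b \<in> E"
      unfolding E_def using a b by (intro CollectI exI[of _ "F \<union> F'"] exI[of _ ?B]) auto
  qed
  show "sets (path_space J UNIV) = sigma_sets UNIV E"
  proof (intro equalityI)
    show "sigma_sets UNIV E \<subseteq> sets (path_space J UNIV)"
    proof (rule sets.sigma_sets_subset')
      show "E \<subseteq> sets (path_space J UNIV)"
        unfolding E_def by (auto intro!: cylinder_sets)
      show "UNIV \<in> sets (path_space J UNIV)" using sets.top[of "path_space J UNIV"] by simp
    qed
    show "sets (path_space J UNIV) \<subseteq> sigma_sets UNIV E"
      unfolding sets_path_space
    proof (rule sigma_sets_mono, rule subsetI)
      fix A :: "(real \<Rightarrow> 'a) set" assume "A \<in> {{w \<in> UNIV. w s \<in> B} |s B. 0 \<le> s \<and> B \<in> sets J}"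
      then obtain s :: real and B where A: "A = {w. w s \<in> B}" "0 \<le> s" "B \<in> sets J" by auto
      have "A = cylinder UNIV {s} 0 (\<lambda>_. B)" by (simp add: A cylinder_def)
      then have "A \<in> E" unfolding E_def using A by blast
      then show "A \<in> sigma_sets UNIV E" by (rule sigma_sets.Basic)
    qed
  qed
qed

text \<open>
  The set of admissible paths is closed only under pasting at a common point, and the set of
  compatible pairs need not be measurable. Pasted paths are therefore regarded as elements of the
  space of all functions of time, of whose sigma-algebra that of \<open>W\<close> is the trace.
\<close>

lemma path_space_trace:
  assumes "N \<in> sets (M \<Otimes>\<^sub>M path_space J W)"
  shows "\<exists>N'\<in>sets (M \<Otimes>\<^sub>M path_space J UNIV). N = N' \<inter> (space M \<times> W)"
proof -
  let ?R = "restrict_space (M \<Otimes>\<^sub>M path_space J UNIV) (UNIV \<times> W)"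
  have sp: "space ?R = space M \<times> W"
    by (auto simp: space_restrict_space space_pair_measure)
  have "(\<lambda>z. z) \<in> ?R \<rightarrow>\<^sub>M M \<Otimes>\<^sub>M path_space J W"
  proof (rule measurable_pair)
    show "fst \<circ> (\<lambda>z. z) \<in> ?R \<rightarrow>\<^sub>M M"
      using measurable_restrict_space1[OF measurable_fst] by (simp add: comp_def)
    have "snd \<in> ?R \<rightarrow>\<^sub>M path_space J W"
      unfolding path_space_def[of J W]
    proof (rule measurable_measure_of)
      fix A assume "A \<in> {{w \<in> W. w s \<in> B} |s B. 0 \<le> s \<and> B \<in> sets J}"
      then obtain s B where A: "A = {w \<in> W. w s \<in> B}" "0 \<le> s" "B \<in> sets J" by auto
      have "{w \<in> UNIV. w s \<in> B} \<in> sets (path_space J UNIV)"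
        unfolding sets_path_space using A(2,3) by (intro sigma_sets.Basic) blast
      from measurable_sets[OF measurable_restrict_space1[OF measurable_snd] this]
      have "snd -` {w \<in> UNIV. w s \<in> B} \<inter> space ?R \<in> sets ?R" .
      then show "snd -` A \<inter> space ?R \<in> sets ?R"
        by (rule back_subst[of "\<lambda>X. X \<in> _"]) (auto simp: sp A)
    qed (auto simp: sp)
    then show "snd \<circ> (\<lambda>z. z) \<in> ?R \<rightarrow>\<^sub>M path_space J W" by (simp add: comp_def)
  qed
  from measurable_sets[OF this assms]
  have "N \<inter> (space M \<times> W) \<in> sets ?R" by (simp add: sp)
  moreover have "N \<subseteq> space M \<times> W"
    using sets.sets_into_space[OF assms] by (simp add: space_pair_measure)
  ultimately have "N \<in> sets ?R" by (simp add: Int_absorb2)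
  then obtain N' where N': "N' \<in> sets (M \<Otimes>\<^sub>M path_space J UNIV)" "N = (UNIV \<times> W) \<inter> N'"
    by (auto simp: sets_restrict_space)
  have "N' \<subseteq> space M \<times> UNIV" using sets.sets_into_space[OF N'(1)] by (simp add: space_pair_measure)
  then have "N = N' \<inter> (space M \<times> W)" using N'(2) by blast
  then show ?thesis using N'(1) by blast
qed

section \<open>The Markov property for functions, cylinders and pasted paths\<close>

locale markov_motion =
  fixes J :: "'a measure" and W :: "(real \<Rightarrow> 'a) set" and K :: "'a \<Rightarrow> (real \<Rightarrow> 'a) measure"
  assumes family: "markov_family J W K"
begin

sublocale paths J W
  using family by unfold_locales (simp add: markov_family_def)

abbreviation "PU \<equiv> path_space J (UNIV :: (real \<Rightarrow> 'a) set)"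

lemma K_kernel: "K \<in> J \<rightarrow>\<^sub>M prob_algebra PS"
  using family unfolding markov_family_def by blast

lemma K_kernel_subprob [measurable]: "K \<in> J \<rightarrow>\<^sub>M subprob_algebra PS"
  using K_kernel by (rule measurable_prob_algebraD)

lemma K_space: "y \<in> space J \<Longrightarrow> K y \<in> space (prob_algebra PS)"
  using K_kernel by (rule measurable_space)

lemma K_prob: "y \<in> space J \<Longrightarrow> prob_space (K y)"
  and K_sets [measurable_cong]: "y \<in> space J \<Longrightarrow> sets (K y) = sets PS"
  using K_space by (auto simp: space_prob_algebra)

lemma space_K: "y \<in> space J \<Longrightarrow> space (K y) = W"
  using sets_eq_imp_space_eq[OF K_sets] by simp

lemma markov_property:
  "y \<in> space J \<Longrightarrow> 0 \<le> s \<Longrightarrow> 0 \<le> u \<Longrightarrow> A \<in> sets (PF s) \<Longrightarrow> B \<in> sets J \<Longrightarrow>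
    emeasure (K y) (A \<inter> {w \<in> W. w (s + u) \<in> B}) =
        (\<integral>\<^sup>+w\<in>A. emeasure (K (w s)) {w' \<in> W. w' u \<in> B} \<partial>K y)"
  using family unfolding markov_family_def by blast

lemma PF_in_PS: "A \<in> sets (PF s) \<Longrightarrow> A \<in> sets PS"
  using sets_path_filtration_le by blast

lemma emeasure_K_measurable: "C \<in> sets PS \<Longrightarrow> (\<lambda>y. emeasure (K y) C) \<in> borel_measurable J"
  by (rule measurable_compose[OF K_kernel_subprob measurable_emeasure_subprob_algebra])

lemma measurable_K: "y \<in> space J \<Longrightarrow> f \<in> PS \<rightarrow>\<^sub>M N \<Longrightarrow> f \<in> K y \<rightarrow>\<^sub>M N"
  using measurable_cong_sets[OF K_sets refl] by blast

text \<open>The Markov property is assumed for events. Both sides here are integrals of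
  \<open>f\<close> against measures on \<open>J\<close>: the law of \<open>w (s + u)\<close> on
  \<open>A\<close>, and a mixture of laws of restarted motions; these agree on every measurable
  set.\<close>

lemma markov_integral:
  assumes y: "y \<in> space J" and s: "0 \<le> s" "0 \<le> u" and A: "A \<in> sets (PF s)"
    and f: "f \<in> borel_measurable J"
  shows "(\<integral>\<^sup>+w\<in>A. f (w (s + u)) \<partial>K y) = (\<integral>\<^sup>+w\<in>A. (\<integral>\<^sup>+w'. f (w' u) \<partial>K (w s)) \<partial>K y)"
proof -
  have A': "A \<in> sets (K y)" using PF_in_PS[OF A] y by (simp add: K_sets)
  have ev: "(\<lambda>w. w r) \<in> K y \<rightarrow>\<^sub>M J" if "0 \<le> r" for r
    using measurable_K[OF y eval_measurable[OF that]] .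
  have ind: "indicator A \<in> borel_measurable (K y)" using A' by simp
  let ?D = "density (K y) (indicator A)"
  let ?N1 = "distr ?D J (\<lambda>w. w (s + u))"
  let ?k = "\<lambda>w. distr (K (w s)) J (\<lambda>w'. w' u)"
  have evD: "(\<lambda>w. w r) \<in> ?D \<rightarrow>\<^sub>M J" if "0 \<le> r" for r
    using ev[OF that] by (simp cong: measurable_cong_sets)
  have k: "?k \<in> ?D \<rightarrow>\<^sub>M subprob_algebra J"
  proof (rule measurable_distr2)
    show "(\<lambda>w. K (w s)) \<in> ?D \<rightarrow>\<^sub>M subprob_algebra PS"
      using measurable_compose[OF evD[OF s(1)] K_kernel_subprob] .
    show "(\<lambda>(w, w'). w' u) \<in> ?D \<Otimes>\<^sub>M PS \<rightarrow>\<^sub>M J"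
      using measurable_compose[OF measurable_snd eval_measurable[OF s(2)]] by (simp add: split_beta')
  qed
  have ws: "w s \<in> space J" if "w \<in> space (K y)" for w
    using that path_in_space s y by (simp add: space_K)
  have ne: "space ?D \<noteq> {}" using prob_space.not_empty[OF K_prob[OF y]] by simp
  have "?N1 = ?D \<bind> ?k"
  proof (rule measure_eqI)
    show "sets ?N1 = sets (?D \<bind> ?k)" using sets_bind[OF _ ne] by (simp add: sets_bind[OF _ ne])
    fix B assume "B \<in> sets ?N1"
    then have B: "B \<in> sets J" by simp
    have "emeasure ?N1 B = emeasure ?D {w \<in> W. w (s + u) \<in> B}"
      using evD[of "s + u"] s B y by (subst emeasure_distr) (auto simp: space_K intro!: arg_cong[where f="emeasure _"])
    also have "\<dots> = (\<integral>\<^sup>+w. indicator A w * indicator {w \<in> W. w (s + u) \<in> B} w \<partial>K y)"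
      using measurable_sets[OF ev[of "s + u"] B] s y A'
      by (subst emeasure_density) (auto simp: space_K Int_def conj_commute)
    also have "\<dots> = (\<integral>\<^sup>+w. indicator (A \<inter> {w \<in> W. w (s + u) \<in> B}) w \<partial>K y)"
      by (intro nn_integral_cong) (auto simp: indicator_def)
    also have "\<dots> = emeasure (K y) (A \<inter> {w \<in> W. w (s + u) \<in> B})"
      using sets.Int[OF A' measurable_sets[OF ev[of "s + u"] B]] s y
      by (subst nn_integral_indicator) (auto simp: space_K vimage_def Int_def conj_commute)
    also have "\<dots> = (\<integral>\<^sup>+w\<in>A. emeasure (K (w s)) {w' \<in> W. w' u \<in> B} \<partial>K y)"
      by (rule markov_property[OF y s A B])
    also have "\<dots> = (\<integral>\<^sup>+w. indicator A w * emeasure (?k w) B \<partial>K y)"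
    proof (rule nn_integral_cong)
      fix w assume w: "w \<in> space (K y)"
      have "emeasure (?k w) B = emeasure (K (w s)) {w' \<in> W. w' u \<in> B}"
        using measurable_K[OF ws[OF w] eval_measurable[OF s(2)]] B
        by (subst emeasure_distr) (auto simp: space_K[OF ws[OF w]] intro!: arg_cong[where f="emeasure _"])
      then show "emeasure (K (w s)) {w' \<in> W. w' u \<in> B} * indicator A w = indicator A w * emeasure (?k w) B"
        by (simp add: mult.commute)
    qed
    also have "\<dots> = (\<integral>\<^sup>+w. emeasure (?k w) B \<partial>?D)"
      using measurable_emeasure_kernel[OF k B] ind
      by (subst nn_integral_density) (auto cong: measurable_cong_sets)
    also have "\<dots> = emeasure (?D \<bind> ?k) B" by (rule emeasure_bind[OF ne k B, symmetric])
    finally show "emeasure ?N1 B = emeasure (?D \<bind> ?k) B" .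
  qed
  then have "(\<integral>\<^sup>+z. f z \<partial>?N1) = (\<integral>\<^sup>+z. f z \<partial>(?D \<bind> ?k))" by simp
  also have "\<dots> = (\<integral>\<^sup>+w. \<integral>\<^sup>+z. f z \<partial>?k w \<partial>?D)" by (rule nn_integral_bind[OF f k])
  also have "\<dots> = (\<integral>\<^sup>+w. indicator A w * (\<integral>\<^sup>+z. f z \<partial>?k w) \<partial>K y)"
    using measurable_compose[OF k nn_integral_measurable_subprob_algebra[OF f]] ind
    by (subst nn_integral_density) (auto cong: measurable_cong_sets)
  also have "\<dots> = (\<integral>\<^sup>+w\<in>A. (\<integral>\<^sup>+w'. f (w' u) \<partial>K (w s)) \<partial>K y)"
  proof (rule nn_integral_cong)
    fix w assume w: "w \<in> space (K y)"
    have "(\<integral>\<^sup>+z. f z \<partial>?k w) = (\<integral>\<^sup>+w'. f (w' u) \<partial>K (w s))"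
      by (rule nn_integral_distr[OF measurable_K[OF ws[OF w] eval_measurable[OF s(2)]]]) (simp add: f)
    then show "indicator A w * (\<integral>\<^sup>+z. f z \<partial>?k w) = (\<integral>\<^sup>+w'. f (w' u) \<partial>K (w s)) * indicator A w"
      by (simp add: mult.commute)
  qed
  finally have "(\<integral>\<^sup>+z. f z \<partial>?N1) = (\<integral>\<^sup>+w\<in>A. (\<integral>\<^sup>+w'. f (w' u) \<partial>K (w s)) \<partial>K y)" .
  moreover have "(\<integral>\<^sup>+z. f z \<partial>?N1) = (\<integral>\<^sup>+w. f (w (s + u)) \<partial>?D)"
    using evD[of "s + u"] s f by (intro nn_integral_distr) auto
  moreover have "\<dots> = (\<integral>\<^sup>+w\<in>A. f (w (s + u)) \<partial>K y)"
    using measurable_compose[OF ev[of "s + u"] f] s ind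
    by (subst nn_integral_density) (auto simp: mult.commute)
  ultimately show ?thesis by simp
qed

text \<open>Induction over the observation times, removing the earliest. The event \<open>A\<close>
  is arbitrary so that it can absorb the first constraint; \<open>y\<close>, \<open>s0\<close> and
  \<open>s\<close> are arbitrary because the induction hypothesis is used for the original path and
  for the path restarted at clock time \<open>s\<close>.\<close>

lemma markov_cylinder:
  assumes "finite F" and B: "\<And>r. B r \<in> sets J"
    and "y \<in> space J" "s0 \<le> s" "\<forall>r\<in>F. s \<le> r" "A \<in> sets (PF (s - s0))"
  shows "emeasure (K y) (A \<inter> cylinder W F s0 B) = (\<integral>\<^sup>+w\<in>A. emeasure (K (w (s - s0))) (cylinder W F s B) \<partial>K y)"
  using assms(1,3-)
proof (induction F arbitrary: y s0 s A rule: finite_linorder_min_induct)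
  case empty
  have A: "A \<in> sets (K y)" "A \<subseteq> W"
    using PF_in_PS[OF empty(4)] sets.sets_into_space[OF empty(4)] empty by (auto simp: K_sets)
  have "(\<integral>\<^sup>+w\<in>A. emeasure (K (w (s - s0))) (cylinder W {} s B) \<partial>K y) = (\<integral>\<^sup>+w. indicator A w \<partial>K y)"
  proof (rule nn_integral_cong)
    fix w assume "w \<in> space (K y)"
    then have "w (s - s0) \<in> space J" using empty by (simp add: space_K path_in_space)
    then have "emeasure (K (w (s - s0))) W = 1"
      using prob_space.emeasure_space_1[OF K_prob] by (metis space_K)
    then show "emeasure (K (w (s - s0))) (cylinder W {} s B) * indicator A w = indicator A w"
      by (simp add: cylinder_def)
  qed
  also have "\<dots> = emeasure (K y) (A \<inter> cylinder W {} s0 B)"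
    using A by (simp add: cylinder_def Int_absorb2)
  finally show ?case by simp
next
  case (insert m F)
  have m: "s \<le> m" "s0 \<le> m" "\<forall>r\<in>F. m \<le> r" using insert by (auto simp: less_imp_le)
  have F: "cylinder W F r B \<in> sets PS" if "r \<le> m" for r
    by (rule cylinder_sets) (use insert m that B in \<open>force+\<close>)
  let ?A' = "A \<inter> {w \<in> W. w (m - s0) \<in> B m}"
  let ?g = "\<lambda>z. indicator (B m) z * emeasure (K z) (cylinder W F m B)"
  have g: "?g \<in> borel_measurable J"
    using emeasure_K_measurable[OF F[OF order_refl]] B by (intro borel_measurable_times_ennreal) auto
  have A': "?A' \<in> sets (PF (m - s0))"
    using sets_path_filtration_mono[of "s - s0" "m - s0" J W] insert.prems m B
    by (intro sets.Int sets_path_filtration_single) auto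
  have "A \<inter> cylinder W (insert m F) s0 B = ?A' \<inter> cylinder W F s0 B"
    by (auto simp: cylinder_def)
  then have "emeasure (K y) (A \<inter> cylinder W (insert m F) s0 B) = emeasure (K y) (?A' \<inter> cylinder W F s0 B)"
    by simp
  \<comment> \<open>First use: restart at clock time \<open>m\<close>, with \<open>A\<close> and the
    constraint at \<open>m\<close> as the past.\<close>
  also have "\<dots> = (\<integral>\<^sup>+w\<in>?A'. emeasure (K (w (m - s0))) (cylinder W F m B) \<partial>K y)"
    using insert.IH[OF insert.prems(1) m(2,3) A'] .
  also have "\<dots> = (\<integral>\<^sup>+w\<in>A. ?g (w ((s - s0) + (m - s))) \<partial>K y)"
    using insert.prems(1) by (intro nn_integral_cong) (auto simp: indicator_def space_K)
  \<comment> \<open>The Markov property at clock time \<open>s\<close>, applied to the position at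
    the later time \<open>m\<close>.\<close>
  also have "\<dots> = (\<integral>\<^sup>+w\<in>A. (\<integral>\<^sup>+w'. ?g (w' (m - s)) \<partial>K (w (s - s0))) \<partial>K y)"
    using insert.prems m by (intro markov_integral[OF _ _ _ _ g]) auto
  also have "\<dots> = (\<integral>\<^sup>+w\<in>A. emeasure (K (w (s - s0))) (cylinder W (insert m F) s B) \<partial>K y)"
  proof (rule nn_integral_cong)
    fix w assume "w \<in> space (K y)"
    then have z: "w (s - s0) \<in> space J" using insert.prems by (simp add: space_K path_in_space)
    let ?A'' = "{w' \<in> W. w' (m - s) \<in> B m}"
    have "(\<integral>\<^sup>+w'. ?g (w' (m - s)) \<partial>K (w (s - s0))) =
        (\<integral>\<^sup>+w'\<in>?A''. emeasure (K (w' (m - s))) (cylinder W F m B) \<partial>K (w (s - s0)))"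
      by (intro nn_integral_cong) (auto simp: indicator_def space_K[OF z])
    \<comment> \<open>Second use, read from right to left: the path that starts at clock time
      \<open>s\<close> is restarted at \<open>m\<close>.\<close>
    also have "\<dots> = emeasure (K (w (s - s0))) (?A'' \<inter> cylinder W F s B)"
      using m B by (intro insert.IH[symmetric, OF z]) (auto intro!: sets_path_filtration_single)
    also have "?A'' \<inter> cylinder W F s B = cylinder W (insert m F) s B"
      by (auto simp: cylinder_def)
    finally show "(\<integral>\<^sup>+w'. ?g (w' (m - s)) \<partial>K (w (s - s0))) * indicator A w =
      emeasure (K (w (s - s0))) (cylinder W (insert m F) s B) * indicator A w" by simp
  qed
  finally show ?case .
qed

lemma paste_measurable: "(\<lambda>((w, d), w'). paste w d w') \<in> (PS \<Otimes>\<^sub>M borel) \<Otimes>\<^sub>M PS \<rightarrow>\<^sub>M PU"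
proof -
  let ?M = "(PS \<Otimes>\<^sub>M borel) \<Otimes>\<^sub>M PS"
  have "(\<lambda>((w, d), w'). paste w d w') \<in> ?M \<rightarrow>\<^sub>M sigma UNIV {{w \<in> UNIV. w s \<in> B} | s B. 0 \<le> s \<and> B \<in> sets J}"
  proof (rule measurable_measure_of)
    fix A :: "(real \<Rightarrow> 'a) set" assume "A \<in> {{w \<in> UNIV. w s \<in> B} |s B. 0 \<le> s \<and> B \<in> sets J}"
    then obtain s :: real and B where A: "A = {w. w s \<in> B}" "0 \<le> s" "B \<in> sets J" by auto
    have "(\<lambda>z. fst (fst z) s) \<in> ?M \<rightarrow>\<^sub>M J"
      by (rule measurable_compose[OF measurable_compose[OF measurable_fst measurable_fst] eval_measurable[OF A(2)]])
    moreover have "(\<lambda>z. snd z (max 0 (s - snd (fst z)))) \<in> ?M \<rightarrow>\<^sub>M J"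
      by (rule eval_measurable2) (auto intro!: borel_measurable_max borel_measurable_diff measurable_compose[OF measurable_fst measurable_snd])
    moreover have "{z \<in> space ?M. s < snd (fst z)} \<in> sets ?M"
      by (intro borel_measurable_less borel_measurable_const measurable_compose[OF measurable_fst measurable_snd])
    ultimately have "(\<lambda>z. if s < snd (fst z) then fst (fst z) s else snd z (max 0 (s - snd (fst z)))) \<in> ?M \<rightarrow>\<^sub>M J"
      by (intro measurable_If)
    from measurable_sets[OF this A(3)]
    show "(\<lambda>((w, d), w'). paste w d w') -` A \<inter> space ?M \<in> sets ?M"
      by (rule back_subst[of "\<lambda>X. X \<in> _"]) (auto simp: A paste_def split_beta split: if_splits)
  qed auto
  then show ?thesis by (simp add: path_space_def)
qed

text \<open>It suffices to compare cylinders: times before \<open>d\<close> constrain the old path,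
  times from \<open>d\<close> on the fresh one, and \<open>markov_cylinder\<close> joins the two.
  This invariance under restarting is what allows ancestral paths to be compared with a single
  motion.\<close>

lemma markov_paste:
  assumes y: "y \<in> space J" and d: "0 \<le> d" and N: "N \<in> sets PU"
  shows "(\<integral>\<^sup>+w. emeasure (K (w d)) {w' \<in> W. paste w d w' \<in> N} \<partial>K y) = emeasure (K y) (N \<inter> W)"
proof -
  let ?k = "\<lambda>w. distr (K (w d)) PU (paste w d)"
  have ev: "(\<lambda>w. w r) \<in> K y \<rightarrow>\<^sub>M J" if "0 \<le> r" for r
    using measurable_K[OF y eval_measurable[OF that]] .
  have "(\<lambda>(w, w'). ((w, d), w')) \<in> K y \<Otimes>\<^sub>M PS \<rightarrow>\<^sub>M (PS \<Otimes>\<^sub>M borel) \<Otimes>\<^sub>M PS"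
    unfolding split_beta
    by (intro measurable_Pair measurable_snd measurable_compose[OF measurable_fst measurable_K[OF y measurable_ident_sets[OF refl]]]) simp
  from measurable_compose[OF this paste_measurable]
  have p: "(\<lambda>(w, w'). paste w d w') \<in> K y \<Otimes>\<^sub>M PS \<rightarrow>\<^sub>M PU" by (simp add: split_beta)
  have k: "?k \<in> K y \<rightarrow>\<^sub>M subprob_algebra PU"
    by (rule measurable_distr2[OF p]) (rule measurable_compose[OF ev[OF d] K_kernel_subprob])
  have ws: "w d \<in> space J" if "w \<in> W" for w using that path_in_space d by simp
  have ne: "space (K y) \<noteq> {}" using prob_space.not_empty[OF K_prob[OF y]] .
  have pw: "paste w d \<in> PS \<rightarrow>\<^sub>M PU" if "w \<in> W" for w
    using measurable_compose[OF measurable_Pair1'[of w "K y" PS] p] that by (simp add: space_K y)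
  have kN: "emeasure (?k w) C = emeasure (K (w d)) {w' \<in> W. paste w d w' \<in> C}" if "C \<in> sets PU" "w \<in> W" for C w
    using measurable_K[OF ws[OF that(2)] pw[OF that(2)]] that
    by (subst emeasure_distr) (auto simp: space_K[OF ws[OF that(2)]] intro!: arg_cong[where f="emeasure _"])
  have idU: "(\<lambda>w. w) \<in> K y \<rightarrow>\<^sub>M PU"
  proof (rule measurable_K[OF y])
    show "(\<lambda>w. w) \<in> PS \<rightarrow>\<^sub>M PU"
      unfolding path_space_def[of J UNIV]
    proof (rule measurable_measure_of)
      fix A :: "(real \<Rightarrow> 'a) set" assume "A \<in> {{w \<in> UNIV. w s \<in> B} |s B. 0 \<le> s \<and> B \<in> sets J}"
      then obtain s :: real and B where A: "A = {w. w s \<in> B}" "0 \<le> s" "B \<in> sets J" by auto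
      from measurable_sets[OF eval_measurable[OF A(2)] A(3)]
      show "(\<lambda>w. w) -` A \<inter> space PS \<in> sets PS"
        by (rule back_subst[of "\<lambda>X. X \<in> _"]) (auto simp: A)
    qed auto
  qed
  have "distr (K y) PU (\<lambda>w. w) = K y \<bind> ?k"
  proof (rule measure_eqI_generator_eq[OF path_space_UNIV_generator(1)[of J], where A="\<lambda>_. UNIV" and \<Omega>=UNIV])
    show "sets (distr (K y) PU (\<lambda>w. w)) = sigma_sets UNIV
       {cylinder UNIV F 0 B |F B. finite F \<and> (\<forall>r\<in>F. 0 \<le> r) \<and> (\<forall>r. B r \<in> sets J)}"
      using path_space_UNIV_generator(2)[of J] by simp
    show "sets (K y \<bind> ?k) = sigma_sets UNIV
       {cylinder UNIV F 0 B |F B. finite F \<and> (\<forall>r\<in>F. 0 \<le> r) \<and> (\<forall>r. B r \<in> sets J)}"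
      using path_space_UNIV_generator(2)[of J] by (subst sets_bind[OF _ ne]) auto
    have "(UNIV :: (real \<Rightarrow> 'a) set) = cylinder UNIV {} 0 (\<lambda>_. {})" by (simp add: cylinder_def)
    then show "range (\<lambda>_::nat. UNIV) \<subseteq> {cylinder UNIV F 0 B |F B. finite F \<and> (\<forall>r\<in>F. 0 \<le> r) \<and> (\<forall>r. B r \<in> sets J)}"
      by blast
    show "emeasure (distr (K y) PU (\<lambda>w. w)) UNIV \<noteq> \<infinity>" for i :: nat
      using prob_space.emeasure_space_1[OF prob_space.prob_space_distr[OF K_prob[OF y] idU]] by simp
    fix C assume "C \<in> {cylinder UNIV F 0 B |F B. finite F \<and> (\<forall>r\<in>F. 0 \<le> r) \<and> (\<forall>r. B r \<in> sets J)}"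
    then obtain F B where C: "C = cylinder UNIV F 0 B" "finite F" "\<forall>r\<in>F. 0 \<le> r" "\<forall>r. B r \<in> sets J" by auto
    have CU: "C \<in> sets PU" using C by (auto intro!: cylinder_sets)
    \<comment> \<open>Time \<open>d\<close> belongs to the second group, in agreement with the
      strict inequality in \<open>paste\<close>.\<close>
    let ?F1 = "{r\<in>F. r < d}" and ?F2 = "{r\<in>F. d \<le> r}"
    have A: "cylinder W ?F1 0 B \<in> sets (PF (d - 0))"
      using C by (intro cylinder_sets_filtration) auto
    have "emeasure (distr (K y) PU (\<lambda>w. w)) C = emeasure (K y) (cylinder W ?F1 0 B \<inter> cylinder W ?F2 0 B)"
      using idU CU C by (subst emeasure_distr)
        (auto simp: space_K[OF y] cylinder_def not_less[symmetric] intro!: arg_cong[where f="emeasure _"])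
    also have "\<dots> = (\<integral>\<^sup>+w\<in>cylinder W ?F1 0 B. emeasure (K (w (d - 0))) (cylinder W ?F2 d B) \<partial>K y)"
      using C d y A by (intro markov_cylinder) auto
    also have "\<dots> = (\<integral>\<^sup>+w. emeasure (?k w) C \<partial>K y)"
    proof (rule nn_integral_cong)
      fix w assume "w \<in> space (K y)"
      then have w: "w \<in> W" using y by (simp add: space_K)
      have "{w' \<in> W. paste w d w' \<in> C} = (if w \<in> cylinder W ?F1 0 B then cylinder W ?F2 d B else {})"
        using w by (auto simp: C cylinder_def paste_def)
      then show "emeasure (K (w (d - 0))) (cylinder W ?F2 d B) * indicator (cylinder W ?F1 0 B) w = emeasure (?k w) C"
        by (simp add: kN[OF CU w] indicator_def)
    qed
    also have "\<dots> = emeasure (K y \<bind> ?k) C" by (rule emeasure_bind[OF ne k CU, symmetric])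
    finally show "emeasure (distr (K y) PU (\<lambda>w. w)) C = emeasure (K y \<bind> ?k) C" .
  qed auto
  then have "emeasure (distr (K y) PU (\<lambda>w. w)) N = emeasure (K y \<bind> ?k) N" by simp
  also have "\<dots> = (\<integral>\<^sup>+w. emeasure (?k w) N \<partial>K y)" by (rule emeasure_bind[OF ne k N])
  also have "\<dots> = (\<integral>\<^sup>+w. emeasure (K (w d)) {w' \<in> W. paste w d w' \<in> N} \<partial>K y)"
    using kN[OF N] y by (intro nn_integral_cong) (simp add: space_K)
  finally show ?thesis using idU N by (simp add: emeasure_distr space_K[OF y])
qed

end

text \<open>The event that \<zeta> is \<open>0\<close> at \<open>s\<close> belongs to the past of
  \<open>s\<close>, so by conditioning \<zeta> at \<open>t\<close> has integral \<open>0\<close>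
  over it; being nonnegative, it vanishes there almost surely.\<close>

lemma (in weighted_paths) zeta_absorbed:
  assumes mart: "martingale_wrt M PF (\<lambda>t w. \<zeta> w t)" and M: "sets M = sets PS" "prob_space M"
    and st: "0 \<le> s" "s \<le> t"
  shows "emeasure M {w \<in> W. \<zeta> w s = 0 \<and> 0 < \<zeta> w t} = 0"
proof -
  interpret M: prob_space M by (rule M(2))
  have spM: "space M = W" using sets_eq_imp_space_eq[OF M(1)] by simp
  have sub: "subalgebra M (PF s)" and int: "integrable M (\<lambda>w. \<zeta> w t)"
    and ce: "AE w in M. real_cond_exp M (PF s) (\<lambda>w. \<zeta> w t) w = \<zeta> w s"
    using mart st unfolding martingale_wrt_def by auto
  interpret S: sigma_finite_subalgebra M "PF s"
    by (rule finite_measure_subalgebra_is_sigma_finite)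
      (use sub in \<open>simp add: finite_measure_subalgebra_def finite_measure_subalgebra_axioms_def M.finite_measure_axioms\<close>)
  have zs: "(\<lambda>w. \<zeta> w s) \<in> borel_measurable (PF s)" using st by (intro zeta_adapted)
  have [measurable]: "(\<lambda>w. \<zeta> w t) \<in> borel_measurable M" using int by simp
  have zsM [measurable]: "(\<lambda>w. \<zeta> w s) \<in> borel_measurable M" by (rule measurable_from_subalg[OF sub zs])
  define A where "A = {w \<in> W. \<zeta> w s = 0}"
  have "{w \<in> space (PF s). \<zeta> w s = 0} \<in> sets (PF s)" using zs by measurable
  then have A: "A \<in> sets (PF s)" by (simp add: A_def)
  then have AM: "A \<in> sets M" using sub by (auto simp: subalgebra_def)
  have "(\<integral>w\<in>A. \<zeta> w t \<partial>M) = (\<integral>w\<in>A. real_cond_exp M (PF s) (\<lambda>w. \<zeta> w t) w \<partial>M)"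
    by (rule S.real_cond_exp_intA[OF int A])
  also have "\<dots> = (\<integral>w\<in>A. \<zeta> w s \<partial>M)"
    unfolding set_lebesgue_integral_def
    using ce AM borel_measurable_cond_exp2[of M "PF s"] zsM
    by (intro integral_cong_AE) auto
  also have "\<dots> = 0"
    unfolding set_lebesgue_integral_def by (rule integral_eq_zero_AE) (auto simp: A_def indicator_def)
  finally have "(\<integral>w. indicator A w *\<^sub>R \<zeta> w t \<partial>M) = 0" unfolding set_lebesgue_integral_def .
  moreover have "integrable M (\<lambda>w. indicator A w *\<^sub>R \<zeta> w t)"
    using int AM by (rule integrable_mult_indicator[rotated])
  moreover have "AE w in M. 0 \<le> indicator A w *\<^sub>R \<zeta> w t"
    using st zeta_nonneg by (intro AE_I2) (auto simp: spM)
  ultimately have "AE w in M. indicator A w *\<^sub>R \<zeta> w t = 0"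
    using integral_nonneg_eq_0_iff_AE by blast
  then have ae: "AE w in M. \<not> (\<zeta> w s = 0 \<and> 0 < \<zeta> w t)"
    by (rule AE_mp, intro AE_I2) (auto simp: A_def spM indicator_def split: if_splits)
  have "{w \<in> space M. \<not> \<not> (\<zeta> w s = 0 \<and> 0 < \<zeta> w t)} \<in> sets M"
    by measurable
  from AE_iff_measurable[OF this refl] ae
  have "emeasure M {w \<in> space M. \<not> \<not> (\<zeta> w s = 0 \<and> 0 < \<zeta> w t)} = 0" by blast
  then show ?thesis by (simp add: spM)
qed

section \<open>The law of the lifetime\<close>

lemma nn_integral_exp_atLeast:
  "(\<integral>\<^sup>+y. ennreal (exp (- y)) * indicator {a..} y \<partial>lborel) = ennreal (exp (- a))"
proof -
  have "((\<lambda>y::real. - exp (- y)) \<longlongrightarrow> - 0) at_top"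
    by (intro tendsto_minus filterlim_compose[OF exp_at_bot filterlim_uminus_at_bot_at_top])
  then have "(\<integral>\<^sup>+y. ennreal (exp (- y)) * indicator {a..} y \<partial>lborel) = ennreal (0 - (- exp (- a)))"
    by (intro nn_integral_FTC_atLeast) (auto intro!: derivative_eq_intros)
  then show ?thesis by simp
qed

text \<open>The times up to \<open>c\<close> with \<open>H s \<le> y\<close> form an interval
  starting at \<open>0\<close>, and the integral of \<open>f\<close> over it is \<open>H\<close> at
  its right end. Continuity is assumed of \<open>S\<close> rather than \<open>H\<close> because
  \<open>H\<close> may become infinite; it prevents \<open>H\<close> from jumping over the level
  \<open>y\<close>.\<close>

lemma hazard_level:
  fixes f :: "real \<Rightarrow> real"
  defines "H \<equiv> \<lambda>t. \<integral>\<^sup>+s. ennreal (f s) * indicator {0..t} s \<partial>lborel"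
  defines "S \<equiv> \<lambda>t. if H t = \<infinity> then 0 else exp (- enn2real (H t))"
  assumes f: "f \<in> borel_measurable borel" and S: "continuous_on {0..} S"
    and c: "0 \<le> c" and y: "0 \<le> y"
  shows "(\<integral>\<^sup>+s. ennreal (f s) * indicator {0..c} s * indicator {s. H s \<le> ennreal y} s \<partial>lborel) = min (ennreal y) (H c)"
proof -
  have mono: "H s \<le> H t" if "s \<le> t" for s t
    unfolding H_def using that by (intro nn_integral_mono) (auto simp: indicator_def)
  have H0: "H 0 = 0"
  proof -
    have "AE s in lborel. s \<noteq> (0::real)" by (rule AE_lborel_singleton)
    then have "AE s in lborel. ennreal (f s) * indicator {0..0} s = 0" by eventually_elim auto
    then show ?thesis unfolding H_def using f by (subst nn_integral_0_iff_AE) auto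
  qed
  \<comment> \<open>In terms of the continuous \<open>S\<close> the level set is closed, which gives
    a last time \<open>s1\<close>.\<close>
  have S_iff: "exp (- y) \<le> S s \<longleftrightarrow> H s \<le> ennreal y" for s
    using y by (cases "H s") (auto simp: S_def not_le top_unique)
  let ?L = "{s\<in>{0..c}. exp (- y) \<le> S s}"
  have Sc: "continuous_on {0..c} S" using S by (rule continuous_on_subset) auto
  have "?L = {0..c} \<inter> S -` {exp (- y)..}" by auto
  moreover have "closed ({0..c} \<inter> S -` {exp (- y)..})"
    by (rule continuous_closed_preimage[OF Sc]) auto
  moreover have "bounded ?L" by (rule bounded_subset[of "{0..c}"]) auto
  ultimately have "compact ?L" by (simp add: compact_eq_bounded_closed)
  moreover have "0 \<in> ?L" using c by (simp add: S_iff H0)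
  ultimately obtain s1 where s1: "s1 \<in> ?L" "\<And>s. s \<in> ?L \<Longrightarrow> s \<le> s1"
    using compact_attains_sup[of ?L] by blast
  have L: "{0..c} \<inter> {s. H s \<le> ennreal y} = {0..s1}"
  proof (intro equalityI subsetI)
    fix s assume "s \<in> {0..c} \<inter> {s. H s \<le> ennreal y}"
    then show "s \<in> {0..s1}" using s1(2)[of s] by (auto simp: S_iff)
  next
    fix s assume s: "s \<in> {0..s1}"
    have "H s \<le> H s1" using s by (intro mono) auto
    also have "\<dots> \<le> ennreal y" using s1(1) by (simp add: S_iff)
    finally show "s \<in> {0..c} \<inter> {s. H s \<le> ennreal y}" using s s1(1) by auto
  qed
  have "(\<integral>\<^sup>+s. ennreal (f s) * indicator {0..c} s * indicator {s. H s \<le> ennreal y} s \<partial>lborel) =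
      (\<integral>\<^sup>+s. ennreal (f s) * indicator {0..s1} s \<partial>lborel)"
  proof (rule nn_integral_cong)
    fix s
    have "indicator {0..c} s * indicator {s. H s \<le> ennreal y} s = (indicator {0..s1} s :: ennreal)"
      unfolding L[symmetric] by (simp add: indicator_inter_arith)
    then show "ennreal (f s) * indicator {0..c} s * indicator {s. H s \<le> ennreal y} s = ennreal (f s) * indicator {0..s1} s"
      by (simp add: mult.assoc)
  qed
  also have "\<dots> = H s1" by (simp add: H_def)
  also have "\<dots> = min (ennreal y) (H c)"
  proof (cases "s1 = c")
    case True
    then show ?thesis using s1(1) by (auto simp: S_iff min_def)
  next
    case False
    then have lt: "s1 < c" using s1(1) by auto
    have less: "S s < exp (- y)" if "s1 < s" "s \<le> c" for s
    proof (rule ccontr)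
      assume "\<not> S s < exp (- y)"
      then have "s \<in> ?L" using that s1(1) by auto
      from s1(2)[OF this] that show False by simp
    qed
    \<comment> \<open>A strict inequality at \<open>s1\<close> would persist on a right
      neighbourhood, against the maximality of \<open>s1\<close>.\<close>
    have "S s1 \<le> exp (- y)"
    proof (rule ccontr)
      assume "\<not> S s1 \<le> exp (- y)"
      then have "exp (- y) < S s1" by simp
      have "continuous_on {s1..c} S" by (rule continuous_on_subset[OF Sc]) (use s1(1) in auto)
      from continuous_on_Icc_at_rightD[OF this lt] have "(S \<longlongrightarrow> S s1) (at_right s1)" .
      then have "eventually (\<lambda>s. exp (- y) < S s) (at_right s1)"
        using \<open>exp (- y) < S s1\<close> by (rule order_tendstoD)
      moreover have "eventually (\<lambda>s. s \<in> {s1<..<c}) (at_right s1)"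
        using lt by (rule eventually_at_right_real)
      ultimately have "eventually (\<lambda>s. False) (at_right s1)"
        by eventually_elim (use less in force)
      then show False by simp
    qed
    then have eq: "S s1 = exp (- y)" using s1(1) by auto
    then have "H s1 = ennreal y"
      using y by (cases "H s1") (auto simp: S_def split: if_splits)
    moreover have "\<not> H c \<le> ennreal y" using less[OF lt order_refl] by (simp add: S_iff[symmetric])
    ultimately show ?thesis by (simp add: min_def not_le less_imp_le)
  qed
  finally show ?thesis .
qed

text \<open>
  Written as \<open>\<integral> exp (- y) 1{H s \<le> y} dy\<close>, the survival function can be integrated against \<open>f\<close> by
  Fubini's theorem, so that no differentiation of the merely absolutely continuous \<open>H\<close> is needed.
\<close>

lemma hazard_integral:
  fixes f :: "real \<Rightarrow> real"
  defines "H \<equiv> \<lambda>t. \<integral>\<^sup>+s. ennreal (f s) * indicator {0..t} s \<partial>lborel"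
  defines "S \<equiv> \<lambda>t. if H t = \<infinity> then 0 else exp (- enn2real (H t))"
  assumes f [measurable]: "f \<in> borel_measurable borel" and f0: "\<And>s. 0 \<le> f s"
    and S: "continuous_on {0..} S" and c: "0 \<le> c"
  shows "(\<integral>\<^sup>+s. ennreal (f s * S s) * indicator {0..c} s \<partial>lborel) = ennreal (1 - S c)"
proof -
  have H [measurable]: "H \<in> borel_measurable borel"
  proof -
    have "(\<lambda>(t, s). ennreal (f s) * (if 0 \<le> s \<and> s \<le> t then 1 else 0)) \<in> borel_measurable (borel \<Otimes>\<^sub>M lborel)"
      by measurable
    from lborel.borel_measurable_nn_integral[OF this]
    show ?thesis unfolding H_def by (simp add: indicator_def of_bool_def cong: if_cong)
  qed
  have S_eq: "ennreal (S s) = (\<integral>\<^sup>+y. ennreal (exp (- y)) * indicator {0..} y * indicator {y. H s \<le> ennreal y} y \<partial>lborel)" for s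
  proof (cases "H s")
    case (real a)
    have "(\<integral>\<^sup>+y. ennreal (exp (- y)) * indicator {0..} y * indicator {y. H s \<le> ennreal y} y \<partial>lborel) =
        (\<integral>\<^sup>+y. ennreal (exp (- y)) * indicator {a..} y \<partial>lborel)"
      using real by (intro nn_integral_cong) (auto simp: indicator_def ennreal_le_iff2)
    then show ?thesis using real by (simp add: nn_integral_exp_atLeast S_def)
  next
    case top
    then show ?thesis by (simp add: S_def top_unique)
  qed
  \<comment> \<open>A second representation by level sets: once the minimum of \<open>y\<close> and
    \<open>H c\<close> is an integral over \<open>u\<close>, integrating first over
    \<open>y \<ge> u\<close> leaves \<open>exp (- u)\<close> on the set \<open>u \<le> H c\<close>,
    with total \<open>1 - S c\<close>.\<close>
  have m_eq: "min (ennreal y) h = (\<integral>\<^sup>+u. indicator {0..y} u * indicator {u. ennreal u \<le> h} u \<partial>lborel)"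
    if "0 \<le> y" for y :: real and h
  proof (cases h)
    case (real b)
    have "(\<integral>\<^sup>+u. indicator {0..y} u * indicator {u. ennreal u \<le> h} u \<partial>lborel) = (\<integral>\<^sup>+u. indicator {0..min y b} u \<partial>lborel)"
      using real by (intro nn_integral_cong) (auto simp: indicator_def ennreal_le_iff2)
    also have "\<dots> = ennreal (min y b)" using that real by simp
    finally show ?thesis using real that by (simp add: min_def ennreal_le_iff)
  next
    case top
    then show ?thesis using that by (simp add: top_unique)
  qed
  have "(\<integral>\<^sup>+s. ennreal (f s * S s) * indicator {0..c} s \<partial>lborel) =
     (\<integral>\<^sup>+s. \<integral>\<^sup>+y. ennreal (f s) * indicator {0..c} s * (ennreal (exp (- y)) * indicator {0..} y * indicator {y. H s \<le> ennreal y} y) \<partial>lborel \<partial>lborel)"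
  proof (rule nn_integral_cong)
    fix s
    have "ennreal (f s * S s) * indicator {0..c} s = (ennreal (f s) * indicator {0..c} s) * ennreal (S s)"
      by (subst ennreal_mult'[OF f0]) (simp add: mult_ac)
    also have "\<dots> = (\<integral>\<^sup>+y. ennreal (f s) * indicator {0..c} s * (ennreal (exp (- y)) * indicator {0..} y * indicator {y. H s \<le> ennreal y} y) \<partial>lborel)"
      unfolding S_eq by (rule nn_integral_cmult[symmetric]) measurable
    finally show "ennreal (f s * S s) * indicator {0..c} s = \<dots>" .
  qed
  also have "\<dots> = (\<integral>\<^sup>+y. \<integral>\<^sup>+s. ennreal (f s) * indicator {0..c} s * (ennreal (exp (- y)) * indicator {0..} y * indicator {y. H s \<le> ennreal y} y) \<partial>lborel \<partial>lborel)"
    by (rule lborel_pair.Fubini'[symmetric]) (simp add: indicator_def of_bool_def)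
  also have "\<dots> = (\<integral>\<^sup>+y. ennreal (exp (- y)) * indicator {0..} y * min (ennreal y) (H c) \<partial>lborel)"
  proof (rule nn_integral_cong)
    fix y :: real
    show "(\<integral>\<^sup>+s. ennreal (f s) * indicator {0..c} s * (ennreal (exp (- y)) * indicator {0..} y * indicator {y. H s \<le> ennreal y} y) \<partial>lborel) =
       ennreal (exp (- y)) * indicator {0..} y * min (ennreal y) (H c)"
    proof (cases "0 \<le> y")
      case True
      have "(\<integral>\<^sup>+s. ennreal (f s) * indicator {0..c} s * (ennreal (exp (- y)) * indicator {0..} y * indicator {y. H s \<le> ennreal y} y) \<partial>lborel) =
         (\<integral>\<^sup>+s. ennreal (exp (- y)) * (ennreal (f s) * indicator {0..c} s * indicator {s. H s \<le> ennreal y} s) \<partial>lborel)"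
        using True by (intro nn_integral_cong) (simp add: indicator_def mult.commute)
      also have "\<dots> = ennreal (exp (- y)) * min (ennreal y) (H c)"
      proof (subst nn_integral_cmult)
        have "(\<integral>\<^sup>+s. ennreal (f s) * indicator {0..c} s * indicator {s. H s \<le> ennreal y} s \<partial>lborel) = min (ennreal y) (H c)"
          unfolding H_def by (rule hazard_level[OF f S[unfolded S_def H_def] c True])
        then show "ennreal (exp (- y)) * (\<integral>\<^sup>+s. ennreal (f s) * indicator {0..c} s * indicator {s. H s \<le> ennreal y} s \<partial>lborel) =
          ennreal (exp (- y)) * min (ennreal y) (H c)" by simp
      qed measurable
      finally show ?thesis using True by simp
    qed simp
  qed
  also have "\<dots> = (\<integral>\<^sup>+y. \<integral>\<^sup>+u. ennreal (exp (- y)) * indicator {0..} y * (indicator {0..y} u * indicator {u. ennreal u \<le> H c} u) \<partial>lborel \<partial>lborel)"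
    by (intro nn_integral_cong, subst nn_integral_cmult) (auto simp: m_eq split: split_indicator)
  also have "\<dots> = (\<integral>\<^sup>+u. \<integral>\<^sup>+y. ennreal (exp (- y)) * indicator {0..} y * (indicator {0..y} u * indicator {u. ennreal u \<le> H c} u) \<partial>lborel \<partial>lborel)"
    by (rule lborel_pair.Fubini'[symmetric]) (simp add: indicator_def of_bool_def)
  also have "\<dots> = (\<integral>\<^sup>+u. ennreal (exp (- u)) * (indicator {0..} u * indicator {u. ennreal u \<le> H c} u) \<partial>lborel)"
  proof (rule nn_integral_cong)
    fix u :: real
    have "(\<integral>\<^sup>+y. ennreal (exp (- y)) * indicator {0..} y * (indicator {0..y} u * indicator {u. ennreal u \<le> H c} u) \<partial>lborel) =
      (\<integral>\<^sup>+y. (ennreal (exp (- y)) * indicator {u..} y) * (indicator {0..} u * indicator {u. ennreal u \<le> H c} u) \<partial>lborel)"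
      by (intro nn_integral_cong) (auto simp: indicator_def)
    also have "\<dots> = (\<integral>\<^sup>+y. ennreal (exp (- y)) * indicator {u..} y \<partial>lborel) * (indicator {0..} u * indicator {u. ennreal u \<le> H c} u)"
      by (rule nn_integral_multc) measurable
    finally show "(\<integral>\<^sup>+y. ennreal (exp (- y)) * indicator {0..} y * (indicator {0..y} u * indicator {u. ennreal u \<le> H c} u) \<partial>lborel) =
      ennreal (exp (- u)) * (indicator {0..} u * indicator {u. ennreal u \<le> H c} u)"
      by (simp only: nn_integral_exp_atLeast)
  qed
  also have "\<dots> = ennreal (1 - S c)"
  proof (cases "H c")
    case (real a)
    have "(\<integral>\<^sup>+u. ennreal (exp (- u)) * (indicator {0..} u * indicator {u. ennreal u \<le> H c} u) \<partial>lborel) =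
      (\<integral>\<^sup>+u. ennreal (exp (- u)) * indicator {0..a} u \<partial>lborel)"
      using real by (intro nn_integral_cong) (auto simp: indicator_def ennreal_le_iff2)
    also have "\<dots> = ennreal (- exp (- a) - (- exp (- 0)))"
      using real by (intro nn_integral_FTC_Icc) (auto intro!: derivative_eq_intros continuous_intros)
    finally show ?thesis using real by (simp add: S_def)
  next
    case top
    then show ?thesis using nn_integral_exp_atLeast[of 0] by (simp add: S_def)
  qed
  finally show ?thesis .
qed

lemma measure_eqI_rectangles:
  assumes M: "sets M = sets (A \<Otimes>\<^sub>M B)" and N: "sets N = sets (A \<Otimes>\<^sub>M B)"
    and fin: "emeasure M (space A \<times> space B) \<noteq> \<infinity>"
    and eq: "\<And>a b. a \<in> sets A \<Longrightarrow> b \<in> sets B \<Longrightarrow> emeasure M (a \<times> b) = emeasure N (a \<times> b)"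
  shows "M = N"
proof (rule measure_eqI_generator_eq[OF Int_stable_pair_measure_generator[of A B],
      where A="\<lambda>_. space A \<times> space B" and \<Omega>="space A \<times> space B"])
  show "{a \<times> b |a b. a \<in> sets A \<and> b \<in> sets B} \<subseteq> Pow (space A \<times> space B)"
    using sets.sets_into_space[of _ A] sets.sets_into_space[of _ B] by blast
  show "sets M = sigma_sets (space A \<times> space B) {a \<times> b |a b. a \<in> sets A \<and> b \<in> sets B}"
    "sets N = sigma_sets (space A \<times> space B) {a \<times> b |a b. a \<in> sets A \<and> b \<in> sets B}"
    using M N by (simp_all add: sets_pair_measure)
  show "range (\<lambda>_::nat. space A \<times> space B) \<subseteq> {a \<times> b |a b. a \<in> sets A \<and> b \<in> sets B}" by blast
qed (use fin eq in auto)

section \<open>Joint laws of motion and lifetime in the tree\<close>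

locale branching = markov_motion J W K for J :: "'a measure" and W and K +
  fixes R :: "'a \<Rightarrow> real" and \<mu> :: "'a \<Rightarrow> nat pmf" and x :: 'a and P :: "'a tree measure"
  assumes mechanism: "branching_mechanism J K R \<mu>"
    and x: "x \<in> space J"
    and law: "branching_law J W K R \<mu> x P"
begin

lemma R_measurable [measurable]: "R \<in> borel_measurable J"
  and R_nonneg: "y \<in> space J \<Longrightarrow> 0 \<le> R y"
  and survival_continuous: "y \<in> space J \<Longrightarrow> AE w in K y. continuous_on {0..} (survival R w)"
  and pmf_measurable: "(\<lambda>y. pmf (\<mu> y) a) \<in> borel_measurable J"
  using mechanism unfolding branching_mechanism_def by blast+

sublocale P: prob_space P
  using law unfolding branching_law_def by blast

lemma space_P [simp]: "space P = trees W x"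
  and sets_P: "sets P = sets (tree_algebra J W x)"
  using law unfolding branching_law_def by blast+

abbreviation "TE v \<equiv> tree_events J W x {u. \<not> prefix v u}"

lemma motion_law_event:
  assumes "A \<in> sets (TE v)" "A \<subseteq> {\<omega>. born \<omega> v}" "B \<in> sets PS"
  shows "emeasure P (A \<inter> {\<omega>. motion \<omega> v \<in> B}) = (\<integral>\<^sup>+\<omega>\<in>A. emeasure (K (start x \<omega> v)) B \<partial>P)"
  using law assms unfolding branching_law_def by blast

lemma lifetime_law_event:
  assumes "A \<in> sets (TE v)" "A \<subseteq> {\<omega>. born \<omega> v}" "B \<in> sets PS" "0 \<le> t"
  shows "emeasure P (A \<inter> {\<omega>. motion \<omega> v \<in> B} \<inter> {\<omega>. ennreal t < lifetime \<omega> v}) =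
          (\<integral>\<^sup>+\<omega>\<in>A \<inter> {\<omega>. motion \<omega> v \<in> B}. ennreal (survival R (motion \<omega> v) t) \<partial>P)"
  using law assms unfolding branching_law_def by blast

lemma TE_P: "A \<in> sets (tree_events J W x U) \<Longrightarrow> A \<in> sets P"
  using sets_tree_events_mono[of U UNIV J W x] by (auto simp: sets_P)

lemma measurable_TE_P: "f \<in> tree_events J W x U \<rightarrow>\<^sub>M N \<Longrightarrow> f \<in> P \<rightarrow>\<^sub>M N"
  by (rule measurable_from_subalg) (use TE_P in \<open>auto simp: subalgebra_def\<close>)

lemma id_P_TE: "(\<lambda>\<omega>. \<omega>) \<in> P \<rightarrow>\<^sub>M tree_events J W x U"
  by (rule measurable_TE_P[of _ U]) simp

lemma born_sets_TE: "{\<omega> \<in> trees W x. born \<omega> v} \<in> sets (TE v)"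
proof -
  have "{u. strict_prefix u v} \<subseteq> {u. \<not> prefix v u}" by auto
  from measurable_born[OF this, of J W x] show ?thesis by (simp add: pred_def)
qed

lemma born_sets_P: "{\<omega> \<in> trees W x. born \<omega> v} \<in> sets P"
  using TE_P[OF born_sets_TE] .

lemma motion_P: "(\<lambda>\<omega>. motion \<omega> v) \<in> P \<rightarrow>\<^sub>M PS"
  by (rule measurable_TE_P[OF measurable_motion[of v UNIV]]) simp

lemma lifetime_P [measurable]: "(\<lambda>\<omega>. lifetime \<omega> v) \<in> borel_measurable P"
  by (rule measurable_TE_P[OF measurable_lifetime[of v UNIV]]) simp

lemma start_P: "(\<lambda>\<omega>. start x \<omega> v) \<in> P \<rightarrow>\<^sub>M J"
  by (rule measurable_TE_P[OF measurable_start[of v UNIV]]) (use x in auto)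

lemma start_in_space: "\<omega> \<in> trees W x \<Longrightarrow> start x \<omega> v \<in> space J"
  using measurable_space[OF start_P] by simp

text \<open>The given law treats events \<open>A \<times> B\<close>. Here the event may couple the
  motion of \<open>v\<close> with the rest of the tree, as is needed when the motion is pasted to an
  ancestral path. Both sides are measures in \<open>N\<close>; the second is a \<open>bind\<close>
  with the kernel \<open>K\<close> at the starting point.\<close>

lemma motion_law:
  assumes N: "N \<in> sets (TE v \<Otimes>\<^sub>M PS)"
  shows "emeasure P {\<omega> \<in> trees W x. born \<omega> v \<and> (\<omega>, motion \<omega> v) \<in> N} =
    (\<integral>\<^sup>+\<omega>\<in>{\<omega>. born \<omega> v}. emeasure (K (start x \<omega> v)) {w \<in> W. (\<omega>, w) \<in> N} \<partial>P)"
proof -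
  let ?b = "{\<omega> \<in> trees W x. born \<omega> v}"
  \<comment> \<open>Everything is restricted to the birth of \<open>v\<close>, since the law is
    prescribed only there.\<close>
  let ?D = "density P (indicator ?b)"
  let ?M = "TE v \<Otimes>\<^sub>M PS"
  let ?k = "\<lambda>\<omega>. distr (K (start x \<omega> v)) ?M (\<lambda>w. (\<omega>, w))"
  have b: "?b \<in> sets P" by (rule born_sets_P)
  have g: "(\<lambda>\<omega>. (\<omega>, motion \<omega> v)) \<in> ?D \<rightarrow>\<^sub>M ?M"
    using measurable_Pair[OF id_P_TE motion_P] by (simp cong: measurable_cong_sets)
  have k: "?k \<in> ?D \<rightarrow>\<^sub>M subprob_algebra ?M"
  proof (rule measurable_distr2)
    show "(\<lambda>\<omega>. K (start x \<omega> v)) \<in> ?D \<rightarrow>\<^sub>M subprob_algebra PS"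
      using measurable_compose[OF start_P K_kernel_subprob] by (simp cong: measurable_cong_sets)
    have "(\<lambda>\<omega>. \<omega>) \<in> ?D \<rightarrow>\<^sub>M TE v" using id_P_TE by (simp cong: measurable_cong_sets)
    from measurable_Pair[OF measurable_compose[OF measurable_fst this] measurable_snd]
    show "(\<lambda>(\<omega>, w). (\<omega>, w)) \<in> ?D \<Otimes>\<^sub>M PS \<rightarrow>\<^sub>M ?M" by (simp add: split_beta')
  qed
  have ne: "space ?D \<noteq> {}" using P.not_empty by simp
  have kN: "emeasure (?k \<omega>) C = emeasure (K (start x \<omega> v)) {w \<in> W. (\<omega>, w) \<in> C}"
    if "C \<in> sets ?M" "\<omega> \<in> trees W x" for C \<omega>
  proof -
    note sp = start_in_space[OF that(2), of v]
    have "(\<lambda>w. (\<omega>, w)) \<in> K (start x \<omega> v) \<rightarrow>\<^sub>M ?M"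
      by (rule measurable_K[OF sp measurable_Pair1']) (use that in simp)
    then show ?thesis using that
      by (subst emeasure_distr) (auto simp: space_K[OF sp] intro!: arg_cong[where f="emeasure _"])
  qed
  have D: "(\<integral>\<^sup>+\<omega>. h \<omega> \<partial>?D) = (\<integral>\<^sup>+\<omega>\<in>{\<omega>. born \<omega> v}. h \<omega> \<partial>P)" if "h \<in> borel_measurable ?D" for h
    using that b by (subst nn_integral_density)
      (auto simp: indicator_def cong: measurable_cong_sets intro!: nn_integral_cong)
  have N1: "emeasure (distr ?D ?M (\<lambda>\<omega>. (\<omega>, motion \<omega> v))) C =
      emeasure P {\<omega> \<in> trees W x. born \<omega> v \<and> (\<omega>, motion \<omega> v) \<in> C}" if "C \<in> sets ?M" for C
  proof -
    let ?C = "(\<lambda>\<omega>. (\<omega>, motion \<omega> v)) -` C \<inter> space ?D"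
    have C: "?C \<in> sets P" using measurable_sets[OF g that] by simp
    have "emeasure (distr ?D ?M (\<lambda>\<omega>. (\<omega>, motion \<omega> v))) C = emeasure ?D ?C"
      by (rule emeasure_distr[OF g that])
    also have "\<dots> = (\<integral>\<^sup>+\<omega>. indicator ?b \<omega> * indicator ?C \<omega> \<partial>P)"
      by (rule emeasure_density) (use b C in auto)
    also have "\<dots> = (\<integral>\<^sup>+\<omega>. indicator (?b \<inter> ?C) \<omega> \<partial>P)"
      by (simp only: indicator_inter_arith)
    also have "\<dots> = emeasure P (?b \<inter> ?C)" using sets.Int[OF b C] by simp
    also have "?b \<inter> ?C = {\<omega> \<in> trees W x. born \<omega> v \<and> (\<omega>, motion \<omega> v) \<in> C}" by auto
    finally show ?thesis .
  qed
  have "distr ?D ?M (\<lambda>\<omega>. (\<omega>, motion \<omega> v)) = ?D \<bind> ?k"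
  proof (rule measure_eqI_rectangles)
    show "sets (?D \<bind> ?k) = sets ?M" by (rule sets_bind[OF _ ne]) simp
    have "emeasure (distr ?D ?M (\<lambda>\<omega>. (\<omega>, motion \<omega> v))) (space ?M) \<noteq> \<infinity>"
      unfolding N1[OF sets.top] by simp
    then show "emeasure (distr ?D ?M (\<lambda>\<omega>. (\<omega>, motion \<omega> v))) (space (TE v) \<times> space PS) \<noteq> \<infinity>"
      by (simp add: space_pair_measure)
    fix A B assume A: "A \<in> sets (TE v)" and B: "B \<in> sets PS"
    have AB: "A \<times> B \<in> sets ?M" using A B by simp
    have At: "A \<subseteq> trees W x" using sets.sets_into_space[OF A] by simp
    have "emeasure (distr ?D ?M (\<lambda>\<omega>. (\<omega>, motion \<omega> v))) (A \<times> B) = emeasure P ((A \<inter> ?b) \<inter> {\<omega>. motion \<omega> v \<in> B})"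
      unfolding N1[OF AB] by (rule arg_cong[where f="emeasure P"]) (use At in auto)
    also have "\<dots> = (\<integral>\<^sup>+\<omega>\<in>A \<inter> ?b. emeasure (K (start x \<omega> v)) B \<partial>P)"
      by (rule motion_law_event[OF sets.Int[OF A born_sets_TE] _ B]) auto
    also have "\<dots> = (\<integral>\<^sup>+\<omega>\<in>{\<omega>. born \<omega> v}. emeasure (?k \<omega>) (A \<times> B) \<partial>P)"
    proof (rule nn_integral_cong)
      fix \<omega> assume "\<omega> \<in> space P"
      then have \<omega>: "\<omega> \<in> trees W x" by simp
      have "{w \<in> W. (\<omega>, w) \<in> A \<times> B} = (if \<omega> \<in> A then B else {})"
        using sets.sets_into_space[OF B] by auto
      then show "emeasure (K (start x \<omega> v)) B * indicator (A \<inter> ?b) \<omega> = emeasure (?k \<omega>) (A \<times> B) * indicator {\<omega>. born \<omega> v} \<omega>"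
        using \<omega> by (simp add: kN[OF AB \<omega>] indicator_def)
    qed
    also have "\<dots> = (\<integral>\<^sup>+\<omega>. emeasure (?k \<omega>) (A \<times> B) \<partial>?D)"
      by (rule D[symmetric]) (rule measurable_emeasure_kernel[OF k AB])
    also have "\<dots> = emeasure (?D \<bind> ?k) (A \<times> B)" by (rule emeasure_bind[OF ne k AB, symmetric])
    finally show "emeasure (distr ?D ?M (\<lambda>\<omega>. (\<omega>, motion \<omega> v))) (A \<times> B) = emeasure (?D \<bind> ?k) (A \<times> B)" .
  qed simp
  then have "emeasure P {\<omega> \<in> trees W x. born \<omega> v \<and> (\<omega>, motion \<omega> v) \<in> N} = emeasure (?D \<bind> ?k) N"
    using N1[OF N] by simp
  also have "\<dots> = (\<integral>\<^sup>+\<omega>. emeasure (?k \<omega>) N \<partial>?D)" by (rule emeasure_bind[OF ne k N])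
  also have "\<dots> = (\<integral>\<^sup>+\<omega>\<in>{\<omega>. born \<omega> v}. emeasure (?k \<omega>) N \<partial>P)"
    by (rule D) (rule measurable_emeasure_kernel[OF k N])
  also have "\<dots> = (\<integral>\<^sup>+\<omega>\<in>{\<omega>. born \<omega> v}. emeasure (K (start x \<omega> v)) {w \<in> W. (\<omega>, w) \<in> N} \<partial>P)"
    by (intro nn_integral_cong) (simp add: kN[OF N])
  finally show ?thesis .
qed


lemma R_path: "(\<lambda>(w, s). R (w (max 0 s))) \<in> borel_measurable (PS \<Otimes>\<^sub>M borel)"
proof -
  have "(\<lambda>(w, s). (s, w)) \<in> PS \<Otimes>\<^sub>M borel \<rightarrow>\<^sub>M borel \<Otimes>\<^sub>M PS"
    unfolding split_beta' by (intro measurable_Pair measurable_fst measurable_snd)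
  from measurable_compose[OF measurable_compose[OF this eval_joint] R_measurable]
  show ?thesis by (simp add: split_beta')
qed

lemma survival_path: "(\<lambda>(w, t). survival R w t) \<in> borel_measurable (PS \<Otimes>\<^sub>M borel)"
proof -
  have "(\<lambda>z. (fst (fst z), snd z)) \<in> (PS \<Otimes>\<^sub>M borel) \<Otimes>\<^sub>M borel \<rightarrow>\<^sub>M PS \<Otimes>\<^sub>M borel"
    by (intro measurable_Pair measurable_snd measurable_compose[OF measurable_fst measurable_fst])
  from measurable_compose[OF this R_path]
  have [measurable]: "(\<lambda>z. R (fst (fst z) (max 0 (snd z)))) \<in> borel_measurable ((PS \<Otimes>\<^sub>M borel) \<Otimes>\<^sub>M borel)"
    by simp
  have "(\<lambda>z. ennreal (R (fst (fst z) (max 0 (snd z)))) * (if 0 \<le> snd z \<and> snd z \<le> snd (fst z) then 1 else 0))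
      \<in> borel_measurable ((PS \<Otimes>\<^sub>M borel) \<Otimes>\<^sub>M borel)"
    by measurable
  then have "(\<lambda>(z, s). ennreal (R (fst z (max 0 s))) * (if 0 \<le> s \<and> s \<le> snd z then 1 else 0))
      \<in> borel_measurable ((PS \<Otimes>\<^sub>M borel) \<Otimes>\<^sub>M lborel)"
    by (simp add: split_beta' cong: measurable_cong_sets sets_pair_measure_cong)
  from lborel.borel_measurable_nn_integral[OF this]
  have [measurable]: "(\<lambda>z. \<integral>\<^sup>+s. ennreal (R (fst z (max 0 s))) * (if 0 \<le> s \<and> s \<le> snd z then 1 else 0) \<partial>lborel)
      \<in> borel_measurable (PS \<Otimes>\<^sub>M borel)" .
  have eq: "(\<integral>\<^sup>+s\<in>{0..snd z}. ennreal (R (fst z s)) \<partial>lborel) =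
      (\<integral>\<^sup>+s. ennreal (R (fst z (max 0 s))) * (if 0 \<le> s \<and> s \<le> snd z then 1 else 0) \<partial>lborel)" for z :: "(real \<Rightarrow> 'a) \<times> real"
    by (intro nn_integral_cong) (auto simp: indicator_def)
  show ?thesis unfolding survival_def Let_def split_beta' eq by measurable
qed

text \<open>Conditional density of the lifetime given the motion, extended by \<open>0\<close> to
  negative arguments; \<open>max 0\<close> gives joint measurability on the whole line.\<close>

definition hazard_density :: "(real \<Rightarrow> 'a) \<Rightarrow> real \<Rightarrow> ennreal" where
  "hazard_density w l = ennreal (R (w (max 0 l)) * survival R w l) * (if 0 \<le> l then 1 else 0)"

lemma hazard_density_measurable: "(\<lambda>(w, l). hazard_density w l) \<in> borel_measurable (PS \<Otimes>\<^sub>M borel)"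
proof -
  note [measurable] = R_path[unfolded split_beta'] survival_path[unfolded split_beta']
  show ?thesis unfolding hazard_density_def split_beta' by measurable
qed

lemma hazard_density_measurable2:
  assumes "f \<in> M \<rightarrow>\<^sub>M PS" "g \<in> borel_measurable M"
  shows "(\<lambda>z. hazard_density (f z) (g z)) \<in> borel_measurable M"
  using measurable_compose[OF measurable_Pair[OF assms] hazard_density_measurable] by simp

lemma hazard_density_integral:
  assumes w: "w \<in> W" "continuous_on {0..} (survival R w)" and c: "0 \<le> c"
  shows "(\<integral>\<^sup>+l. hazard_density w l * indicator {..c} l \<partial>lborel) = ennreal (1 - survival R w c)"
proof -
  let ?f = "\<lambda>s. R (w (max 0 s))"
  have eq: "survival R w t = (if (\<integral>\<^sup>+s. ennreal (?f s) * indicator {0..t} s \<partial>lborel) = \<infinity> then 0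
      else exp (- enn2real (\<integral>\<^sup>+s. ennreal (?f s) * indicator {0..t} s \<partial>lborel)))" for t
  proof -
    have "(\<integral>\<^sup>+s\<in>{0..t}. ennreal (R (w s)) \<partial>lborel) = (\<integral>\<^sup>+s. ennreal (?f s) * indicator {0..t} s \<partial>lborel)"
      by (intro nn_integral_cong) (auto simp: indicator_def)
    then show ?thesis by (simp add: survival_def Let_def)
  qed
  have f: "?f \<in> borel_measurable borel"
    using measurable_compose[OF measurable_Pair1'[of w PS] R_path] w by simp
  have f0: "0 \<le> ?f s" for s using w path_in_space[of w "max 0 s"] by (intro R_nonneg) simp
  have "(\<integral>\<^sup>+l. hazard_density w l * indicator {..c} l \<partial>lborel) =
      (\<integral>\<^sup>+l. ennreal (?f l * survival R w l) * indicator {0..c} l \<partial>lborel)"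
    by (intro nn_integral_cong) (auto simp: hazard_density_def indicator_def)
  also have "\<dots> = ennreal (1 - survival R w c)"
    using hazard_integral[OF f f0 _ c] w(2) unfolding eq by blast
  finally show ?thesis .
qed

lemma survival_nonneg: "0 \<le> survival R w t" and survival_le_1: "survival R w t \<le> 1"
  by (auto simp: survival_def Let_def)

text \<open>Continuity of the survival function holds almost surely under each \<open>K y\<close>.
  The exceptional paths are thus null for every starting point, and the law of the motion of
  \<open>v\<close> carries this over to the tree.\<close>

lemma AE_hazard_density:
  assumes c: "0 \<le> c"
  shows "AE \<omega> in P. born \<omega> v \<longrightarrow>
    (\<integral>\<^sup>+l. hazard_density (motion \<omega> v) l * indicator {..c} l \<partial>lborel) = ennreal (1 - survival R (motion \<omega> v) c)"
proof -
  let ?q = "\<lambda>w. \<integral>\<^sup>+l. hazard_density w l * indicator {..c} l \<partial>lborel"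
  have "(\<lambda>(w, l). hazard_density w l * indicator {..c} l) \<in> borel_measurable (PS \<Otimes>\<^sub>M borel)"
    unfolding split_beta'
    by (intro borel_measurable_times_ennreal hazard_density_measurable2 borel_measurable_indicator' measurable_fst measurable_snd) simp
  then have "(\<lambda>(w, l). hazard_density w l * indicator {..c} l) \<in> borel_measurable (PS \<Otimes>\<^sub>M lborel)"
    by (simp cong: measurable_cong_sets sets_pair_measure_cong)
  from lborel.borel_measurable_nn_integral[OF this]
  have q [measurable]: "?q \<in> borel_measurable PS" .
  have [measurable]: "(\<lambda>w. survival R w c) \<in> borel_measurable PS"
    using measurable_compose[OF measurable_Pair2'[of c borel PS] survival_path] by simp
  let ?B = "{w \<in> space PS. ?q w \<noteq> ennreal (1 - survival R w c)}"
  have B: "?B \<in> sets PS"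
    by (rule borel_measurable_neq[OF q]) measurable
  have K0: "emeasure (K y) ?B = 0" if y: "y \<in> space J" for y
  proof -
    have "AE w in K y. ?q w = ennreal (1 - survival R w c)"
      using survival_continuous[OF y] AE_space
      by eventually_elim (use hazard_density_integral[OF _ _ c] y in \<open>auto simp: space_K\<close>)
    moreover have "{w \<in> space (K y). ?q w \<noteq> ennreal (1 - survival R w c)} = ?B" by (simp add: space_K[OF y])
    ultimately show ?thesis using AE_iff_measurable[of ?B "K y" "\<lambda>w. ?q w = ennreal (1 - survival R w c)"] B
      by (simp add: K_sets[OF y])
  qed
  have "{\<omega> \<in> trees W x. born \<omega> v} \<inter> {\<omega>. motion \<omega> v \<in> ?B} = {\<omega> \<in> space P. \<not> (born \<omega> v \<longrightarrow> ?q (motion \<omega> v) = ennreal (1 - survival R (motion \<omega> v) c))}"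
    by (auto simp: trees_motion)
  moreover have "emeasure P ({\<omega> \<in> trees W x. born \<omega> v} \<inter> {\<omega>. motion \<omega> v \<in> ?B}) = 0"
  proof -
    have "emeasure P ({\<omega> \<in> trees W x. born \<omega> v} \<inter> {\<omega>. motion \<omega> v \<in> ?B}) =
       (\<integral>\<^sup>+\<omega>\<in>{\<omega> \<in> trees W x. born \<omega> v}. emeasure (K (start x \<omega> v)) ?B \<partial>P)"
      by (rule motion_law_event[OF born_sets_TE _ B]) auto
    also have "\<dots> = (\<integral>\<^sup>+\<omega>. 0 \<partial>P)"
      by (intro nn_integral_cong) (simp only: K0[OF start_in_space] space_P mult_zero_left)
    finally show ?thesis by simp
  qed
  moreover have "{\<omega> \<in> trees W x. born \<omega> v} \<inter> {\<omega>. motion \<omega> v \<in> ?B} \<in> sets P"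
  proof -
    have "{\<omega> \<in> trees W x. born \<omega> v} \<inter> ((\<lambda>\<omega>. motion \<omega> v) -` ?B \<inter> space P) \<in> sets P"
      by (intro sets.Int born_sets_P measurable_sets[OF motion_P B])
    then show ?thesis by (rule back_subst[of "\<lambda>A. A \<in> _"]) auto
  qed
  ultimately show ?thesis by (intro AE_I[of _ _ "{\<omega> \<in> trees W x. born \<omega> v} \<inter> {\<omega>. motion \<omega> v \<in> ?B}"]) auto
qed

text \<open>What is known just before the lifetime of \<open>v\<close> is drawn: the particles
  outside the subtree of \<open>v\<close>, and the motion of \<open>v\<close>. As a preimage from a
  product it is controlled by rectangles.\<close>

definition pre_lifetime :: "label \<Rightarrow> 'a tree measure" where
  "pre_lifetime v = vimage_algebra (trees W x) (\<lambda>\<omega>. (\<omega>, motion \<omega> v)) (TE v \<Otimes>\<^sub>M PS)"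

lemma space_pre_lifetime [simp]: "space (pre_lifetime v) = trees W x"
  by (simp add: pre_lifetime_def)

lemma pair_pre_lifetime: "(\<lambda>\<omega>. (\<omega>, motion \<omega> v)) \<in> pre_lifetime v \<rightarrow>\<^sub>M TE v \<Otimes>\<^sub>M PS"
  unfolding pre_lifetime_def
  by (rule measurable_vimage_algebra1) (auto simp: space_pair_measure trees_motion)

lemma id_pre_lifetime: "(\<lambda>\<omega>. \<omega>) \<in> pre_lifetime v \<rightarrow>\<^sub>M TE v"
  using measurable_compose[OF pair_pre_lifetime measurable_fst] by simp

lemma motion_pre_lifetime: "(\<lambda>\<omega>. motion \<omega> v) \<in> pre_lifetime v \<rightarrow>\<^sub>M PS"
  using measurable_compose[OF pair_pre_lifetime measurable_snd] by simp

lemma sets_pre_lifetime: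
  assumes "E \<in> sets (pre_lifetime v)"
  obtains E' where "E' \<in> sets (TE v \<Otimes>\<^sub>M PS)" "E = {\<omega> \<in> trees W x. (\<omega>, motion \<omega> v) \<in> E'}"
proof -
  from assms obtain E' where "E' \<in> sets (TE v \<Otimes>\<^sub>M PS)" "E = (\<lambda>\<omega>. (\<omega>, motion \<omega> v)) -` E' \<inter> trees W x"
    unfolding pre_lifetime_def
    by (subst (asm) sets_vimage_algebra2) (auto simp: space_pair_measure trees_motion)
  then show ?thesis by (intro that[of E']) auto
qed

lemma pair_P: "(\<lambda>\<omega>. (\<omega>, motion \<omega> v)) \<in> P \<rightarrow>\<^sub>M TE v \<Otimes>\<^sub>M PS"
  by (intro measurable_Pair id_P_TE motion_P)

lemma pre_lifetime_P: "E \<in> sets (pre_lifetime v) \<Longrightarrow> E \<in> sets P"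
proof (elim sets_pre_lifetime)
  fix E' assume "E' \<in> sets (TE v \<Otimes>\<^sub>M PS)" "E = {\<omega> \<in> trees W x. (\<omega>, motion \<omega> v) \<in> E'}"
  then show "E \<in> sets P"
    using measurable_sets[OF pair_P, of E' v] by (auto simp: vimage_def Int_def conj_commute)
qed

text \<open>A passage from tails to distribution functions, and from rectangles to all of
  \<open>pre_lifetime\<close>; in this form the lifetime visibly has a density.\<close>

lemma lifetime_law:
  assumes E: "E \<in> sets (pre_lifetime v)" and c: "0 \<le> c"
  shows "emeasure P {\<omega> \<in> E. born \<omega> v \<and> lifetime \<omega> v \<le> ennreal c} =
    (\<integral>\<^sup>+\<omega>\<in>{\<omega> \<in> E. born \<omega> v}. (\<integral>\<^sup>+l. hazard_density (motion \<omega> v) l * indicator {..c} l \<partial>lborel) \<partial>P)"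
proof -
  let ?M = "TE v \<Otimes>\<^sub>M PS"
  let ?b = "{\<omega> \<in> trees W x. born \<omega> v}"
  let ?bc = "{\<omega> \<in> trees W x. born \<omega> v \<and> lifetime \<omega> v \<le> ennreal c}"
  let ?q = "\<lambda>\<omega>. ennreal (1 - survival R (motion \<omega> v) c)"
  have sm [measurable]: "(\<lambda>\<omega>. survival R (motion \<omega> v) c) \<in> borel_measurable P"
    using measurable_compose[OF measurable_Pair[OF motion_P measurable_const] survival_path, of c v] by simp
  have b [measurable]: "?b \<in> sets P" by (rule born_sets_P)
  have "{\<omega> \<in> space P. lifetime \<omega> v \<le> ennreal c} \<in> sets P" by measurable
  from sets.Int[OF b this] have bc: "?bc \<in> sets P"
    by (rule back_subst[of "\<lambda>A. A \<in> _"]) auto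
  let ?N1 = "distr (density P (indicator ?bc)) ?M (\<lambda>\<omega>. (\<omega>, motion \<omega> v))"
  let ?N2 = "distr (density P (\<lambda>\<omega>. ?q \<omega> * indicator ?b \<omega>)) ?M (\<lambda>\<omega>. (\<omega>, motion \<omega> v))"
  have emN: "emeasure (distr (density P h) ?M (\<lambda>\<omega>. (\<omega>, motion \<omega> v))) C =
      (\<integral>\<^sup>+\<omega>. h \<omega> * indicator {\<omega> \<in> trees W x. (\<omega>, motion \<omega> v) \<in> C} \<omega> \<partial>P)"
    if "C \<in> sets ?M" and [measurable]: "h \<in> borel_measurable P" for C h
  proof -
    have C: "(\<lambda>\<omega>. (\<omega>, motion \<omega> v)) -` C \<inter> space P \<in> sets P" using measurable_sets[OF pair_P that(1)] .
    have "emeasure (distr (density P h) ?M (\<lambda>\<omega>. (\<omega>, motion \<omega> v))) C =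
        emeasure (density P h) ((\<lambda>\<omega>. (\<omega>, motion \<omega> v)) -` C \<inter> space P)"
      using pair_P that by (subst emeasure_distr) (simp_all cong: measurable_cong_sets)
    also have "\<dots> = (\<integral>\<^sup>+\<omega>. h \<omega> * indicator ((\<lambda>\<omega>. (\<omega>, motion \<omega> v)) -` C \<inter> space P) \<omega> \<partial>P)"
      by (rule emeasure_density[OF that(2) C])
    also have "\<dots> = (\<integral>\<^sup>+\<omega>. h \<omega> * indicator {\<omega> \<in> trees W x. (\<omega>, motion \<omega> v) \<in> C} \<omega> \<partial>P)"
      by (intro nn_integral_cong) (auto simp: indicator_def)
    finally show ?thesis .
  qed
  have hm: "indicator ?bc \<in> borel_measurable P" "(\<lambda>\<omega>. ?q \<omega> * indicator ?b \<omega>) \<in> borel_measurable P"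
    using bc by measurable
  have "?N1 = ?N2"
  proof (rule measure_eqI_rectangles)
    have "emeasure ?N1 (space ?M) \<le> (\<integral>\<^sup>+\<omega>. 1 \<partial>P)"
      unfolding emN[OF sets.top hm(1)] by (intro nn_integral_mono) (auto simp: indicator_def)
    also have "\<dots> = 1" using P.emeasure_space_1 by simp
    finally show "emeasure ?N1 (space (TE v) \<times> space PS) \<noteq> \<infinity>"
      by (auto simp: space_pair_measure top_unique)
    fix A B assume A: "A \<in> sets (TE v)" and B: "B \<in> sets PS"
    have AB: "A \<times> B \<in> sets ?M" using A B by simp
    have At: "A \<subseteq> trees W x" using sets.sets_into_space[OF A] by simp
    let ?A = "A \<inter> ?b"
    let ?AB = "?A \<inter> {\<omega>. motion \<omega> v \<in> B}"
    have A': "?A \<in> sets (TE v)" "?A \<subseteq> {\<omega>. born \<omega> v}" using A born_sets_TE by auto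
    have ABs: "?AB \<in> sets P"
    proof -
      have "?A \<inter> ((\<lambda>\<omega>. motion \<omega> v) -` B \<inter> space P) \<in> sets P"
        by (intro sets.Int TE_P[OF A'(1)] measurable_sets[OF motion_P B])
      then show ?thesis by (rule back_subst[of "\<lambda>A. A \<in> _"]) auto
    qed
    have lts: "{\<omega> \<in> space P. lifetime \<omega> v \<le> ennreal c} \<in> sets P" "{\<omega> \<in> space P. ennreal c < lifetime \<omega> v} \<in> sets P"
      by measurable
    have split: "emeasure P ?AB = emeasure P (?AB \<inter> {\<omega> \<in> space P. lifetime \<omega> v \<le> ennreal c}) +
        emeasure P (?AB \<inter> {\<omega> \<in> space P. ennreal c < lifetime \<omega> v})"
      using ABs lts by (subst plus_emeasure) (auto intro!: arg_cong[where f="emeasure P"])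
    have surv: "emeasure P (?AB \<inter> {\<omega> \<in> space P. ennreal c < lifetime \<omega> v}) =
        (\<integral>\<^sup>+\<omega>\<in>?AB. ennreal (survival R (motion \<omega> v) c) \<partial>P)"
    proof -
      have "?AB \<inter> {\<omega> \<in> space P. ennreal c < lifetime \<omega> v} = ?AB \<inter> {\<omega>. ennreal c < lifetime \<omega> v}" by auto
      then show ?thesis using lifetime_law_event[OF A' B c] by simp
    qed
    have one: "emeasure P ?AB = (\<integral>\<^sup>+\<omega>\<in>?AB. ?q \<omega> \<partial>P) + (\<integral>\<^sup>+\<omega>\<in>?AB. ennreal (survival R (motion \<omega> v) c) \<partial>P)"
    proof -
      have "emeasure P ?AB = (\<integral>\<^sup>+\<omega>. indicator ?AB \<omega> \<partial>P)" using ABs by simp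
      also have "\<dots> = (\<integral>\<^sup>+\<omega>. ?q \<omega> * indicator ?AB \<omega> + ennreal (survival R (motion \<omega> v) c) * indicator ?AB \<omega> \<partial>P)"
        using survival_nonneg survival_le_1
        by (intro nn_integral_cong) (simp add: indicator_def ennreal_plus[symmetric] del: ennreal_plus)
      also have "\<dots> = (\<integral>\<^sup>+\<omega>\<in>?AB. ?q \<omega> \<partial>P) + (\<integral>\<^sup>+\<omega>\<in>?AB. ennreal (survival R (motion \<omega> v) c) \<partial>P)"
        by (intro nn_integral_add borel_measurable_times_ennreal borel_measurable_indicator ABs; measurable)
      finally show ?thesis .
    qed
    \<comment> \<open>The tail is removed by cancellation in \<open>ennreal\<close>, for which it
      has to be finite.\<close>
    have fin: "(\<integral>\<^sup>+\<omega>\<in>?AB. ennreal (survival R (motion \<omega> v) c) \<partial>P) \<noteq> \<infinity>"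
      unfolding surv[symmetric] by simp
    have "(\<integral>\<^sup>+\<omega>\<in>?AB. ennreal (survival R (motion \<omega> v) c) \<partial>P) + emeasure P (?AB \<inter> {\<omega> \<in> space P. lifetime \<omega> v \<le> ennreal c}) =
        (\<integral>\<^sup>+\<omega>\<in>?AB. ennreal (survival R (motion \<omega> v) c) \<partial>P) + (\<integral>\<^sup>+\<omega>\<in>?AB. ?q \<omega> \<partial>P)"
      using split one unfolding surv by (simp only: add.commute)
    then have "emeasure P (?AB \<inter> {\<omega> \<in> space P. lifetime \<omega> v \<le> ennreal c}) = (\<integral>\<^sup>+\<omega>\<in>?AB. ?q \<omega> \<partial>P)"
      using fin unfolding ennreal_add_left_cancel by blast
    moreover have "emeasure ?N1 (A \<times> B) = emeasure P (?AB \<inter> {\<omega> \<in> space P. lifetime \<omega> v \<le> ennreal c})"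
    proof -
      have "emeasure ?N1 (A \<times> B) = (\<integral>\<^sup>+\<omega>. indicator (?AB \<inter> {\<omega> \<in> space P. lifetime \<omega> v \<le> ennreal c}) \<omega> \<partial>P)"
        unfolding emN[OF AB hm(1)] using At by (intro nn_integral_cong) (auto simp: indicator_def)
      then show ?thesis using ABs lts by simp
    qed
    moreover have "emeasure ?N2 (A \<times> B) = (\<integral>\<^sup>+\<omega>\<in>?AB. ?q \<omega> \<partial>P)"
      unfolding emN[OF AB hm(2)] using At by (intro nn_integral_cong) (auto simp: indicator_def)
    ultimately show "emeasure ?N1 (A \<times> B) = emeasure ?N2 (A \<times> B)" by simp
  qed simp_all
  from E obtain E' where E': "E' \<in> sets ?M" "E = {\<omega> \<in> trees W x. (\<omega>, motion \<omega> v) \<in> E'}"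
    by (rule sets_pre_lifetime)
  have "emeasure P {\<omega> \<in> E. born \<omega> v \<and> lifetime \<omega> v \<le> ennreal c} = (\<integral>\<^sup>+\<omega>. indicator (E \<inter> ?bc) \<omega> \<partial>P)"
  proof -
    have "{\<omega> \<in> E. born \<omega> v \<and> lifetime \<omega> v \<le> ennreal c} = E \<inter> ?bc" using E'(2) by auto
    then show ?thesis using sets.Int[OF pre_lifetime_P[OF E] bc] by simp
  qed
  also have "\<dots> = emeasure ?N1 E'"
    unfolding emN[OF E'(1) hm(1)] by (intro nn_integral_cong) (auto simp: indicator_def E'(2))
  also have "\<dots> = emeasure ?N2 E'" using \<open>?N1 = ?N2\<close> by simp
  also have "\<dots> = (\<integral>\<^sup>+\<omega>\<in>{\<omega> \<in> E. born \<omega> v}. (\<integral>\<^sup>+l. hazard_density (motion \<omega> v) l * indicator {..c} l \<partial>lborel) \<partial>P)"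
    unfolding emN[OF E'(1) hm(2)]
    by (intro nn_integral_cong_AE, use AE_hazard_density[OF c, of v] AE_space in eventually_elim)
      (auto simp: indicator_def E'(2))
  finally show ?thesis .
qed

text \<open>For a born \<open>v\<close> with finite lifetime, the pair of prior information and
  lifetime has density \<open>hazard_density\<close> with respect to the product of \<open>P\<close>
  and Lebesgue measure, and this product does not charge a set with null sections.\<close>

lemma lifetime_absolutely_continuous:
  assumes N: "N \<in> sets (pre_lifetime v \<Otimes>\<^sub>M borel)"
    and null: "AE \<omega> in P. born \<omega> v \<longrightarrow> emeasure lborel {l. 0 \<le> l \<and> (\<omega>, l) \<in> N} = 0"
  shows "emeasure P {\<omega> \<in> trees W x. born \<omega> v \<and> lifetime \<omega> v < \<infinity> \<and> (\<omega>, enn2real (lifetime \<omega> v)) \<in> N} = 0"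
proof -
  let ?T = "pre_lifetime v"
  let ?M = "?T \<Otimes>\<^sub>M borel"
  \<comment> \<open>\<open>enn2real\<close> sends an infinite lifetime to \<open>0\<close>;
    excluding it avoids a spurious atom there.\<close>
  let ?b = "{\<omega> \<in> trees W x. born \<omega> v \<and> lifetime \<omega> v < \<infinity>}"
  let ?g = "\<lambda>z. hazard_density (motion (fst z) v) (snd z) * indicator {\<omega> \<in> trees W x. born \<omega> v} (fst z)"
  let ?f = "\<lambda>\<omega>. (\<omega>, enn2real (lifetime \<omega> v))"
  have idP: "(\<lambda>\<omega>. \<omega>) \<in> P \<rightarrow>\<^sub>M ?T"
  proof (rule measurableI)
    fix A assume A: "A \<in> sets ?T"
    have "A \<subseteq> trees W x" using sets.sets_into_space[OF A] by simp
    then show "(\<lambda>\<omega>. \<omega>) -` A \<inter> space P \<in> sets P" using pre_lifetime_P[OF A] by (simp add: Int_absorb2)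
  qed simp
  have f: "?f \<in> P \<rightarrow>\<^sub>M ?M" by (intro measurable_Pair idP borel_measurable_enn2real lifetime_P)
  have b: "?b \<in> sets P"
  proof -
    have "{\<omega> \<in> space P. lifetime \<omega> v < \<infinity>} \<in> sets P" by measurable
    from sets.Int[OF born_sets_P this] show ?thesis by (rule back_subst[of "\<lambda>A. A \<in> _"]) auto
  qed
  have idM: "(\<lambda>z. z) \<in> P \<Otimes>\<^sub>M lborel \<rightarrow>\<^sub>M ?M"
  proof -
    have "(\<lambda>z. (fst z, snd z)) \<in> P \<Otimes>\<^sub>M lborel \<rightarrow>\<^sub>M ?M"
      by (intro measurable_Pair measurable_compose[OF measurable_fst idP]) (simp cong: measurable_cong_sets)
    then show ?thesis by simp
  qed
  have g: "?g \<in> borel_measurable (P \<Otimes>\<^sub>M lborel)"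
    by (intro borel_measurable_times_ennreal hazard_density_measurable2 measurable_compose[OF measurable_fst motion_P]
        measurable_compose[OF measurable_fst borel_measurable_indicator[OF born_sets_P]]) (simp cong: measurable_cong_sets)
  let ?N1 = "distr (density P (indicator ?b)) ?M ?f"
  let ?N2 = "distr (density (P \<Otimes>\<^sub>M lborel) ?g) ?M (\<lambda>z. z)"
  have N1: "emeasure ?N1 C = emeasure P {\<omega> \<in> ?b. ?f \<omega> \<in> C}" if "C \<in> sets ?M" for C
  proof -
    have C: "?f -` C \<inter> space P \<in> sets P" using measurable_sets[OF f that] .
    have "emeasure ?N1 C = emeasure (density P (indicator ?b)) (?f -` C \<inter> space P)"
      using f that by (subst emeasure_distr) (simp_all cong: measurable_cong_sets)
    also have "\<dots> = (\<integral>\<^sup>+\<omega>. indicator ?b \<omega> * indicator (?f -` C \<inter> space P) \<omega> \<partial>P)"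
      by (rule emeasure_density) (use b C in auto)
    also have "\<dots> = (\<integral>\<^sup>+\<omega>. indicator (?b \<inter> (?f -` C \<inter> space P)) \<omega> \<partial>P)"
      by (simp only: indicator_inter_arith)
    also have "\<dots> = emeasure P (?b \<inter> (?f -` C \<inter> space P))" using sets.Int[OF b C] by simp
    also have "?b \<inter> (?f -` C \<inter> space P) = {\<omega> \<in> ?b. ?f \<omega> \<in> C}" by auto
    finally show ?thesis .
  qed
  have N2: "emeasure ?N2 C = (\<integral>\<^sup>+\<omega>. \<integral>\<^sup>+l. ?g (\<omega>, l) * indicator C (\<omega>, l) \<partial>lborel \<partial>P)" if "C \<in> sets ?M" for C
  proof -
    have C: "C \<inter> space (P \<Otimes>\<^sub>M lborel) \<in> sets (P \<Otimes>\<^sub>M lborel)" using measurable_sets[OF idM that] by simp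
    have "emeasure ?N2 C = emeasure (density (P \<Otimes>\<^sub>M lborel) ?g) (C \<inter> space (P \<Otimes>\<^sub>M lborel))"
      using idM that by (subst emeasure_distr) (simp_all cong: measurable_cong_sets)
    also have "\<dots> = (\<integral>\<^sup>+z. ?g z * indicator (C \<inter> space (P \<Otimes>\<^sub>M lborel)) z \<partial>(P \<Otimes>\<^sub>M lborel))"
      by (rule emeasure_density[OF g C])
    also have "\<dots> = (\<integral>\<^sup>+\<omega>. \<integral>\<^sup>+l. ?g (\<omega>, l) * indicator (C \<inter> space (P \<Otimes>\<^sub>M lborel)) (\<omega>, l) \<partial>lborel \<partial>P)"
      by (rule lborel.nn_integral_fst[symmetric], rule borel_measurable_times_ennreal[OF g borel_measurable_indicator[OF C]])
    also have "\<dots> = (\<integral>\<^sup>+\<omega>. \<integral>\<^sup>+l. ?g (\<omega>, l) * indicator C (\<omega>, l) \<partial>lborel \<partial>P)"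
      by (intro nn_integral_cong) (auto simp: indicator_def space_pair_measure)
    finally show ?thesis .
  qed
  \<comment> \<open>\<open>lifetime_law\<close> gives distribution functions, so half-lines are
    taken as generators in the second coordinate.\<close>
  let ?E = "{a \<times> b | a b. a \<in> sets ?T \<and> b \<in> range (atMost :: real \<Rightarrow> _)}"
  have Tsub: "\<And>a. a \<in> sets ?T \<Longrightarrow> a \<subseteq> trees W x" using sets.sets_into_space[of _ ?T] by simp
  have Ttop: "trees W x \<in> sets ?T" using sets.top[of ?T] by simp
  have setsM: "sets ?M = sigma_sets (trees W x \<times> UNIV) ?E"
  proof -
    have "sets ?M = sets (sigma (space ?T \<times> space (borel :: real measure)) ?E)"
    proof (rule sets_pair_eq[where Ca="{space ?T}" and Cb="range (\<lambda>n::nat. {..real n})"])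
      show "sets ?T = sigma_sets (space ?T) (sets ?T)" by (rule sets.sigma_sets_eq[symmetric])
      have "sets (borel :: real measure) = sets (sigma UNIV (range (atMost :: real \<Rightarrow> _)))"
        by (rule arg_cong[where f=sets, OF borel_eq_atMost])
      also have "\<dots> = sigma_sets UNIV (range atMost)" by (rule sets_measure_of) simp
      finally show "sets (borel :: real measure) = sigma_sets (space borel) (range atMost)" by simp
      show "(\<Union>n::nat. {..real n}) = space borel" by (auto intro: real_arch_simple)
    qed (auto simp: Ttop dest: Tsub)
    then show ?thesis by (subst (asm) sets_measure_of) (auto dest: Tsub)
  qed
  have "?N1 = ?N2"
  proof (rule measure_eqI_generator_eq[where E="?E" and A="\<lambda>n::nat. trees W x \<times> {..real n}" and \<Omega>="trees W x \<times> UNIV"])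
    show "Int_stable ?E"
    proof (rule Int_stableI)
      fix a b assume "a \<in> ?E" "b \<in> ?E"
      then obtain a1 c1 b1 c2 where "a = a1 \<times> {..c1}" "b = b1 \<times> {..c2}" "a1 \<in> sets ?T" "b1 \<in> sets ?T" by auto
      then have "a \<inter> b = (a1 \<inter> b1) \<times> {..min c1 c2}" "a1 \<inter> b1 \<in> sets ?T" by auto
      then show "a \<inter> b \<in> ?E" by blast
    qed
    show "?E \<subseteq> Pow (trees W x \<times> UNIV)" by (auto dest: Tsub)
    show "sets ?N1 = sigma_sets (trees W x \<times> UNIV) ?E" "sets ?N2 = sigma_sets (trees W x \<times> UNIV) ?E"
      using setsM by simp_all
    show "range (\<lambda>n::nat. trees W x \<times> {..real n}) \<subseteq> ?E"
      using sets.top[of ?T] by auto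
    show "(\<Union>n::nat. trees W x \<times> {..real n}) = trees W x \<times> UNIV" by (auto intro: real_arch_simple)
    show "emeasure ?N1 (trees W x \<times> {..real n}) \<noteq> \<infinity>" for n :: nat
    proof -
      have "trees W x \<times> {..real n} \<in> sets ?M" using sets.top[of ?T] by (intro pair_measureI) auto
      from N1[OF this] show ?thesis by simp
    qed
    fix X assume "X \<in> ?E"
    then obtain a c where X: "X = a \<times> {..c}" "a \<in> sets ?T" by auto
    have XM: "X \<in> sets ?M" unfolding X(1) using X(2) by (intro pair_measureI) auto
    have at: "a \<subseteq> trees W x" using sets.sets_into_space[OF X(2)] by simp
    show "emeasure ?N1 X = emeasure ?N2 X"
    proof (cases "0 \<le> c")
      case True
      have "{\<omega> \<in> ?b. ?f \<omega> \<in> X} = {\<omega> \<in> a. born \<omega> v \<and> lifetime \<omega> v \<le> ennreal c}"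
      proof -
        have "lifetime \<omega> v < \<infinity> \<and> enn2real (lifetime \<omega> v) \<le> c \<longleftrightarrow> lifetime \<omega> v \<le> ennreal c" for \<omega> :: "'a tree"
          using True by (cases "lifetime \<omega> v") (auto simp: top_unique)
        then show ?thesis using at X by auto
      qed
      then have "emeasure ?N1 X = (\<integral>\<^sup>+\<omega>\<in>{\<omega> \<in> a. born \<omega> v}. (\<integral>\<^sup>+l. hazard_density (motion \<omega> v) l * indicator {..c} l \<partial>lborel) \<partial>P)"
        using N1[OF XM] lifetime_law[OF X(2) True] by simp
      also have "\<dots> = emeasure ?N2 X"
        unfolding N2[OF XM]
      proof (rule nn_integral_cong)
        fix \<omega> assume "\<omega> \<in> space P"
        then show "(\<integral>\<^sup>+l. hazard_density (motion \<omega> v) l * indicator {..c} l \<partial>lborel) * indicator {\<omega> \<in> a. born \<omega> v} \<omega> =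
            (\<integral>\<^sup>+l. ?g (\<omega>, l) * indicator X (\<omega>, l) \<partial>lborel)"
          by (cases "\<omega> \<in> a \<and> born \<omega> v") (auto simp: X indicator_def intro!: nn_integral_cong)
      qed
      finally show ?thesis .
    next
      case False
      have "{\<omega> \<in> ?b. ?f \<omega> \<in> X} = {}"
      proof -
        have "\<not> enn2real (lifetime \<omega> v) \<le> c" for \<omega> :: "'a tree"
          using False enn2real_nonneg[of "lifetime \<omega> v"] by linarith
        then show ?thesis by (auto simp: X)
      qed
      then have "emeasure ?N1 X = 0" unfolding N1[OF XM] by (simp only: emeasure_empty)
      moreover have "emeasure ?N2 X = (\<integral>\<^sup>+\<omega>. \<integral>\<^sup>+l. 0 \<partial>(lborel :: real measure) \<partial>P)"
        unfolding N2[OF XM] using False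
        by (intro nn_integral_cong) (auto simp: X indicator_def hazard_density_def)
      ultimately show ?thesis by simp
    qed
  qed
  then have "emeasure P {\<omega> \<in> ?b. ?f \<omega> \<in> N} = (\<integral>\<^sup>+\<omega>. \<integral>\<^sup>+l. ?g (\<omega>, l) * indicator N (\<omega>, l) \<partial>lborel \<partial>P)"
    using N1[OF N] N2[OF N] by simp
  also have "\<dots> = (\<integral>\<^sup>+\<omega>. 0 \<partial>P)"
  proof (rule nn_integral_cong_AE, use null AE_space in eventually_elim)
    fix \<omega> assume \<omega>: "born \<omega> v \<longrightarrow> emeasure lborel {l. 0 \<le> l \<and> (\<omega>, l) \<in> N} = 0" "\<omega> \<in> space P"
    have s: "{l. 0 \<le> l \<and> (\<omega>, l) \<in> N} \<in> sets lborel"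
    proof -
      have "{l \<in> space borel. 0 \<le> l \<and> l \<in> Pair \<omega> -` N} \<in> sets (borel :: real measure)"
        using sets_Pair1[OF N, of \<omega>] by measurable
      then show ?thesis by simp
    qed
    show "(\<integral>\<^sup>+l. ?g (\<omega>, l) * indicator N (\<omega>, l) \<partial>lborel) = 0"
    proof (cases "born \<omega> v")
      case True
      then have "AE l in lborel. \<not> (0 \<le> l \<and> (\<omega>, l) \<in> N)"
        using \<omega> s by (intro AE_I[where N="{l. 0 \<le> l \<and> (\<omega>, l) \<in> N}"]) auto
      then have "AE l in lborel. ?g (\<omega>, l) * indicator N (\<omega>, l) = 0"
        by eventually_elim (auto simp: indicator_def hazard_density_def)
      then have "(\<integral>\<^sup>+l. ?g (\<omega>, l) * indicator N (\<omega>, l) \<partial>lborel) = (\<integral>\<^sup>+l. 0 \<partial>(lborel :: real measure))"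
        by (rule nn_integral_cong_AE)
      then show ?thesis by simp
    qed simp
  qed
  finally have "emeasure P {\<omega> \<in> ?b. ?f \<omega> \<in> N} = 0" by simp
  moreover have "{\<omega> \<in> ?b. ?f \<omega> \<in> N} = {\<omega> \<in> trees W x. born \<omega> v \<and> lifetime \<omega> v < \<infinity> \<and> (\<omega>, enn2real (lifetime \<omega> v)) \<in> N}"
    by auto
  ultimately show ?thesis by simp
qed

end

section \<open>Ancestral paths are absolutely continuous\<close>

context branching
begin

text \<open>
  The null sections are required for every value of \<open>V\<close>, not just for almost every one; this weak
  form of absolute continuity is all that is needed, and it is inherited by the children of \<open>v\<close>.
  In the application \<open>V\<close> is a time of birth.
\<close>

definition ancestral_ac :: "label \<Rightarrow> ('a tree \<Rightarrow> real) \<Rightarrow> bool" where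
  "ancestral_ac v V \<longleftrightarrow> (\<forall>N\<in>sets (borel \<Otimes>\<^sub>M PS).
     (\<forall>s. emeasure (K x) {w \<in> W. (s, w) \<in> N} = 0) \<longrightarrow>
     emeasure P {\<omega> \<in> trees W x. born \<omega> v \<and> (V \<omega>, position \<omega> v) \<in> N} = 0)"

text \<open>Total version of \<open>position\<close>: an unborn label gets some path in
  \<open>W\<close>, so that measurability can be stated without restricting the space.\<close>

definition ancestral_path :: "label \<Rightarrow> 'a tree \<Rightarrow> real \<Rightarrow> 'a" where
  "ancestral_path v \<omega> = (if born \<omega> v then position \<omega> v else motion \<omega> [])"

lemma ancestral_path_in: "\<omega> \<in> trees W x \<Longrightarrow> ancestral_path v \<omega> \<in> W"
  using position_in_paths[OF admissible] by (simp add: ancestral_path_def trees_motion)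

lemma ancestral_path_measurable:
  assumes M: "space M = trees W x" "{\<omega> \<in> trees W x. born \<omega> v} \<in> sets M"
    and "\<And>u. strict_prefix u v \<Longrightarrow> (\<lambda>\<omega>. lifetime \<omega> u) \<in> borel_measurable M"
    and m: "\<And>u. prefix u v \<Longrightarrow> (\<lambda>\<omega>. motion \<omega> u) \<in> M \<rightarrow>\<^sub>M PS"
  shows "ancestral_path v \<in> M \<rightarrow>\<^sub>M PS"
proof -
  have "{\<omega> \<in> space M. born \<omega> v} \<in> sets M" using M by simp
  then have "(\<lambda>\<omega>. if born \<omega> v then position \<omega> v else motion \<omega> []) \<in> M \<rightarrow>\<^sub>M PS"
  proof (subst measurable_If_restrict_space_iff, safe)
    show "(\<lambda>\<omega>. position \<omega> v) \<in> restrict_space M {\<omega>. born \<omega> v} \<rightarrow>\<^sub>M PS"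
      by (rule measurable_position_general[OF M(1)]) (use m assms(3) in auto)
    show "(\<lambda>\<omega>. motion \<omega> []) \<in> restrict_space M {\<omega>. \<not> born \<omega> v} \<rightarrow>\<^sub>M PS"
      by (rule measurable_restrict_space1[OF m]) simp
  qed
  then show ?thesis by (simp add: ancestral_path_def[abs_def])
qed

lemma ancestral_path_pre_lifetime: "ancestral_path v \<in> pre_lifetime v \<rightarrow>\<^sub>M PS"
proof (rule ancestral_path_measurable)
  show "{\<omega> \<in> trees W x. born \<omega> v} \<in> sets (pre_lifetime v)"
  proof -
    have "(\<lambda>\<omega>. \<omega>) -` {\<omega> \<in> trees W x. born \<omega> v} \<inter> space (pre_lifetime v) \<in> sets (pre_lifetime v)"
      by (rule measurable_sets[OF id_pre_lifetime born_sets_TE])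
    then show ?thesis by (rule back_subst[of "\<lambda>A. A \<in> _"]) auto
  qed
  show "(\<lambda>\<omega>. lifetime \<omega> u) \<in> borel_measurable (pre_lifetime v)" if "strict_prefix u v" for u
    by (rule measurable_compose[OF id_pre_lifetime measurable_lifetime]) (use that in auto)
  show "(\<lambda>\<omega>. motion \<omega> u) \<in> pre_lifetime v \<rightarrow>\<^sub>M PS" if "prefix u v" for u
  proof (cases "u = v")
    case True
    then show ?thesis using motion_pre_lifetime by simp
  next
    case False
    then have "\<not> prefix v u" using that by (auto dest: prefix_order.antisym)
    then show ?thesis by (intro measurable_compose[OF id_pre_lifetime measurable_motion]) simp
  qed
qed simp

lemma ancestral_path_TE: "ancestral_path v \<in> TE (v @ [j]) \<rightarrow>\<^sub>M PS"
proof (rule ancestral_path_measurable)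
  have sub: "{u. strict_prefix u v} \<subseteq> {u. \<not> prefix (v @ [j]) u}" "{u. prefix u v} \<subseteq> {u. \<not> prefix (v @ [j]) u}"
    by (auto dest!: prefix_length_le prefix_length_less)
  show "{\<omega> \<in> trees W x. born \<omega> v} \<in> sets (TE (v @ [j]))"
    using measurable_born[OF sub(1), of J W x] by (simp add: pred_def)
  show "(\<lambda>\<omega>. lifetime \<omega> u) \<in> borel_measurable (TE (v @ [j]))" if "strict_prefix u v" for u
    by (rule measurable_lifetime) (use that sub in auto)
  show "(\<lambda>\<omega>. motion \<omega> u) \<in> TE (v @ [j]) \<rightarrow>\<^sub>M PS" if "prefix u v" for u
    by (rule measurable_motion) (use that sub in auto)
qed simp

text \<open>At the root the ancestral path is the motion itself, with law \<open>K x\<close>, so the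
  single section at \<open>c\<close> decides.\<close>

lemma ancestral_ac_Nil: "ancestral_ac [] (\<lambda>\<omega>. c)"
  unfolding ancestral_ac_def
proof (intro ballI impI)
  fix N :: "(real \<times> (real \<Rightarrow> 'a)) set"
  assume N: "N \<in> sets (borel \<Otimes>\<^sub>M PS)" and null: "\<forall>s. emeasure (K x) {w \<in> W. (s, w) \<in> N} = 0"
  have "(\<lambda>(\<omega>, w). (c, w)) \<in> TE [] \<Otimes>\<^sub>M PS \<rightarrow>\<^sub>M borel \<Otimes>\<^sub>M PS"
    unfolding split_beta' by (intro measurable_Pair measurable_snd) simp
  from measurable_sets[OF this N]
  have "emeasure P {\<omega> \<in> trees W x. born \<omega> [] \<and> (\<omega>, motion \<omega> []) \<in> (\<lambda>(\<omega>, w). (c, w)) -` N \<inter> space (TE [] \<Otimes>\<^sub>M PS)} =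
     (\<integral>\<^sup>+\<omega>\<in>{\<omega>. born \<omega> []}. emeasure (K (start x \<omega> [])) {w \<in> W. (\<omega>, w) \<in> (\<lambda>(\<omega>, w). (c, w)) -` N \<inter> space (TE [] \<Otimes>\<^sub>M PS)} \<partial>P)"
    by (rule motion_law)
  also have "\<dots> = (\<integral>\<^sup>+\<omega>. 0 \<partial>P)"
  proof (rule nn_integral_cong)
    fix \<omega> assume "\<omega> \<in> space P"
    then have "{w \<in> W. (\<omega>, w) \<in> (\<lambda>(\<omega>, w). (c, w)) -` N \<inter> space (TE [] \<Otimes>\<^sub>M PS)} = {w \<in> W. (c, w) \<in> N}"
      by (auto simp: space_pair_measure)
    then show "emeasure (K (start x \<omega> [])) {w \<in> W. (\<omega>, w) \<in> (\<lambda>(\<omega>, w). (c, w)) -` N \<inter> space (TE [] \<Otimes>\<^sub>M PS)} *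
        indicator {\<omega>. born \<omega> []} \<omega> = 0"
      using null by (simp add: start_def)
  qed
  also have "{\<omega> \<in> trees W x. born \<omega> [] \<and> (\<omega>, motion \<omega> []) \<in> (\<lambda>(\<omega>, w). (c, w)) -` N \<inter> space (TE [] \<Otimes>\<^sub>M PS)} =
      {\<omega> \<in> trees W x. born \<omega> [] \<and> (c, position \<omega> []) \<in> N}"
    by (auto simp: space_pair_measure position_Nil trees_motion)
  finally show "emeasure P {\<omega> \<in> trees W x. born \<omega> [] \<and> (c, position \<omega> []) \<in> N} = 0" by simp
qed

text \<open>Let \<open>G\<close> be the conditional probability of \<open>N\<close> given the old
  time \<open>s\<close>, the path of \<open>v\<close> and its death time \<open>d\<close>. For fixed
  \<open>s\<close> and \<open>d\<close>, restarting at \<open>d\<close> keeps the law, so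
  \<open>G\<close> integrates to \<open>0\<close> under \<open>K x\<close>; by Fubini almost every
  path has \<open>G = 0\<close> for almost every \<open>d\<close>. The hypothesis on
  \<open>v\<close> transfers this to the ancestral path, and the density of the lifetime to the
  actual death time. The function \<open>\<phi>\<close> allows the old time to be retained or
  replaced by the death of \<open>v\<close>.\<close>

lemma ancestral_ac_snoc:
  assumes ac: "ancestral_ac v V" and V: "V \<in> borel_measurable (TE v)"
    and \<phi>: "(\<lambda>(s, d). \<phi> s d) \<in> borel_measurable (borel \<Otimes>\<^sub>M borel)"
  shows "ancestral_ac (v @ [j]) (\<lambda>\<omega>. \<phi> (V \<omega>) (enn2real (death \<omega> v)))"
  unfolding ancestral_ac_def
proof (intro ballI impI)
  fix N :: "(real \<times> (real \<Rightarrow> 'a)) set"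
  assume N: "N \<in> sets (borel \<Otimes>\<^sub>M PS)" and null: "\<forall>s. emeasure (K x) {w \<in> W. (s, w) \<in> N} = 0"
  let ?d = "\<lambda>\<omega>. enn2real (death \<omega> v)"
  \<comment> \<open>Pasting arbitrary pairs of paths leads only into \<open>PU\<close>, so
    \<open>N\<close> is represented as a trace.\<close>
  obtain N' where N': "N' \<in> sets (borel \<Otimes>\<^sub>M PU)" "N = N' \<inter> (space borel \<times> W)"
    using path_space_trace[OF N] by blast
  have N'sec: "Pair s -` N' \<in> sets PU" for s using sets_Pair1[OF N'(1)] .
  let ?A = "borel \<Otimes>\<^sub>M (PS \<Otimes>\<^sub>M borel) :: (real \<times> (real \<Rightarrow> 'a) \<times> real) measure"
  \<comment> \<open>\<open>max 0\<close> keeps all evaluation times nonnegative; at actual death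
    times it changes nothing.\<close>
  define pst :: "(real \<times> (real \<Rightarrow> 'a) \<times> real) \<times> (real \<Rightarrow> 'a) \<Rightarrow> real \<times> (real \<Rightarrow> 'a)" where
    "pst = (\<lambda>z. (\<phi> (fst (fst z)) (max 0 (snd (snd (fst z)))),
      paste (fst (snd (fst z))) (max 0 (snd (snd (fst z)))) (snd z)))"
  have pst: "pst \<in> ?A \<Otimes>\<^sub>M PS \<rightarrow>\<^sub>M borel \<Otimes>\<^sub>M PU"
    unfolding pst_def
  proof (rule measurable_Pair)
    have d: "(\<lambda>z. max 0 (snd (snd (fst z)))) \<in> borel_measurable (?A \<Otimes>\<^sub>M PS)"
      by (intro borel_measurable_max borel_measurable_const
          measurable_compose[OF measurable_fst measurable_compose[OF measurable_snd measurable_snd]])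
    have s: "(\<lambda>z. fst (fst z)) \<in> borel_measurable (?A \<Otimes>\<^sub>M PS)"
      by (rule measurable_compose[OF measurable_fst measurable_fst])
    show "(\<lambda>z. \<phi> (fst (fst z)) (max 0 (snd (snd (fst z))))) \<in> borel_measurable (?A \<Otimes>\<^sub>M PS)"
      using measurable_compose[OF measurable_Pair[OF s d] \<phi>] by simp
    have w: "(\<lambda>z. fst (snd (fst z))) \<in> ?A \<Otimes>\<^sub>M PS \<rightarrow>\<^sub>M PS"
      by (rule measurable_compose[OF measurable_fst measurable_compose[OF measurable_snd measurable_fst]])
    show "(\<lambda>z. paste (fst (snd (fst z))) (max 0 (snd (snd (fst z)))) (snd z)) \<in> ?A \<Otimes>\<^sub>M PS \<rightarrow>\<^sub>M PU"
      using measurable_compose[OF measurable_Pair[OF measurable_Pair[OF w d] measurable_snd] paste_measurable] by simp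
  qed
  define G where "G = (\<lambda>a. emeasure (K (fst (snd a) (max 0 (snd (snd a))))) {w' \<in> W. pst (a, w') \<in> N'})"
  have G: "G \<in> borel_measurable ?A"
    unfolding G_def
  proof (rule emeasure_measurable_subprob_algebra2)
    have "pst -` N' \<inter> space (?A \<Otimes>\<^sub>M PS) \<in> sets (?A \<Otimes>\<^sub>M PS)" by (rule measurable_sets[OF pst N'(1)])
    then show "Sigma (space ?A) (\<lambda>a. {w' \<in> W. pst (a, w') \<in> N'}) \<in> sets (?A \<Otimes>\<^sub>M PS)"
      by (rule back_subst[of "\<lambda>X. X \<in> _"]) (auto simp: space_pair_measure)
    have "(\<lambda>a. fst (snd a) (max 0 (snd (snd a)))) \<in> ?A \<rightarrow>\<^sub>M J"
      by (rule eval_measurable2)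
        (auto intro!: borel_measurable_max measurable_compose[OF measurable_snd measurable_fst] measurable_compose[OF measurable_snd measurable_snd])
    from measurable_compose[OF this K_kernel_subprob]
    show "(\<lambda>a. K (fst (snd a) (max 0 (snd (snd a))))) \<in> ?A \<rightarrow>\<^sub>M subprob_algebra PS" .
  qed
  \<comment> \<open>With \<open>s\<close> and \<open>d\<close> fixed, \<open>markov_paste\<close>
    turns the integral into the measure of the null section of \<open>N\<close> at
    \<open>\<phi> s d\<close>.\<close>
  have G0: "(\<integral>\<^sup>+w. G (s, w, d) \<partial>K x) = 0" if d: "0 \<le> d" for s d
  proof -
    have "(\<integral>\<^sup>+w. G (s, w, d) \<partial>K x) = (\<integral>\<^sup>+w. emeasure (K (w d)) {w' \<in> W. paste w d w' \<in> Pair (\<phi> s d) -` N'} \<partial>K x)"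
      using d by (intro nn_integral_cong) (simp add: G_def pst_def)
    also have "\<dots> = emeasure (K x) (Pair (\<phi> s d) -` N' \<inter> W)"
      by (rule markov_paste[OF x d N'sec])
    also have "Pair (\<phi> s d) -` N' \<inter> W = {w \<in> W. (\<phi> s d, w) \<in> N}" using N'(2) by auto
    finally show ?thesis using null by simp
  qed
  let ?B = "{a \<in> space ?A. 0 \<le> snd (snd a) \<and> G a \<noteq> 0}"
  have B: "?B \<in> sets ?A"
  proof -
    have "{a \<in> space ?A. G a \<noteq> 0} \<in> sets ?A" using borel_measurable_neq[OF G, of "\<lambda>_. 0"] by simp
    moreover have "{a \<in> space ?A. 0 \<le> snd (snd a)} \<in> sets ?A"
      by (intro borel_measurable_le borel_measurable_const measurable_compose[OF measurable_snd measurable_snd])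
    ultimately have "{a \<in> space ?A. 0 \<le> snd (snd a)} \<inter> {a \<in> space ?A. G a \<noteq> 0} \<in> sets ?A" by (rule sets.Int[rotated])
    then show ?thesis by (rule back_subst[of "\<lambda>X. X \<in> _"]) auto
  qed
  \<comment> \<open>\<open>L\<close> measures the bad death times. It depends on the old time and
    the path alone, so the set where it is nonzero is one to which the hypothesis on
    \<open>v\<close> applies.\<close>
  define L where "L = (\<lambda>z. emeasure lborel {d. 0 \<le> d \<and> G (fst z, snd z, d) \<noteq> 0})"
  have Bpair: "{z \<in> space ((borel \<Otimes>\<^sub>M PS) \<Otimes>\<^sub>M borel). (fst (fst z), snd (fst z), snd z) \<in> ?B} \<in> sets ((borel \<Otimes>\<^sub>M PS) \<Otimes>\<^sub>M borel)"
  proof -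
    have "(\<lambda>z. (fst (fst z), snd (fst z), snd z)) \<in> (borel \<Otimes>\<^sub>M PS) \<Otimes>\<^sub>M borel \<rightarrow>\<^sub>M ?A"
      by (intro measurable_Pair measurable_compose[OF measurable_fst measurable_fst] measurable_compose[OF measurable_fst measurable_snd] measurable_snd)
    from measurable_sets[OF this B] show ?thesis
      by (rule back_subst[of "\<lambda>X. X \<in> _"]) auto
  qed
  have L: "L \<in> borel_measurable (borel \<Otimes>\<^sub>M PS)"
  proof -
    have "{z \<in> space ((borel \<Otimes>\<^sub>M PS) \<Otimes>\<^sub>M borel). (fst (fst z), snd (fst z), snd z) \<in> ?B} \<in> sets ((borel \<Otimes>\<^sub>M PS) \<Otimes>\<^sub>M lborel)"
    proof -
      have "sets ((borel \<Otimes>\<^sub>M PS) \<Otimes>\<^sub>M (lborel :: real measure)) = sets ((borel \<Otimes>\<^sub>M PS) \<Otimes>\<^sub>M (borel :: real measure))"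
        by (intro sets_pair_measure_cong refl sets_lborel)
      from Bpair[folded this] show ?thesis .
    qed
    from lborel.measurable_emeasure_Pair[OF this]
    show ?thesis
      by (rule measurable_cong[THEN iffD1, rotated])
        (auto simp: L_def space_pair_measure intro!: arg_cong[where f="emeasure lborel"])
  qed
  have L0: "emeasure (K x) {w \<in> W. L (s, w) \<noteq> 0} = 0" for s
  proof -
    interpret Kx: prob_space "K x" by (rule K_prob[OF x])
    have "(\<lambda>z. (s, fst z, snd z)) \<in> K x \<Otimes>\<^sub>M lborel \<rightarrow>\<^sub>M ?A"
    proof (intro measurable_Pair measurable_const)
      show "fst \<in> K x \<Otimes>\<^sub>M lborel \<rightarrow>\<^sub>M PS"
        by (rule measurable_compose[OF measurable_fst measurable_K[OF x measurable_ident_sets[OF refl]]])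
    qed (simp_all cong: measurable_cong_sets)
    from measurable_sets[OF this B]
    have m: "{z \<in> space (K x \<Otimes>\<^sub>M lborel). (s, fst z, snd z) \<in> ?B} \<in> sets (K x \<Otimes>\<^sub>M lborel)"
      by (rule back_subst[of "\<lambda>X. X \<in> _"]) auto
    have ind: "(\<lambda>z. indicator {z \<in> space (K x \<Otimes>\<^sub>M lborel). (s, fst z, snd z) \<in> ?B} z :: ennreal) \<in> borel_measurable (K x \<Otimes>\<^sub>M lborel)"
      by (rule borel_measurable_indicator[OF m])
    interpret pair_sigma_finite "K x" lborel by unfold_locales
    have "(\<integral>\<^sup>+w. L (s, w) \<partial>K x) = (\<integral>\<^sup>+w. \<integral>\<^sup>+d. indicator {z \<in> space (K x \<Otimes>\<^sub>M lborel). (s, fst z, snd z) \<in> ?B} (w, d) \<partial>lborel \<partial>K x)"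
    proof (rule nn_integral_cong)
      fix w assume w: "w \<in> space (K x)"
      have "{d. 0 \<le> d \<and> G (s, w, d) \<noteq> 0} = Pair w -` {z \<in> space (K x \<Otimes>\<^sub>M lborel). (s, fst z, snd z) \<in> ?B}"
        using w by (auto simp: space_pair_measure space_K[OF x])
      then have "L (s, w) = emeasure lborel (Pair w -` {z \<in> space (K x \<Otimes>\<^sub>M lborel). (s, fst z, snd z) \<in> ?B})"
        by (simp only: L_def fst_conv snd_conv)
      also have "\<dots> = (\<integral>\<^sup>+d. indicator (Pair w -` {z \<in> space (K x \<Otimes>\<^sub>M lborel). (s, fst z, snd z) \<in> ?B}) d \<partial>lborel)"
        by (rule nn_integral_indicator[OF sets_Pair1[OF m], symmetric])
      finally show "L (s, w) = (\<integral>\<^sup>+d. indicator {z \<in> space (K x \<Otimes>\<^sub>M lborel). (s, fst z, snd z) \<in> ?B} (w, d) \<partial>lborel)"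
        by (simp only: indicator_vimage comp_def)
    qed
    also have "\<dots> = (\<integral>\<^sup>+d. \<integral>\<^sup>+w. indicator {z \<in> space (K x \<Otimes>\<^sub>M lborel). (s, fst z, snd z) \<in> ?B} (w, d) \<partial>K x \<partial>lborel)"
      by (rule Fubini'[symmetric]) (use ind in simp)
    also have "\<dots> = (\<integral>\<^sup>+d. 0 \<partial>(lborel :: real measure))"
    proof (rule nn_integral_cong)
      fix d :: real
      show "(\<integral>\<^sup>+w. indicator {z \<in> space (K x \<Otimes>\<^sub>M lborel). (s, fst z, snd z) \<in> ?B} (w, d) \<partial>K x) = 0"
      proof (cases "0 \<le> d")
        case True
        have "(\<lambda>w. G (s, w, d)) \<in> borel_measurable (K x)"
          by (rule measurable_compose[OF _ G]) (intro measurable_Pair measurable_const measurable_K[OF x measurable_ident_sets[OF refl]]; simp)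
        then have "AE w in K x. G (s, w, d) = 0"
          using G0[OF True, of s] by (simp add: nn_integral_0_iff_AE)
        then have "(\<integral>\<^sup>+w. indicator {z \<in> space (K x \<Otimes>\<^sub>M lborel). (s, fst z, snd z) \<in> ?B} (w, d) \<partial>K x) = (\<integral>\<^sup>+w. 0 \<partial>K x)"
          by (intro nn_integral_cong_AE) (auto elim!: eventually_mono simp: indicator_def)
        then show ?thesis by simp
      qed simp
    qed
    finally have "(\<integral>\<^sup>+w. L (s, w) \<partial>K x) = 0" by simp
    moreover have Lm: "(\<lambda>w. L (s, w)) \<in> borel_measurable (K x)"
      by (rule measurable_K[OF x measurable_compose[OF measurable_Pair1' L]]) simp
    ultimately have "AE w in K x. L (s, w) = 0" by (simp add: nn_integral_0_iff_AE)
    then have "emeasure (K x) {w \<in> space (K x). L (s, w) \<noteq> 0} = 0"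
      using AE_iff_measurable[OF borel_measurable_neq[OF Lm, of "\<lambda>_. 0"] refl] by simp
    then show ?thesis by (simp add: space_K[OF x])
  qed
  let ?N2 = "{z \<in> space (borel \<Otimes>\<^sub>M PS). L z \<noteq> 0}"
  have N2: "?N2 \<in> sets (borel \<Otimes>\<^sub>M PS)" using borel_measurable_neq[OF L, of "\<lambda>_. 0"] by simp
  have "emeasure P {\<omega> \<in> trees W x. born \<omega> v \<and> (V \<omega>, position \<omega> v) \<in> ?N2} = 0"
  proof -
    have "{w \<in> W. (s, w) \<in> ?N2} = {w \<in> W. L (s, w) \<noteq> 0}" for s by (auto simp: space_pair_measure)
    then show ?thesis using ac N2 L0 unfolding ancestral_ac_def by auto
  qed
  moreover have VP: "V \<in> borel_measurable P" by (rule measurable_TE_P[OF V])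
  have apP: "ancestral_path v \<in> P \<rightarrow>\<^sub>M PS"
    by (rule ancestral_path_measurable) (use born_sets_P lifetime_P motion_P in auto)
  have "{\<omega> \<in> trees W x. born \<omega> v \<and> (V \<omega>, position \<omega> v) \<in> ?N2} \<in> sets P"
  proof -
    have "{\<omega> \<in> trees W x. born \<omega> v} \<inter> ((\<lambda>\<omega>. (V \<omega>, ancestral_path v \<omega>)) -` ?N2 \<inter> space P) \<in> sets P"
      by (intro sets.Int born_sets_P measurable_sets[OF measurable_Pair[OF VP apP] N2])
    then show ?thesis by (rule back_subst[of "\<lambda>X. X \<in> _"]) (auto simp: ancestral_path_def)
  qed
  ultimately have AE_L: "AE \<omega> in P. born \<omega> v \<longrightarrow> L (V \<omega>, ancestral_path v \<omega>) = 0"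
    by (intro AE_I[where N="{\<omega> \<in> trees W x. born \<omega> v \<and> (V \<omega>, position \<omega> v) \<in> ?N2}"])
      (auto simp: ancestral_path_def space_pair_measure position_in_paths[OF admissible, of _ x])
  let ?h = "\<lambda>z. (V (fst z), ancestral_path v (fst z), enn2real (birth (fst z) v) + snd z)"
  have bT: "(\<lambda>\<omega>. enn2real (birth \<omega> v)) \<in> borel_measurable (pre_lifetime v)"
    by (intro borel_measurable_enn2real measurable_compose[OF id_pre_lifetime measurable_birth]) auto
  have h: "?h \<in> pre_lifetime v \<Otimes>\<^sub>M borel \<rightarrow>\<^sub>M ?A"
    by (intro measurable_Pair measurable_compose[OF measurable_fst measurable_compose[OF id_pre_lifetime V]]
        measurable_compose[OF measurable_fst ancestral_path_pre_lifetime] borel_measurable_add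
        measurable_compose[OF measurable_fst bT] measurable_snd)
  let ?N3 = "?h -` ?B \<inter> space (pre_lifetime v \<Otimes>\<^sub>M borel)"
  have N3: "?N3 \<in> sets (pre_lifetime v \<Otimes>\<^sub>M borel)" by (rule measurable_sets[OF h B])
  have "emeasure P {\<omega> \<in> trees W x. born \<omega> v \<and> lifetime \<omega> v < \<infinity> \<and> (\<omega>, enn2real (lifetime \<omega> v)) \<in> ?N3} = 0"
  proof (rule lifetime_absolutely_continuous[OF N3], use AE_L AE_space in eventually_elim, rule impI)
    fix \<omega> assume "born \<omega> v \<longrightarrow> L (V \<omega>, ancestral_path v \<omega>) = 0" "\<omega> \<in> space P" "born \<omega> v"
    then have L: "L (V \<omega>, ancestral_path v \<omega>) = 0" and \<omega>: "\<omega> \<in> trees W x" by auto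
    let ?S = "{d. 0 \<le> d \<and> G (V \<omega>, ancestral_path v \<omega>, d) \<noteq> 0}"
    let ?b = "enn2real (birth \<omega> v)"
    have S: "?S \<in> sets borel"
    proof -
      have "(V \<omega>, ancestral_path v \<omega>) \<in> space (borel \<Otimes>\<^sub>M PS)"
        using ancestral_path_in[OF \<omega>] by (simp add: space_pair_measure)
      then have eq: "?S = Pair (V \<omega>, ancestral_path v \<omega>) -` {z \<in> space ((borel \<Otimes>\<^sub>M PS) \<Otimes>\<^sub>M borel). (fst (fst z), snd (fst z), snd z) \<in> ?B}"
        by (auto simp: space_pair_measure)
      show ?thesis unfolding eq by (rule sets_Pair1[OF Bpair])
    qed
    \<comment> \<open>Death is birth plus lifetime, and the birth time is known beforehand: the bad
      lifetimes lie in a translate of the bad death times, hence in a Lebesgue null set.\<close>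
    have "emeasure lborel {l. 0 \<le> l \<and> (\<omega>, l) \<in> ?N3} \<le> emeasure lborel ((\<lambda>l. ?b + l) -` ?S \<inter> space lborel)"
    proof (rule emeasure_mono)
      have "(\<lambda>l. ?b + l) \<in> lborel \<rightarrow>\<^sub>M borel" by simp
      from measurable_sets[OF this S] show "(\<lambda>l. ?b + l) -` ?S \<inter> space lborel \<in> sets lborel" .
    qed auto
    also have "\<dots> = emeasure (distr lborel borel (\<lambda>l. ?b + l)) ?S"
      using S by (subst emeasure_distr) auto
    also have "\<dots> = emeasure lborel ?S" by (simp add: lborel_distr_plus)
    also have "\<dots> = 0" using L by (simp add: L_def)
    finally show "emeasure lborel {l. 0 \<le> l \<and> (\<omega>, l) \<in> ?N3} = 0" by simp
  qed
  moreover have "{\<omega> \<in> trees W x. born \<omega> v \<and> lifetime \<omega> v < \<infinity> \<and> (\<omega>, enn2real (lifetime \<omega> v)) \<in> ?N3} \<in> sets P"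
  proof -
    have "(\<lambda>\<omega>. (V \<omega>, ancestral_path v \<omega>, enn2real (birth \<omega> v) + enn2real (lifetime \<omega> v))) \<in> P \<rightarrow>\<^sub>M ?A"
      by (intro measurable_Pair VP apP borel_measurable_add borel_measurable_enn2real lifetime_P
          measurable_TE_P[OF measurable_birth[of v UNIV]]) auto
    note m = measurable_sets[OF this B]
    have "{\<omega> \<in> space P. lifetime \<omega> v < \<infinity>} \<in> sets P" by measurable
    from sets.Int[OF sets.Int[OF born_sets_P this] m]
    have "{\<omega> \<in> trees W x. born \<omega> v} \<inter> {\<omega> \<in> space P. lifetime \<omega> v < \<infinity>} \<inter>
       ((\<lambda>\<omega>. (V \<omega>, ancestral_path v \<omega>, enn2real (birth \<omega> v) + enn2real (lifetime \<omega> v))) -` ?B \<inter> space P) \<in> sets P" .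
    then show ?thesis
      by (rule back_subst[of "\<lambda>X. X \<in> _"]) (auto simp: space_pair_measure)
  qed
  ultimately have AE3: "AE \<omega> in P. \<not> (born \<omega> v \<and> lifetime \<omega> v < \<infinity> \<and> (\<omega>, enn2real (lifetime \<omega> v)) \<in> ?N3)"
    by (intro AE_I[where N="{\<omega> \<in> trees W x. born \<omega> v \<and> lifetime \<omega> v < \<infinity> \<and> (\<omega>, enn2real (lifetime \<omega> v)) \<in> ?N3}"]) auto
  let ?r = "\<lambda>z. pst ((V (fst z), ancestral_path v (fst z), ?d (fst z)), snd z)"
  have sub: "{u. prefix u v} \<subseteq> {u. \<not> prefix (v @ [j]) u}"
    by (auto dest!: prefix_length_le)
  have V': "V \<in> borel_measurable (TE (v @ [j]))"
    by (rule tree_events_le[OF _ V]) (auto dest: append_prefixD)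
  have r: "?r \<in> TE (v @ [j]) \<Otimes>\<^sub>M PS \<rightarrow>\<^sub>M borel \<Otimes>\<^sub>M PU"
    by (rule measurable_compose[OF _ pst], intro measurable_Pair measurable_snd measurable_compose[OF measurable_fst V']
        measurable_compose[OF measurable_fst ancestral_path_TE]
        measurable_compose[OF measurable_fst borel_measurable_enn2real[OF measurable_death[OF sub]]])
  let ?N4 = "?r -` N' \<inter> space (TE (v @ [j]) \<Otimes>\<^sub>M PS)"
  have N4: "?N4 \<in> sets (TE (v @ [j]) \<Otimes>\<^sub>M PS)" by (rule measurable_sets[OF r N'(1)])
  \<comment> \<open>The event is rewritten through the child's own motion, which is fresh given
    everything outside its subtree; \<open>motion_law\<close> then produces \<open>G\<close> at the
    actual death time.\<close>
  have "{\<omega> \<in> trees W x. born \<omega> (v @ [j]) \<and> (\<phi> (V \<omega>) (?d \<omega>), position \<omega> (v @ [j])) \<in> N} =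
      {\<omega> \<in> trees W x. born \<omega> (v @ [j]) \<and> (\<omega>, motion \<omega> (v @ [j])) \<in> ?N4}"
  proof -
    have "(\<phi> (V \<omega>) (?d \<omega>), position \<omega> (v @ [j])) \<in> N \<longleftrightarrow> (\<omega>, motion \<omega> (v @ [j])) \<in> ?N4"
      if \<omega>: "\<omega> \<in> trees W x" "born \<omega> (v @ [j])" for \<omega>
    proof -
      have "born \<omega> v" using \<omega> by (simp add: born_snoc)
      then have "position \<omega> (v @ [j]) = paste (ancestral_path v \<omega>) (?d \<omega>) (motion \<omega> (v @ [j]))"
        using position_snoc[OF \<omega>] by (simp add: paste_def ancestral_path_def)
      moreover have "position \<omega> (v @ [j]) \<in> W" by (rule position_in_paths[OF admissible \<omega>])
      ultimately show ?thesis
        using N'(2) \<omega> by (simp add: pst_def space_pair_measure trees_motion)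
    qed
    then show ?thesis by blast
  qed
  then have "emeasure P {\<omega> \<in> trees W x. born \<omega> (v @ [j]) \<and> (\<phi> (V \<omega>) (?d \<omega>), position \<omega> (v @ [j])) \<in> N} =
      (\<integral>\<^sup>+\<omega>\<in>{\<omega>. born \<omega> (v @ [j])}. emeasure (K (start x \<omega> (v @ [j]))) {w \<in> W. (\<omega>, w) \<in> ?N4} \<partial>P)"
    using motion_law[OF N4] by simp
  also have "\<dots> = (\<integral>\<^sup>+\<omega>. 0 \<partial>P)"
  proof (rule nn_integral_cong_AE, use AE3 AE_space in eventually_elim)
    fix \<omega> assume n3: "\<not> (born \<omega> v \<and> lifetime \<omega> v < \<infinity> \<and> (\<omega>, enn2real (lifetime \<omega> v)) \<in> ?N3)" and "\<omega> \<in> space P"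
    then have \<omega>: "\<omega> \<in> trees W x" by simp
    show "emeasure (K (start x \<omega> (v @ [j]))) {w \<in> W. (\<omega>, w) \<in> ?N4} * indicator {\<omega>. born \<omega> (v @ [j])} \<omega> = 0"
    proof (cases "born \<omega> (v @ [j])")
      case True
      then have b: "born \<omega> v" "lifetime \<omega> v < \<infinity>" by (auto simp: born_snoc)
      have bf: "birth \<omega> v < \<infinity>" by (rule birth_finite[OF b(1)])
      have d: "?d \<omega> = enn2real (birth \<omega> v) + enn2real (lifetime \<omega> v)"
        using b bf by (simp add: death_def enn2real_plus)
      have "G (V \<omega>, ancestral_path v \<omega>, ?d \<omega>) = 0"
        using n3 b \<omega> ancestral_path_in[OF \<omega>] by (simp add: d space_pair_measure)
      moreover have "start x \<omega> (v @ [j]) = ancestral_path v \<omega> (?d \<omega>)"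
      proof -
        have "ennreal (?d \<omega>) = death \<omega> v" using b bf by (simp add: death_def)
        then have "position \<omega> v (?d \<omega>) = motion \<omega> v (?d \<omega> - enn2real (birth \<omega> v))"
          by (intro position_ge_birth) (simp add: birth_le_death)
        then show ?thesis using b by (simp add: start_def ancestral_path_def d)
      qed
      moreover have "{w \<in> W. (\<omega>, w) \<in> ?N4} = {w' \<in> W. pst ((V \<omega>, ancestral_path v \<omega>, ?d \<omega>), w') \<in> N'}"
        using \<omega> by (auto simp: space_pair_measure)
      ultimately show ?thesis by (simp add: G_def)
    qed simp
  qed
  finally show "emeasure P {\<omega> \<in> trees W x. born \<omega> (v @ [j]) \<and> (\<phi> (V \<omega>) (?d \<omega>), position \<omega> (v @ [j])) \<in> N} = 0"
    by simp
qed

text \<open>For the birth of a strict ancestor \<open>\<phi>\<close> keeps the old time; for the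
  birth of the label itself it selects the parent's death. In the latter case any old time serves,
  and the root's birth is taken.\<close>

lemma ancestral_ac_birth:
  "n \<le> length v \<Longrightarrow> ancestral_ac v (\<lambda>\<omega>. enn2real (birth \<omega> (take n v)))"
proof (induction v arbitrary: n rule: rev_induct)
  case Nil
  then show ?case using ancestral_ac_Nil[of 0] by simp
next
  case (snoc j v)
  have V: "(\<lambda>\<omega>. enn2real (birth \<omega> (take m v))) \<in> borel_measurable (TE v)" for m
  proof (intro borel_measurable_enn2real measurable_birth subsetI)
    fix u assume "u \<in> {u. strict_prefix u (take m v)}"
    then have "strict_prefix u v" by (auto intro: prefix_order.less_le_trans[OF _ take_is_prefix])
    then show "u \<in> {u. \<not> prefix v u}" by auto
  qed
  show ?case
  proof (cases "n \<le> length v")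
    case True
    have "(\<lambda>(s, d). s) \<in> borel_measurable (borel \<Otimes>\<^sub>M (borel :: real measure))"
      by (simp add: split_beta')
    from ancestral_ac_snoc[OF snoc.IH[OF True] V this, of j] show ?thesis using True by simp
  next
    case False
    then have n: "n = length (v @ [j])" using snoc.prems by simp
    have "(\<lambda>(s, d). d) \<in> borel_measurable ((borel :: real measure) \<Otimes>\<^sub>M (borel :: real measure))"
      by (simp add: split_beta')
    from ancestral_ac_snoc[OF snoc.IH[of 0] V this, of j] show ?thesis by (simp add: n)
  qed
qed

end

section \<open>Summation over tuples\<close>

text \<open>As integrals over counting measure the sums of the theorem become accessible to Tonelli.
  Every family in \<open>ennreal\<close> is summable, so an enumeration by naturals gives the
  value.\<close>

lemma infsum_eq_nn_integral_count_space:
  fixes f :: "'i::countable \<Rightarrow> ennreal"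
  shows "infsum f A = (\<integral>\<^sup>+i. f i \<partial>count_space A)"
proof -
  let ?h = "\<lambda>n. f (from_nat n) * indicator (to_nat ` A) n"
  have inj: "inj_on (to_nat :: 'i \<Rightarrow> nat) A" by (rule inj_on_subset[OF inj_to_nat]) simp
  have "infsum f A = infsum (f \<circ> from_nat) (to_nat ` A)"
    by (subst infsum_reindex[OF inj]) (simp add: comp_def)
  also have "\<dots> = infsum ?h UNIV" by (rule infsum_cong_neutral) (auto simp: indicator_def)
  also have "\<dots> = suminf ?h"
  proof -
    have "?h summable_on UNIV" by (rule nonneg_summable_on_complete) simp
    from has_sum_imp_sums[OF has_sum_infsum[OF this]] show ?thesis by (rule sums_unique)
  qed
  also have "\<dots> = (\<integral>\<^sup>+n. ?h n \<partial>count_space UNIV)" by (rule nn_integral_count_space_nat[symmetric])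
  also have "\<dots> = (\<integral>\<^sup>+n. f (from_nat n) \<partial>count_space (to_nat ` A))"
    by (simp add: nn_integral_count_space_indicator)
  also have "\<dots> = (\<integral>\<^sup>+i. f (from_nat (to_nat i)) \<partial>count_space A)"
    by (rule nn_integral_bij_count_space[symmetric, OF inj_on_imp_bij_betw[OF inj]])
  finally show ?thesis by simp
qed

text \<open>The default values agree: for a family that is not absolutely summable both sides are
  \<open>0\<close>.\<close>

lemma infsum_eq_integral_count_space:
  fixes f :: "'i \<Rightarrow> real"
  shows "infsum f A = (\<integral>i. f i \<partial>count_space A)"
proof (cases "integrable (count_space A) f")
  case True
  then have "Infinite_Set_Sum.abs_summable_on f A" by (simp add: Infinite_Set_Sum.abs_summable_on_def)
  from infsetsum_infsum[OF this] show ?thesis by (simp add: infsetsum_def)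
next
  case False
  then have "\<not> Infinite_Set_Sum.abs_summable_on f A" by (simp add: Infinite_Set_Sum.abs_summable_on_def)
  then have "\<not> f summable_on A"
    using summable_on_iff_abs_summable_on_real[of f A] abs_summable_equivalent[of f A] by blast
  then show ?thesis using False by (simp add: infsum_not_exists not_integrable_integral_eq)
qed

section \<open>Uniform choices\<close>

text \<open>Where all of \<open>vs\<close> is alive, the reciprocal of the conditional probability
  that the marks follow \<open>vs\<close>; on \<open>spines_at\<close> it is also the last factor of
  \<open>spine_density\<close>.\<close>

definition offspring_prod :: "label list \<Rightarrow> 'a tree \<Rightarrow> real" where
  "offspring_prod vs \<omega> = (\<Prod>v\<in>prefix_set vs - set vs. real (offspring \<omega> v) ^ mark_count vs v)"

text \<open>The choices that decide whether the marks reach \<open>vs\<close>: one for each mark and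
  each strict ancestor of its target.\<close>

definition choice_index :: "label list \<Rightarrow> (nat \<times> label) set" where
  "choice_index vs = (SIGMA i:{..<length vs}. {u. strict_prefix u (vs ! i)})"

lemma finite_strict_prefixes: "finite {u. strict_prefix u v}"
  by (rule finite_subset[of _ "set (prefixes v)"]) (auto simp: strict_prefix_def)

lemma finite_choice_index: "finite (choice_index vs)"
  by (simp add: choice_index_def finite_strict_prefixes)

text \<open>The order of multiplication is exchanged: grouped by ancestors instead of marks, a label
  occurs once for every mark it carries. Incomparability of living labels ensures that no strict
  ancestor is itself in \<open>vs\<close>.\<close>

lemma offspring_prod_eq:
  assumes "set vs \<subseteq> alive \<omega> t"
  shows "(\<Prod>(i, u)\<in>choice_index vs. real (offspring \<omega> u)) = offspring_prod vs \<omega>"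
proof -
  let ?D = "prefix_set vs - set vs"
  have S: "{u. strict_prefix u (vs ! i)} = {u \<in> ?D. prefix u (vs ! i)}" if i: "i < length vs" for i
  proof (intro set_eqI iffI)
    fix u assume "u \<in> {u. strict_prefix u (vs ! i)}"
    then have u: "prefix u (vs ! i)" "u \<noteq> vs ! i" by auto
    have "u \<notin> set vs"
      using alive_antichain[OF _ _ u(1), of \<omega> t] u(2) assms i by (auto simp: subset_iff)
    moreover have "u \<in> prefix_set vs" using u i by (auto simp: prefix_set_def)
    ultimately show "u \<in> {u \<in> ?D. prefix u (vs ! i)}" using u by simp
  next
    fix u assume "u \<in> {u \<in> ?D. prefix u (vs ! i)}"
    then show "u \<in> {u. strict_prefix u (vs ! i)}" using i by (auto simp: strict_prefix_def)
  qed
  have "(\<Prod>(i, u)\<in>choice_index vs. real (offspring \<omega> u)) =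
      (\<Prod>i<length vs. \<Prod>u\<in>{u. strict_prefix u (vs ! i)}. real (offspring \<omega> u))"
    unfolding choice_index_def by (subst prod.Sigma) (auto simp: finite_strict_prefixes)
  also have "\<dots> = (\<Prod>i<length vs. \<Prod>u | u \<in> ?D \<and> prefix u (vs ! i). real (offspring \<omega> u))"
    by (intro prod.cong refl) (simp add: S)
  also have "\<dots> = (\<Prod>u\<in>?D. \<Prod>i | i \<in> {..<length vs} \<and> prefix u (vs ! i). real (offspring \<omega> u))"
    by (rule prod.swap_restrict) auto
  also have "\<dots> = offspring_prod vs \<omega>"
    by (simp add: offspring_prod_def mark_count_def)
  finally show ?thesis .
qed

lemma offspring_prod_pos:
  assumes "set vs \<subseteq> alive \<omega> t"
  shows "0 < offspring_prod vs \<omega>"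
  unfolding offspring_prod_def
proof (rule prod_pos)
  fix v assume v: "v \<in> prefix_set vs - set vs"
  then obtain u where u: "u \<in> set vs" "prefix v u" by (auto simp: prefix_set_def)
  then have "strict_prefix v u" using v by (metis DiffE strict_prefixI)
  moreover have "born \<omega> u" using u assms by (auto dest: aliveD)
  ultimately have "0 < offspring \<omega> v" using born_strict_prefix(2)[of v u \<omega>] by simp
  then show "0 < real (offspring \<omega> v) ^ mark_count vs v" by simp
qed

text \<open>Separates a condition on the tree from finitely many prescribed choices, the shape in
  which \<open>spine_law\<close> can be applied.\<close>

lemma spines_at_iff:
  "spines_at \<omega> t vs \<longleftrightarrow> set vs \<subseteq> alive \<omega> t \<and> (\<forall>(i, u)\<in>choice_index vs. choice \<omega> i u = vs ! i ! length u)"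
proof -
  have "follows \<omega> i v \<longleftrightarrow> (\<forall>u. strict_prefix u v \<longrightarrow> choice \<omega> i u = v ! length u)" for i v
  proof
    assume f: "follows \<omega> i v"
    show "\<forall>u. strict_prefix u v \<longrightarrow> choice \<omega> i u = v ! length u"
    proof (intro allI impI)
      fix u assume "strict_prefix u v"
      then have "length u < length v" "take (length u) v = u"
        by (auto simp: strict_prefix_def prefix_def)
      then show "choice \<omega> i u = v ! length u" using f unfolding follows_def by metis
    qed
  next
    assume f: "\<forall>u. strict_prefix u v \<longrightarrow> choice \<omega> i u = v ! length u"
    show "follows \<omega> i v"
      unfolding follows_def
    proof (intro allI impI)
      fix n assume n: "n < length v"
      then have "strict_prefix (take n v) v" by (auto simp: strict_prefix_def take_is_prefix)
      then show "choice \<omega> i (take n v) = v ! n" using f n by simp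
    qed
  qed
  then show ?thesis
    by (fastforce simp: spines_at_def spine_eq_Some choice_index_def set_conv_nth)
qed

section \<open>The change of measure and the many-to-few identity\<close>

locale weighted_branching = branching J W K R \<mu> x P + weighted_paths J W \<zeta>
  for J :: "'a measure" and W K R \<mu> x P \<zeta> +
  fixes Pk Q :: "'a tree measure" and k :: nat and t :: real
  assumes functional: "unit_martingale_functional J W K \<zeta>"
    and spines: "spine_law J W x k P Pk"
    and tilted: "tilted_measure J W R \<mu> \<zeta> x k Pk Q"
    and t: "0 \<le> t"
begin

text \<open>The exceptional pairs \<open>(s, w)\<close> have \<zeta> equal to \<open>0\<close> at
  \<open>s\<close> and positive at \<open>t\<close>. For each fixed \<open>s\<close> they are null
  for a single motion by \<open>zeta_absorbed\<close>; \<open>ancestral_ac_birth\<close> carries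
  this to the random birth time.\<close>

lemma zeta_pos_at_birth:
  assumes n: "n \<le> length u"
  shows "AE \<omega> in P. u \<in> alive \<omega> t \<and> 0 < \<zeta> (position \<omega> u) t \<longrightarrow>
    0 < \<zeta> (position \<omega> u) (birth_upto \<omega> t (take n u))"
proof -
  let ?M = "borel \<Otimes>\<^sub>M PS :: (real \<times> (real \<Rightarrow> 'a)) measure"
  \<comment> \<open>The clamp keeps the evaluation time within \<open>[0, t]\<close>, as
    \<open>zeta_measurable2\<close> requires; on \<open>?N\<close> it changes nothing.\<close>
  let ?r = "\<lambda>z :: real \<times> (real \<Rightarrow> 'a). max 0 (min (fst z) t)"
  let ?N = "{z \<in> space ?M. (\<zeta> (snd z) (?r z) = 0 \<and> 0 < \<zeta> (snd z) t) \<and> 0 \<le> fst z \<and> fst z \<le> t}"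
  have sp: "snd \<in> ?M \<rightarrow>\<^sub>M PF t" by (rule measurable_compose[OF measurable_snd id_PS_PF])
  have [measurable]: "(\<lambda>z. \<zeta> (snd z) (?r z)) \<in> borel_measurable ?M"
    by (rule zeta_measurable2[OF t _ sp])
      (use t in \<open>auto intro!: borel_measurable_max borel_measurable_min measurable_fst\<close>)
  have [measurable]: "(\<lambda>z. \<zeta> (snd z) t) \<in> borel_measurable ?M"
    by (rule zeta_measurable2[OF t _ sp]) (use t in auto)
  have N: "?N \<in> sets ?M" by measurable
  have null: "emeasure (K x) {w \<in> W. (s, w) \<in> ?N} = 0" for s
  proof (cases "0 \<le> s \<and> s \<le> t")
    case True
    have "{w \<in> W. (s, w) \<in> ?N} = {w \<in> W. \<zeta> w s = 0 \<and> 0 < \<zeta> w t}"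
      using True by (auto simp: space_pair_measure)
    moreover have "martingale_wrt (K x) PF (\<lambda>t w. \<zeta> w t)"
      using functional x unfolding unit_martingale_functional_def by blast
    ultimately show ?thesis
      using zeta_absorbed[OF _ K_sets[OF x] K_prob[OF x], of s t] True by simp
  next
    case False
    then have eq: "{w \<in> W. (s, w) \<in> ?N} = {}" by auto
    show ?thesis unfolding eq by simp
  qed
  let ?V = "\<lambda>\<omega>. enn2real (birth \<omega> (take n u))"
  let ?X = "{\<omega> \<in> trees W x. born \<omega> u \<and> (?V \<omega>, position \<omega> u) \<in> ?N}"
  have X0: "emeasure P ?X = 0"
    using ancestral_ac_birth[OF n] N null unfolding ancestral_ac_def by blast
  have Xs: "?X \<in> sets P"
  proof -
    have V: "?V \<in> borel_measurable P"
      by (intro borel_measurable_enn2real measurable_TE_P[OF measurable_birth[of "take n u" UNIV]]) auto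
    have ap: "ancestral_path u \<in> P \<rightarrow>\<^sub>M PS"
      by (rule ancestral_path_measurable) (use born_sets_P lifetime_P motion_P in auto)
    have "{\<omega> \<in> trees W x. born \<omega> u} \<inter> ((\<lambda>\<omega>. (?V \<omega>, ancestral_path u \<omega>)) -` ?N \<inter> space P) \<in> sets P"
      by (intro sets.Int born_sets_P measurable_sets[OF measurable_Pair[OF V ap] N])
    then show ?thesis
      by (rule back_subst[of "\<lambda>X. X \<in> _"]) (auto simp: ancestral_path_def)
  qed
  show ?thesis
  proof (rule AE_I[OF _ X0 Xs], rule subsetI)
    fix \<omega> assume "\<omega> \<in> {\<omega> \<in> space P. \<not> (u \<in> alive \<omega> t \<and> 0 < \<zeta> (position \<omega> u) t \<longrightarrow>
      0 < \<zeta> (position \<omega> u) (birth_upto \<omega> t (take n u)))}"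
    then have \<omega>: "\<omega> \<in> trees W x" "u \<in> alive \<omega> t" "0 < \<zeta> (position \<omega> u) t"
      "\<not> 0 < \<zeta> (position \<omega> u) (birth_upto \<omega> t (take n u))" by auto
    have b: "born \<omega> u" by (rule aliveD(1)[OF \<omega>(2)])
    have pW: "position \<omega> u \<in> W" by (rule position_in_paths[OF admissible \<omega>(1) b])
    have e: "birth_upto \<omega> t (take n u) = ?V \<omega>"
      by (rule birth_upto_eq[OF t alive_birth_le[OF take_is_prefix \<omega>(2)]])
    have bd: "0 \<le> ?V \<omega>" "?V \<omega> \<le> t" using birth_upto_bounds[OF t, of \<omega> "take n u"] e by auto
    have "\<zeta> (position \<omega> u) (?V \<omega>) = 0"
      using \<omega>(4) zeta_nonneg[OF pW bd(1)] e by simp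
    then show "\<omega> \<in> ?X" using \<omega> b pW bd by (auto simp: space_pair_measure min_def max_def)
  qed
qed

lemma space_Pk [simp]: "space Pk = trees W x"
  and sets_Pk: "sets Pk = sets (spine_algebra J W x k)"
  and Pk_P: "E \<in> sets P \<Longrightarrow> emeasure Pk E = emeasure P E"
  using spines unfolding spine_law_def by blast+

lemma choice_law:
  assumes "E \<in> sets P" "finite I" "I \<subseteq> {..<k} \<times> UNIV"
    and "E \<subseteq> {\<omega>. \<forall>(i, v)\<in>I. born \<omega> v \<and> lifetime \<omega> v < \<infinity> \<and> c i v < offspring \<omega> v}"
  shows "emeasure Pk (E \<inter> {\<omega>. \<forall>(i, v)\<in>I. choice \<omega> i v = c i v}) =
    (\<integral>\<^sup>+\<omega>\<in>E. ennreal (\<Prod>(i, v)\<in>I. 1 / real (offspring \<omega> v)) \<partial>P)"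
proof -
  have "\<forall>I c. \<forall>E\<in>sets P.
        finite I \<longrightarrow> I \<subseteq> {..<k} \<times> UNIV \<longrightarrow>
        E \<subseteq> {\<omega>. \<forall>(i, v)\<in>I. born \<omega> v \<and> lifetime \<omega> v < \<infinity> \<and> c i v < offspring \<omega> v} \<longrightarrow>
        emeasure Pk (E \<inter> {\<omega>. \<forall>(i, v)\<in>I. choice \<omega> i v = c i v}) =
          (\<integral>\<^sup>+\<omega>\<in>E. ennreal (\<Prod>(i, v)\<in>I. 1 / real (offspring \<omega> v)) \<partial>P)"
    using spines unfolding spine_law_def by (elim conjE)
  from this[rule_format, OF assms] show ?thesis .
qed

lemma P_le_Pk: "E \<in> sets P \<Longrightarrow> E \<in> sets Pk"
  using subsetD[OF tree_algebra_le_spine] by (simp add: sets_P sets_Pk)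

lemma AE_Pk: 
  assumes "AE \<omega> in P. C \<omega>"
  shows "AE \<omega> in Pk. C \<omega>"
proof -
  from assms obtain N where "{\<omega> \<in> space P. \<not> C \<omega>} \<subseteq> N" "emeasure P N = 0" "N \<in> sets P"
    by (rule AE_E)
  then show ?thesis using Pk_P P_le_Pk by (intro AE_I[of _ _ N]) auto
qed

lemma alive_sets_P: "{\<omega> \<in> trees W x. set vs \<subseteq> alive \<omega> t} \<in> sets P"
proof -
  have "{\<omega> \<in> space P. \<forall>v\<in>set vs. v \<in> alive \<omega> t} \<in> sets P"
    by (rule sets.sets_Collect_finite_All)
      (use measurable_alive[where U=UNIV and J=J and W=W and x=x and t=t] in \<open>auto simp: pred_def sets_P\<close>)
  then show ?thesis by (simp add: subset_iff Ball_def)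
qed

lemma offspring_P [measurable]: "(\<lambda>\<omega>. real (offspring \<omega> v)) \<in> borel_measurable P"
  by (rule measurable_TE_P[OF measurable_compose[OF measurable_offspring[of v UNIV]]]) auto

lemma offspring_prod_P [measurable]: "(\<lambda>\<omega>. offspring_prod vs \<omega>) \<in> borel_measurable P"
  unfolding offspring_prod_def by measurable

lemma spines_at_sets_Pk:
  assumes "length vs = k"
  shows "{\<omega> \<in> trees W x. spines_at \<omega> t vs} \<in> sets Pk"
  using subsetD[OF spine_filtration_le spines_at_sets[OF t assms, of x]] by (simp add: sets_Pk)

text \<open>Given the tree, the marks follow \<open>vs\<close> with probability
  \<open>1 / offspring_prod vs \<omega>\<close>, so the extra factor undoes the selection. The law
  of the choices speaks about events of \<open>P\<close>; hence the two measures are compared on its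
  sigma-algebra before \<open>f\<close> is integrated.\<close>

lemma many_to_few_single:
  assumes k: "length vs = k" and f: "f \<in> borel_measurable P"
  shows "(\<integral>\<^sup>+\<omega>. f \<omega> * ennreal (offspring_prod vs \<omega>) * indicator {\<omega>. spines_at \<omega> t vs} \<omega> \<partial>Pk) =
    (\<integral>\<^sup>+\<omega>. f \<omega> * indicator {\<omega>. set vs \<subseteq> alive \<omega> t} \<omega> \<partial>P)"
proof -
  let ?S = "{\<omega> \<in> trees W x. spines_at \<omega> t vs}"
  let ?A = "{\<omega> \<in> trees W x. set vs \<subseteq> alive \<omega> t}"
  let ?p = "\<lambda>\<omega>. ennreal (1 / offspring_prod vs \<omega>) * indicator ?A \<omega>"
  have S: "?S \<in> sets Pk" by (rule spines_at_sets_Pk[OF k])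
  have A [measurable]: "?A \<in> sets P" by (rule alive_sets_P)
  have p [measurable]: "?p \<in> borel_measurable P" by measurable
  have idP: "(\<lambda>\<omega>. \<omega>) \<in> density Pk (indicator ?S) \<rightarrow>\<^sub>M P"
  proof (rule measurableI)
    fix E assume E: "E \<in> sets P"
    then have "E \<subseteq> trees W x" using sets.sets_into_space[of E P] by simp
    then show "(\<lambda>\<omega>. \<omega>) -` E \<inter> space (density Pk (indicator ?S)) \<in> sets (density Pk (indicator ?S))"
      using P_le_Pk[OF E] by (simp add: Int_absorb2)
  qed simp
  have eq: "distr (density Pk (indicator ?S)) P (\<lambda>\<omega>. \<omega>) = density P ?p"
  proof (rule measure_eqI)
    fix E assume "E \<in> sets (distr (density Pk (indicator ?S)) P (\<lambda>\<omega>. \<omega>))"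
    then have E: "E \<in> sets P" by simp
    have Et: "E \<subseteq> trees W x" using sets.sets_into_space[OF E] by simp
    have "emeasure (distr (density Pk (indicator ?S)) P (\<lambda>\<omega>. \<omega>)) E = emeasure (density Pk (indicator ?S)) E"
      using Et idP E by (subst emeasure_distr) (simp_all add: Int_absorb2)
    also have "\<dots> = (\<integral>\<^sup>+\<omega>. indicator ?S \<omega> * indicator E \<omega> \<partial>Pk)"
      by (rule emeasure_density) (use S P_le_Pk[OF E] in auto)
    also have "\<dots> = (\<integral>\<^sup>+\<omega>. indicator (?S \<inter> E) \<omega> \<partial>Pk)"
      by (simp only: indicator_inter_arith)
    also have "\<dots> = emeasure Pk (?S \<inter> E)"
      by (rule nn_integral_indicator) (use S P_le_Pk[OF E] in auto)
    \<comment> \<open>On \<open>?A\<close> every prescribed choice is an existing child of a born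
      particle that dies, which is the proviso of \<open>choice_law\<close>.\<close>
    also have "?S \<inter> E = (E \<inter> ?A) \<inter> {\<omega>. \<forall>(i, u)\<in>choice_index vs. choice \<omega> i u = (\<lambda>i u. vs ! i ! length u) i u}"
      using Et by (auto simp: spines_at_iff)
    also have "emeasure Pk \<dots> = (\<integral>\<^sup>+\<omega>\<in>E \<inter> ?A. ennreal (\<Prod>(i, v)\<in>choice_index vs. 1 / real (offspring \<omega> v)) \<partial>P)"
    proof -
      have 1: "E \<inter> ?A \<in> sets P" using E A by (rule sets.Int)
      have 2: "choice_index vs \<subseteq> {..<k} \<times> UNIV" by (auto simp: choice_index_def k)
      have 3: "E \<inter> ?A \<subseteq> {\<omega>. \<forall>(i, v)\<in>choice_index vs. born \<omega> v \<and> lifetime \<omega> v < \<infinity> \<and>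
          (\<lambda>i u. vs ! i ! length u) i v < offspring \<omega> v}"
      proof (intro subsetI CollectI ballI, clarify)
        fix \<omega> i v assume "\<omega> \<in> E" "\<omega> \<in> trees W x" and vs: "set vs \<subseteq> alive \<omega> t" and "(i, v) \<in> choice_index vs"
        then have i: "i < length vs" "strict_prefix v (vs ! i)" by (auto simp: choice_index_def)
        have "vs ! i \<in> alive \<omega> t" using vs i by (auto simp: subset_iff)
        then have b: "born \<omega> (vs ! i)" by (rule aliveD(1))
        show "born \<omega> v \<and> lifetime \<omega> v < \<infinity> \<and> vs ! i ! length v < offspring \<omega> v"
          using born_strict_prefix[OF i(2) b] born_prefix[OF _ b, of v] i(2) by auto
      qed
      show ?thesis by (rule choice_law[OF 1 finite_choice_index 2 3])
    qed
    also have "\<dots> = (\<integral>\<^sup>+\<omega>. ?p \<omega> * indicator E \<omega> \<partial>P)"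
    proof (rule nn_integral_cong)
      fix \<omega> assume "\<omega> \<in> space P"
      show "ennreal (\<Prod>(i, v)\<in>choice_index vs. 1 / real (offspring \<omega> v)) * indicator (E \<inter> ?A) \<omega> = ?p \<omega> * indicator E \<omega>"
      proof (cases "\<omega> \<in> ?A")
        case True
        then have "(\<Prod>(i, v)\<in>choice_index vs. 1 / real (offspring \<omega> v)) = 1 / offspring_prod vs \<omega>"
          using offspring_prod_eq[of vs \<omega> t] by (simp add: split_beta' prod_dividef)
        then show ?thesis using True by (simp add: indicator_def)
      qed simp
    qed
    also have "\<dots> = emeasure (density P ?p) E" by (rule emeasure_density[OF p E, symmetric])
    finally show "emeasure (distr (density Pk (indicator ?S)) P (\<lambda>\<omega>. \<omega>)) E = emeasure (density P ?p) E" .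
  qed simp
  let ?g = "\<lambda>\<omega>. f \<omega> * ennreal (offspring_prod vs \<omega>)"
  have g: "?g \<in> borel_measurable P" using f by measurable
  have gk: "?g \<in> borel_measurable Pk"
    by (rule measurable_from_subalg[OF _ g]) (use P_le_Pk in \<open>auto simp: subalgebra_def\<close>)
  have "(\<integral>\<^sup>+\<omega>. ?g \<omega> * indicator {\<omega>. spines_at \<omega> t vs} \<omega> \<partial>Pk) = (\<integral>\<^sup>+\<omega>. indicator ?S \<omega> * ?g \<omega> \<partial>Pk)"
    by (intro nn_integral_cong) (auto simp: indicator_def)
  also have "\<dots> = (\<integral>\<^sup>+\<omega>. ?g \<omega> \<partial>density Pk (indicator ?S))"
    by (rule nn_integral_density[symmetric, OF borel_measurable_indicator[OF S] gk])
  also have "\<dots> = (\<integral>\<^sup>+\<omega>. ?g \<omega> \<partial>distr (density Pk (indicator ?S)) P (\<lambda>\<omega>. \<omega>))"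
    by (rule nn_integral_distr[OF idP, symmetric]) (use g in simp)
  also have "\<dots> = (\<integral>\<^sup>+\<omega>. ?p \<omega> * ?g \<omega> \<partial>P)"
    unfolding eq by (rule nn_integral_density[OF p g])
  also have "\<dots> = (\<integral>\<^sup>+\<omega>. f \<omega> * indicator {\<omega>. set vs \<subseteq> alive \<omega> t} \<omega> \<partial>P)"
  proof (rule nn_integral_cong)
    fix \<omega> assume "\<omega> \<in> space P"
    then have \<omega>: "\<omega> \<in> trees W x" by simp
    show "?p \<omega> * ?g \<omega> = f \<omega> * indicator {\<omega>. set vs \<subseteq> alive \<omega> t} \<omega>"
    proof (cases "set vs \<subseteq> alive \<omega> t")
      case True
      have pos: "0 < offspring_prod vs \<omega>" by (rule offspring_prod_pos[OF True])
      then have "ennreal (1 / offspring_prod vs \<omega>) * ennreal (offspring_prod vs \<omega>) = 1"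
        by (simp flip: ennreal_mult)
      then have "f \<omega> * (ennreal (1 / offspring_prod vs \<omega>) * ennreal (offspring_prod vs \<omega>)) = f \<omega>" by simp
      then show ?thesis using True \<omega> by (simp add: mult_ac)
    qed simp
  qed
  finally show ?thesis .
qed

definition positive_event :: "label list \<Rightarrow> 'a tree set" where
  "positive_event vs = {\<omega> \<in> trees W x. \<forall>u\<in>set vs. u \<in> alive \<omega> t \<and> 0 < \<zeta> (position \<omega> u) t}"

lemma BF_P: "f \<in> borel_measurable (BF x t) \<Longrightarrow> f \<in> borel_measurable P"
  by (rule measurable_from_subalg) (auto simp: subalgebra_def sets_P intro: subsetD[OF branching_filtration_le])

lemma positive_event_P [measurable]: "positive_event vs \<in> sets P"
proof -
  have "{\<omega> \<in> space P. u \<in> alive \<omega> t \<and> 0 < \<zeta> (position \<omega> u) t} \<in> sets P" for u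
  proof -
    have "(\<lambda>\<omega>. \<zeta> (position \<omega> u) t) \<in> borel_measurable (BFA x t u)"
      by (intro measurable_compose[OF position_adapted zeta_adapted] t)
    then have "{\<omega> \<in> space (BFA x t u). 0 < \<zeta> (position \<omega> u) t} \<in> sets (BFA x t u)" by measurable
    moreover have "{\<omega>. u \<in> alive \<omega> t} \<inter> space (BF x t) \<in> sets (BF x t)"
      using alive_sets[OF t order_refl, of x u] by (rule back_subst[of "\<lambda>X. X \<in> _"]) auto
    ultimately have "{\<omega> \<in> space (BFA x t u). 0 < \<zeta> (position \<omega> u) t} \<in> sets (BF x t)"
      by (subst (asm) sets_restrict_space_iff) auto
    then have "{\<omega> \<in> space (BFA x t u). 0 < \<zeta> (position \<omega> u) t} \<in> sets P"
      unfolding sets_P by (rule subsetD[OF branching_filtration_le])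
    then show ?thesis by (rule back_subst[of "\<lambda>X. X \<in> _"]) (auto simp: space_BFA)
  qed
  then have "{\<omega> \<in> space P. \<forall>u\<in>set vs. u \<in> alive \<omega> t \<and> 0 < \<zeta> (position \<omega> u) t} \<in> sets P"
    by (intro sets.sets_Collect_finite_All) auto
  then show ?thesis by (simp add: positive_event_def)
qed

text \<open>A statement about a single tree, with the almost sure positivity at births as a
  hypothesis. It keeps all denominators nonzero, because the value of \<zeta> at a death is the one
  at the next birth on the line, and at \<open>t\<close> for the particle still alive.\<close>

lemma density_weight:
  assumes \<omega>: "\<omega> \<in> trees W x" "spines_at \<omega> t vs" and k: "length vs = k"
    and birth: "\<forall>u n. u \<in> alive \<omega> t \<longrightarrow> 0 < \<zeta> (position \<omega> u) t \<longrightarrow> n \<le> length u \<longrightarrow>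
      0 < \<zeta> (position \<omega> u) (birth_upto \<omega> t (take n u))"
  shows "0 < spine_density R \<mu> \<zeta> k t \<omega> \<longleftrightarrow> \<omega> \<in> positive_event vs"
    and "0 \<le> spine_density R \<mu> \<zeta> k t \<omega>"
    and "\<omega> \<in> positive_event vs \<Longrightarrow>
      spine_density R \<mu> \<zeta> k t \<omega> * weight R \<mu> k t \<omega> = offspring_prod vs \<omega>"
proof -
  have alive: "set vs \<subseteq> alive \<omega> t" by (rule spines_at_alive[OF \<omega>(2)])
  let ?b = "\<lambda>v. particle_zeta \<zeta> \<omega> v (birth_upto \<omega> t v)"
  let ?d = "\<lambda>v. particle_zeta \<zeta> \<omega> v (death_upto \<omega> t v)"
  let ?r = "rate_integral R \<mu> \<omega> k t"
  have pz: "particle_zeta \<zeta> \<omega> v t = \<zeta> (position \<omega> v) t" if "v \<in> set vs" for v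
  proof -
    have v: "v \<in> alive \<omega> t" using that alive by blast
    then show ?thesis
      using particle_zeta_eq(2)[OF t \<omega>(1) v prefix_order.refl] death_upto_alive[OF t v] by simp
  qed
  have pe: "\<omega> \<in> positive_event vs \<longleftrightarrow> (\<forall>v\<in>set vs. 0 < particle_zeta \<zeta> \<omega> v t)"
    using \<omega>(1) alive pz by (auto simp: positive_event_def)
  have dens: "spine_density R \<mu> \<zeta> k t \<omega> = of_bool (\<omega> \<in> positive_event vs) *
      (\<Prod>v\<in>prefix_set vs. ?d v / ?b v * exp (- ?r v)) * offspring_prod vs \<omega>"
    using spine_density_eq[OF \<omega>(1) t \<omega>(2)] pe by (simp add: k offspring_prod_def)
  have fac: "0 < ?b v \<and> 0 < ?d v" if v: "v \<in> prefix_set vs" and p: "\<omega> \<in> positive_event vs" for v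
  proof -
    obtain u where u: "u \<in> set vs" "prefix v u" using v by (auto simp: prefix_set_def)
    have ua: "u \<in> alive \<omega> t" "0 < \<zeta> (position \<omega> u) t" using p u by (auto simp: positive_event_def)
    have bu: "0 < \<zeta> (position \<omega> u) (birth_upto \<omega> t w)" if "prefix w u" for w
    proof -
      have "length w \<le> length u" "take (length w) u = w" using that by (auto simp: prefix_def)
      then show ?thesis using birth[rule_format, OF ua, of "length w"] by simp
    qed
    have "0 < \<zeta> (position \<omega> u) (death_upto \<omega> t v)"
    proof (cases "v = u")
      case True
      then show ?thesis using ua death_upto_alive[OF t ua(1)] by simp
    next
      case False
      then have "strict_prefix v u" using u by auto
      then obtain j where "prefix (v @ [j]) u" by (rule strict_prefix_snocE)
      from bu[OF this] show ?thesis by (simp add: death_upto_snoc[of _ _ _ j])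
    qed
    then show ?thesis
      using particle_zeta_eq[OF t \<omega>(1) ua(1) u(2)] bu[OF u(2)] by simp
  qed
  have op: "0 < offspring_prod vs \<omega>" by (rule offspring_prod_pos[OF alive])
  have pr: "0 < (\<Prod>v\<in>prefix_set vs. ?d v / ?b v * exp (- ?r v))" if "\<omega> \<in> positive_event vs"
    using fac that by (intro prod_pos) simp
  show "0 < spine_density R \<mu> \<zeta> k t \<omega> \<longleftrightarrow> \<omega> \<in> positive_event vs"
    using op pr by (cases "\<omega> \<in> positive_event vs") (auto simp: dens)
  show "0 \<le> spine_density R \<mu> \<zeta> k t \<omega>"
    using op pr by (cases "\<omega> \<in> positive_event vs") (auto simp: dens less_imp_le)
  show "spine_density R \<mu> \<zeta> k t \<omega> * weight R \<mu> k t \<omega> = offspring_prod vs \<omega>" if p: "\<omega> \<in> positive_event vs"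
  proof -
    have "(\<Prod>v\<in>prefix_set vs. ?d v / ?b v * exp (- ?r v)) * (\<Prod>v\<in>prefix_set vs. ?b v / ?d v * exp (?r v)) = 1"
    proof -
      have "(?d v / ?b v * exp (- ?r v)) * (?b v / ?d v * exp (?r v)) = 1" if "v \<in> prefix_set vs" for v
        using fac[OF that p] by (simp add: exp_minus field_simps)
      then show ?thesis by (simp flip: prod.distrib)
    qed
    then show ?thesis
      using weight_eq[OF R_measurable pmf_measurable t \<omega>] p by (simp add: dens k mult_ac)
  qed
qed

text \<open>Labels and prefix lengths are countable, so one null set serves for all of them.\<close>

lemma AE_birth_pos:
  "AE \<omega> in Pk. \<forall>u n. u \<in> alive \<omega> t \<longrightarrow> 0 < \<zeta> (position \<omega> u) t \<longrightarrow> n \<le> length u \<longrightarrow>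
      0 < \<zeta> (position \<omega> u) (birth_upto \<omega> t (take n u))"
  unfolding AE_all_countable
proof (intro allI)
  fix u n
  show "AE \<omega> in Pk. u \<in> alive \<omega> t \<longrightarrow> 0 < \<zeta> (position \<omega> u) t \<longrightarrow> n \<le> length u \<longrightarrow>
      0 < \<zeta> (position \<omega> u) (birth_upto \<omega> t (take n u))"
  proof (cases "n \<le> length u")
    case True
    from AE_Pk[OF zeta_pos_at_birth[OF True]] show ?thesis by (auto elim: eventually_mono)
  qed simp
qed

text \<open>The integrand on the left is not known to be adapted. But \<open>Q\<close> gives no mass
  to the adapted event where the density is not positive, so the integrand may be set to
  \<open>0\<close> there; the truncated one is adapted, and the density formula applies to
  it.\<close>

lemma nn_integral_tilted:
  assumes Y: "Y \<in> borel_measurable (SF x k t)"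
  shows "(\<integral>\<^sup>+\<omega>. ennreal (Y \<omega> * weight R \<mu> k t \<omega>) \<partial>Q) =
    (\<integral>\<^sup>+\<omega>. ennreal (spine_density R \<mu> \<zeta> k t \<omega>) *
      ennreal (if 0 < spine_density R \<mu> \<zeta> k t \<omega> then Y \<omega> * weight R \<mu> k t \<omega> else 0) \<partial>Pk)"
proof -
  let ?S = "SF x k t"
  let ?\<rho> = "spine_density R \<mu> \<zeta> k t"
  let ?Z = "\<lambda>\<omega>. if 0 < ?\<rho> \<omega> then Y \<omega> * weight R \<mu> k t \<omega> else 0"
  have subQ: "subalgebra Q ?S"
    and restr: "restr_to_subalg Q ?S = density (restr_to_subalg Pk ?S) (\<lambda>\<omega>. ennreal (?\<rho> \<omega>))"
    using tilted t unfolding tilted_measure_def by blast+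
  have subPk: "subalgebra Pk ?S"
    by (simp add: subalgebra_def sets_Pk spine_filtration_le)
  have \<rho>: "?\<rho> \<in> borel_measurable ?S"
    by (rule spine_density_measurable[OF R_measurable pmf_measurable t])
  have Z: "?Z \<in> borel_measurable ?S"
    by (rule truncated_weight_measurable[OF R_measurable pmf_measurable t Y])
  have S_eq: "sets (restr_to_subalg Pk ?S) = sets ?S" by (rule sets_restr_to_subalg[OF subPk])
  have meas: "f \<in> borel_measurable (restr_to_subalg Pk ?S)" if "f \<in> borel_measurable ?S" for f :: "'a tree \<Rightarrow> ennreal"
    using that measurable_cong_sets[OF S_eq refl] by blast
  have \<rho>': "(\<lambda>\<omega>. ennreal (?\<rho> \<omega>)) \<in> borel_measurable ?S" using \<rho> by measurable
  have swap: "(\<integral>\<^sup>+\<omega>. f \<omega> \<partial>Q) = (\<integral>\<^sup>+\<omega>. ennreal (?\<rho> \<omega>) * f \<omega> \<partial>Pk)"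
    if f: "f \<in> borel_measurable ?S" for f
  proof -
    have "(\<integral>\<^sup>+\<omega>. f \<omega> \<partial>Q) = (\<integral>\<^sup>+\<omega>. f \<omega> \<partial>restr_to_subalg Q ?S)"
      by (rule nn_integral_subalgebra2[OF subQ f, symmetric])
    also have "\<dots> = (\<integral>\<^sup>+\<omega>. ennreal (?\<rho> \<omega>) * f \<omega> \<partial>restr_to_subalg Pk ?S)"
      unfolding restr by (rule nn_integral_density[OF meas[OF \<rho>'] meas[OF f]])
    also have "\<dots> = (\<integral>\<^sup>+\<omega>. ennreal (?\<rho> \<omega>) * f \<omega> \<partial>Pk)"
      by (rule nn_integral_subalgebra2[OF subPk]) (use \<rho>' f in measurable)
    finally show ?thesis .
  qed
  let ?N = "{\<omega> \<in> space ?S. ?\<rho> \<omega> \<le> 0}"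
  have N: "?N \<in> sets ?S" using \<rho> by measurable
  have NQ: "?N \<in> sets Q" using N subQ by (auto simp: subalgebra_def)
  have "emeasure Q ?N = (\<integral>\<^sup>+\<omega>. indicator ?N \<omega> \<partial>Q)" using NQ by simp
  also have "\<dots> = (\<integral>\<^sup>+\<omega>. ennreal (?\<rho> \<omega>) * indicator ?N \<omega> \<partial>Pk)"
    by (rule swap[OF borel_measurable_indicator[OF N]])
  also have "\<dots> = (\<integral>\<^sup>+\<omega>. 0 \<partial>Pk)"
    by (intro nn_integral_cong) (auto simp: indicator_def ennreal_neg)
  finally have "emeasure Q ?N = 0" by simp
  then have "AE \<omega> in Q. 0 < ?\<rho> \<omega>"
    using subQ by (intro AE_I[OF _ _ NQ]) (auto simp: subalgebra_def not_less)
  then have "(\<integral>\<^sup>+\<omega>. ennreal (Y \<omega> * weight R \<mu> k t \<omega>) \<partial>Q) = (\<integral>\<^sup>+\<omega>. ennreal (?Z \<omega>) \<partial>Q)"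
    by (intro nn_integral_cong_AE) (auto elim!: eventually_mono)
  also have "\<dots> = (\<integral>\<^sup>+\<omega>. ennreal (?\<rho> \<omega>) * ennreal (?Z \<omega>) \<partial>Pk)"
    by (rule swap) (use Z in measurable)
  finally show ?thesis .
qed

text \<open>The dependence of the index set on the tree is moved into the indicator of
  \<open>positive_event\<close>, so that all trees share one countable index set.\<close>

lemma tuples_sum:
  assumes \<omega>: "\<omega> \<in> trees W x"
  shows "(\<Sum>\<^sub>\<infinity>vs\<in>tuples k (alive \<omega> t).
          ennreal (Yv (map Some vs) \<omega> * of_bool (\<forall>i<k. 0 < \<zeta> (position \<omega> (vs ! i)) t))) =
      (\<integral>\<^sup>+vs. ennreal (Yv (map Some vs) \<omega>) * indicator (positive_event vs) \<omega> \<partial>count_space {vs. length vs = k})"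
    and "(\<Sum>\<^sub>\<infinity>vs\<in>tuples k (alive \<omega> t).
          Yv (map Some vs) \<omega> * of_bool (\<forall>i<k. 0 < \<zeta> (position \<omega> (vs ! i)) t)) =
      (\<integral>vs. Yv (map Some vs) \<omega> * indicator (positive_event vs) \<omega> \<partial>count_space {vs. length vs = k})"
proof -
  have pe: "\<omega> \<in> positive_event vs \<longleftrightarrow> set vs \<subseteq> alive \<omega> t \<and> (\<forall>i<length vs. 0 < \<zeta> (position \<omega> (vs ! i)) t)" for vs
    using \<omega> by (auto simp: positive_event_def all_set_conv_all_nth subset_iff in_set_conv_nth)
  show "(\<Sum>\<^sub>\<infinity>vs\<in>tuples k (alive \<omega> t).
          ennreal (Yv (map Some vs) \<omega> * of_bool (\<forall>i<k. 0 < \<zeta> (position \<omega> (vs ! i)) t))) =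
      (\<integral>\<^sup>+vs. ennreal (Yv (map Some vs) \<omega>) * indicator (positive_event vs) \<omega> \<partial>count_space {vs. length vs = k})"
    unfolding infsum_eq_nn_integral_count_space[symmetric]
    by (rule infsum_cong_neutral) (auto simp: tuples_def pe)
  show "(\<Sum>\<^sub>\<infinity>vs\<in>tuples k (alive \<omega> t).
          Yv (map Some vs) \<omega> * of_bool (\<forall>i<k. 0 < \<zeta> (position \<omega> (vs ! i)) t)) =
      (\<integral>vs. Yv (map Some vs) \<omega> * indicator (positive_event vs) \<omega> \<partial>count_space {vs. length vs = k})"
    unfolding infsum_eq_integral_count_space[symmetric]
    by (rule infsum_cong_neutral) (auto simp: tuples_def pe)
qed

text \<open>\<open>ennreal\<close> cuts off negative values on both sides, so that the lemma,
  applied to \<open>Y\<close> and to its negative, covers both parts of the signed case. Under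
  \<open>Pk\<close> at most one tuple contributes, and Tonelli reduces the claim to
  \<open>many_to_few_single\<close>.\<close>

lemma many_to_few_nn:
  assumes Y: "Y \<in> borel_measurable (SF x k t)"
    and Yv: "\<And>vs. length vs = k \<Longrightarrow> None \<notin> set vs \<Longrightarrow> Yv vs \<in> borel_measurable (BF x t)"
    and YYv: "\<And>\<omega> vs. \<omega> \<in> trees W x \<Longrightarrow> length vs = k \<Longrightarrow> spines_at \<omega> t vs \<Longrightarrow> Y \<omega> = Yv (map Some vs) \<omega>"
  shows "(\<integral>\<^sup>+\<omega>. \<integral>\<^sup>+vs. ennreal (Yv (map Some vs) \<omega>) * indicator (positive_event vs) \<omega> \<partial>count_space {vs. length vs = k} \<partial>P) =
    (\<integral>\<^sup>+\<omega>. ennreal (Y \<omega> * weight R \<mu> k t \<omega>) \<partial>Q)"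
proof -
  let ?I = "{vs :: label list. length vs = k}"
  let ?\<rho> = "spine_density R \<mu> \<zeta> k t"
  let ?F = "\<lambda>vs \<omega>. ennreal (Yv (map Some vs) \<omega>) * indicator (positive_event vs) \<omega>"
  let ?T = "\<lambda>vs \<omega>. ?F vs \<omega> * ennreal (offspring_prod vs \<omega>) * indicator {\<omega>. spines_at \<omega> t vs} \<omega>"
  have F: "?F vs \<in> borel_measurable P" if "vs \<in> ?I" for vs
  proof -
    have [measurable]: "Yv (map Some vs) \<in> borel_measurable P"
      by (rule BF_P[OF Yv]) (use that in auto)
    show ?thesis by measurable
  qed
  have T: "?T vs \<in> borel_measurable Pk" if vs: "vs \<in> ?I" for vs
  proof -
    have "(\<lambda>\<omega>. ?F vs \<omega> * ennreal (offspring_prod vs \<omega>)) \<in> borel_measurable P"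
      using F[OF vs] by measurable
    then have [measurable]: "(\<lambda>\<omega>. ?F vs \<omega> * ennreal (offspring_prod vs \<omega>)) \<in> borel_measurable Pk"
      by (rule measurable_from_subalg[rotated]) (use P_le_Pk in \<open>auto simp: subalgebra_def\<close>)
    have [measurable]: "{\<omega> \<in> trees W x. spines_at \<omega> t vs} \<in> sets Pk"
      by (rule spines_at_sets_Pk) (use vs in simp)
    have "(\<lambda>\<omega>. ?F vs \<omega> * ennreal (offspring_prod vs \<omega>) * indicator {\<omega> \<in> trees W x. spines_at \<omega> t vs} \<omega>) \<in> borel_measurable Pk"
      by measurable
    then show ?thesis
      by (rule measurable_cong[THEN iffD1, rotated]) (simp add: indicator_def)
  qed
  have "(\<integral>\<^sup>+\<omega>. ennreal (Y \<omega> * weight R \<mu> k t \<omega>) \<partial>Q) =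
    (\<integral>\<^sup>+\<omega>. ennreal (?\<rho> \<omega>) * ennreal (if 0 < ?\<rho> \<omega> then Y \<omega> * weight R \<mu> k t \<omega> else 0) \<partial>Pk)"
    by (rule nn_integral_tilted[OF Y])
  also have "\<dots> = (\<integral>\<^sup>+\<omega>. \<integral>\<^sup>+vs. ?T vs \<omega> \<partial>count_space ?I \<partial>Pk)"
  proof (rule nn_integral_cong_AE, use AE_birth_pos AE_space in eventually_elim)
    fix \<omega> assume birth: "\<forall>u n. u \<in> alive \<omega> t \<longrightarrow> 0 < \<zeta> (position \<omega> u) t \<longrightarrow> n \<le> length u \<longrightarrow>
      0 < \<zeta> (position \<omega> u) (birth_upto \<omega> t (take n u))" and "\<omega> \<in> space Pk"
    then have \<omega>: "\<omega> \<in> trees W x" by simp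
    show "ennreal (?\<rho> \<omega>) * ennreal (if 0 < ?\<rho> \<omega> then Y \<omega> * weight R \<mu> k t \<omega> else 0) =
      (\<integral>\<^sup>+vs. ?T vs \<omega> \<partial>count_space ?I)"
    proof (cases "\<exists>vs. length vs = k \<and> spines_at \<omega> t vs")
      case False
      then have "(\<integral>\<^sup>+vs. ?T vs \<omega> \<partial>count_space ?I) = (\<integral>\<^sup>+vs. 0 \<partial>count_space ?I)"
        by (intro nn_integral_cong) auto
      moreover have "?\<rho> \<omega> = 0" using False by (intro spine_density_eq_0) auto
      ultimately show ?thesis by simp
    next
      case True
      then obtain vs where vs: "length vs = k" "spines_at \<omega> t vs" by blast
      note dw = density_weight[OF \<omega> vs(2,1) birth]
      \<comment> \<open>The marks have only one list of positions at time \<open>t\<close>; all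
        other tuples contribute \<open>0\<close>.\<close>
      have "(\<integral>\<^sup>+vs. ?T vs \<omega> \<partial>count_space ?I) = (\<Sum>vs\<in>{vs}. ?T vs \<omega>)"
        by (rule nn_integral_count_space') (use vs in \<open>auto simp: indicator_def dest: spines_at_unique\<close>)
      also have "\<dots> = ?F vs \<omega> * ennreal (offspring_prod vs \<omega>)" using vs by simp
      also have "\<dots> = ennreal (?\<rho> \<omega>) * ennreal (if 0 < ?\<rho> \<omega> then Y \<omega> * weight R \<mu> k t \<omega> else 0)"
      proof (cases "\<omega> \<in> positive_event vs")
        case True
        have op: "0 \<le> offspring_prod vs \<omega>"
          using offspring_prod_pos[OF spines_at_alive[OF vs(2)]] by simp
        \<comment> \<open>This rule asks only that the density be nonnegative; \<open>Y\<close> may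
          have either sign.\<close>
        have "ennreal (?\<rho> \<omega>) * ennreal (Y \<omega> * weight R \<mu> k t \<omega>) = ennreal (?\<rho> \<omega> * (Y \<omega> * weight R \<mu> k t \<omega>))"
          by (rule ennreal_mult'[OF dw(2), symmetric])
        also have "?\<rho> \<omega> * (Y \<omega> * weight R \<mu> k t \<omega>) = offspring_prod vs \<omega> * Y \<omega>"
          using dw(3)[OF True] by (metis mult.commute mult.left_commute)
        also have "ennreal \<dots> = ennreal (offspring_prod vs \<omega>) * ennreal (Y \<omega>)"
          by (rule ennreal_mult'[OF op])
        finally show ?thesis
          using True dw(1) YYv[OF \<omega> vs] by (simp add: mult.commute)
      next
        case False
        then show ?thesis using dw(1) by simp
      qed
      finally show ?thesis by simp
    qed
  qed
  also have "\<dots> = (\<integral>\<^sup>+vs. \<integral>\<^sup>+\<omega>. ?T vs \<omega> \<partial>Pk \<partial>count_space ?I)"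
    by (rule nn_integral_count_space_nn_integral) (use T in auto)
  also have "\<dots> = (\<integral>\<^sup>+vs. \<integral>\<^sup>+\<omega>. ?F vs \<omega> \<partial>P \<partial>count_space ?I)"
  proof (rule nn_integral_cong)
    fix vs assume "vs \<in> space (count_space ?I)"
    then have vs: "vs \<in> ?I" by simp
    have "(\<integral>\<^sup>+\<omega>. ?T vs \<omega> \<partial>Pk) = (\<integral>\<^sup>+\<omega>. ?F vs \<omega> * indicator {\<omega>. set vs \<subseteq> alive \<omega> t} \<omega> \<partial>P)"
      by (rule many_to_few_single[OF _ F[OF vs]]) (use vs in simp)
    also have "\<dots> = (\<integral>\<^sup>+\<omega>. ?F vs \<omega> \<partial>P)"
      by (intro nn_integral_cong) (auto simp: indicator_def positive_event_def)
    finally show "(\<integral>\<^sup>+\<omega>. ?T vs \<omega> \<partial>Pk) = (\<integral>\<^sup>+\<omega>. ?F vs \<omega> \<partial>P)" .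
  qed
  also have "\<dots> = (\<integral>\<^sup>+\<omega>. \<integral>\<^sup>+vs. ?F vs \<omega> \<partial>count_space ?I \<partial>P)"
    by (rule nn_integral_count_space_nn_integral[symmetric]) (use F in auto)
  finally show ?thesis by simp
qed

text \<open>Integrability under \<open>Q\<close> makes the integrals of both parts finite, and
  \<open>many_to_few_nn\<close> carries this to \<open>P\<close>. Hence for almost every tree the
  inner sum converges absolutely and is the difference of \<open>Fp\<close> and
  \<open>Fm\<close>.\<close>

lemma many_to_few_integrable:
  assumes Y: "Y \<in> borel_measurable (SF x k t)"
    and Yv: "\<And>vs. length vs = k \<Longrightarrow> None \<notin> set vs \<Longrightarrow> Yv vs \<in> borel_measurable (BF x t)"
    and YYv: "\<And>\<omega> vs. \<omega> \<in> trees W x \<Longrightarrow> length vs = k \<Longrightarrow> spines_at \<omega> t vs \<Longrightarrow> Y \<omega> = Yv (map Some vs) \<omega>"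
    and int: "integrable Q (\<lambda>\<omega>. Y \<omega> * weight R \<mu> k t \<omega>)"
  shows "integrable P (\<lambda>\<omega>. \<integral>vs. Yv (map Some vs) \<omega> * indicator (positive_event vs) \<omega> \<partial>count_space {vs. length vs = k})"
    and "(\<integral>\<omega>. (\<integral>vs. Yv (map Some vs) \<omega> * indicator (positive_event vs) \<omega> \<partial>count_space {vs. length vs = k}) \<partial>P) =
      (\<integral>\<omega>. Y \<omega> * weight R \<mu> k t \<omega> \<partial>Q)"
proof -
  let ?I = "{vs :: label list. length vs = k}"
  let ?g = "\<lambda>vs \<omega>. Yv (map Some vs) \<omega> * indicator (positive_event vs) \<omega>"
  let ?r = "\<lambda>\<omega>. \<integral>vs. ?g vs \<omega> \<partial>count_space ?I"
  define Fp where "Fp \<omega> = (\<integral>\<^sup>+vs. ennreal (?g vs \<omega>) \<partial>count_space ?I)" for \<omega>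
  define Fm where "Fm \<omega> = (\<integral>\<^sup>+vs. ennreal (- ?g vs \<omega>) \<partial>count_space ?I)" for \<omega>
  have sf: "sigma_finite_measure (count_space ?I)"
    by (rule sigma_finite_measure_count_space_countable) simp
  have g: "?g vs \<in> borel_measurable P" if "vs \<in> ?I" for vs
  proof -
    have [measurable]: "Yv (map Some vs) \<in> borel_measurable P"
      by (rule BF_P[OF Yv]) (use that in auto)
    show ?thesis by measurable
  qed
  have gpair: "(\<lambda>(\<omega>, vs). ?g vs \<omega>) \<in> borel_measurable (P \<Otimes>\<^sub>M count_space ?I)"
  proof -
    have "(\<lambda>(vs, \<omega>). ?g vs \<omega>) \<in> borel_measurable (count_space ?I \<Otimes>\<^sub>M P)"
      by (rule measurable_pair_measure_countable1) (use g in auto)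
    from measurable_pair_swap[OF this] show ?thesis by (simp add: split_beta')
  qed
  have r: "?r \<in> borel_measurable P"
    by (rule sigma_finite_measure.borel_measurable_lebesgue_integral[OF sf gpair])
  have Fp: "Fp \<in> borel_measurable P" and Fm: "Fm \<in> borel_measurable P"
  proof -
    have "(\<lambda>(\<omega>, vs). ennreal (?g vs \<omega>)) \<in> borel_measurable (P \<Otimes>\<^sub>M count_space ?I)"
      "(\<lambda>(\<omega>, vs). ennreal (- ?g vs \<omega>)) \<in> borel_measurable (P \<Otimes>\<^sub>M count_space ?I)"
      using gpair by (simp_all add: split_beta')
    from this[THEN sigma_finite_measure.borel_measurable_nn_integral[OF sf]]
    show "Fp \<in> borel_measurable P" "Fm \<in> borel_measurable P"
      unfolding Fp_def[abs_def] Fm_def[abs_def] .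
  qed
  have ip: "(\<integral>\<^sup>+\<omega>. Fp \<omega> \<partial>P) = (\<integral>\<^sup>+\<omega>. ennreal (Y \<omega> * weight R \<mu> k t \<omega>) \<partial>Q)"
  proof -
    have "Fp = (\<lambda>\<omega>. \<integral>\<^sup>+vs. ennreal (Yv (map Some vs) \<omega>) * indicator (positive_event vs) \<omega> \<partial>count_space ?I)"
      unfolding Fp_def by (intro ext nn_integral_cong) (simp add: indicator_def)
    then show ?thesis using many_to_few_nn[of Y Yv, OF Y Yv YYv] by simp
  qed
  have im: "(\<integral>\<^sup>+\<omega>. Fm \<omega> \<partial>P) = (\<integral>\<^sup>+\<omega>. ennreal (- (Y \<omega> * weight R \<mu> k t \<omega>)) \<partial>Q)"
  proof -
    have "Fm = (\<lambda>\<omega>. \<integral>\<^sup>+vs. ennreal (- Yv (map Some vs) \<omega>) * indicator (positive_event vs) \<omega> \<partial>count_space ?I)"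
      unfolding Fm_def by (intro ext nn_integral_cong) (simp add: indicator_def)
    moreover have "(\<integral>\<^sup>+\<omega>. \<integral>\<^sup>+vs. ennreal (- Yv (map Some vs) \<omega>) * indicator (positive_event vs) \<omega> \<partial>count_space ?I \<partial>P) =
      (\<integral>\<^sup>+\<omega>. ennreal (- Y \<omega> * weight R \<mu> k t \<omega>) \<partial>Q)"
      by (rule many_to_few_nn[of "\<lambda>\<omega>. - Y \<omega>" "\<lambda>vs \<omega>. - Yv vs \<omega>"]) (use Y Yv YYv in auto)
    ultimately show ?thesis by simp
  qed
  have fin: "(\<integral>\<^sup>+\<omega>. Fp \<omega> \<partial>P) < \<infinity>" "(\<integral>\<^sup>+\<omega>. Fm \<omega> \<partial>P) < \<infinity>"
    unfolding ip im using int by (auto simp: real_integrable_def top.not_eq_extremum)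
  \<comment> \<open>This holds for every tree: if the inner family is not integrable,
    \<open>?r\<close> has the default value \<open>0\<close>.\<close>
  have bound: "ennreal (norm (?r \<omega>)) \<le> Fp \<omega> + Fm \<omega>" for \<omega>
  proof -
    have "ennreal (norm (?r \<omega>)) \<le> (\<integral>\<^sup>+vs. norm (?g vs \<omega>) \<partial>count_space ?I)"
    proof (cases "integrable (count_space ?I) (\<lambda>vs. ?g vs \<omega>)")
      case True
      then show ?thesis by (rule integral_norm_bound_ennreal)
    qed (simp add: not_integrable_integral_eq)
    also have "\<dots> = (\<integral>\<^sup>+vs. ennreal (?g vs \<omega>) + ennreal (- ?g vs \<omega>) \<partial>count_space ?I)"
      by (intro nn_integral_cong) (auto simp: abs_if ennreal_neg)
    also have "\<dots> = Fp \<omega> + Fm \<omega>" unfolding Fp_def Fm_def by (rule nn_integral_add) auto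
    finally show ?thesis .
  qed
  show integ: "integrable P ?r"
  proof (rule integrableI_bounded[OF r])
    have "(\<integral>\<^sup>+\<omega>. ennreal (norm (?r \<omega>)) \<partial>P) \<le> (\<integral>\<^sup>+\<omega>. Fp \<omega> + Fm \<omega> \<partial>P)"
      by (intro nn_integral_mono bound)
    also have "\<dots> = (\<integral>\<^sup>+\<omega>. Fp \<omega> \<partial>P) + (\<integral>\<^sup>+\<omega>. Fm \<omega> \<partial>P)" by (rule nn_integral_add[OF Fp Fm])
    also have "\<dots> < \<infinity>" using fin by simp
    finally show "(\<integral>\<^sup>+\<omega>. ennreal (norm (?r \<omega>)) \<partial>P) < \<infinity>" .
  qed
  have AEfin: "AE \<omega> in P. Fp \<omega> \<noteq> \<infinity>" "AE \<omega> in P. Fm \<omega> \<noteq> \<infinity>"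
    using nn_integral_PInf_AE[OF Fp] nn_integral_PInf_AE[OF Fm] fin by auto
  have part: "integrable P (\<lambda>\<omega>. enn2real (F \<omega>))" "(\<integral>\<omega>. enn2real (F \<omega>) \<partial>P) = enn2real (\<integral>\<^sup>+\<omega>. F \<omega> \<partial>P)"
    if F: "F \<in> borel_measurable P" "(\<integral>\<^sup>+\<omega>. F \<omega> \<partial>P) < \<infinity>" "AE \<omega> in P. F \<omega> \<noteq> \<infinity>" for F :: "'a tree \<Rightarrow> ennreal"
  proof -
    have e: "(\<integral>\<^sup>+\<omega>. ennreal (enn2real (F \<omega>)) \<partial>P) = (\<integral>\<^sup>+\<omega>. F \<omega> \<partial>P)"
      using F(3) by (intro nn_integral_cong_AE) (auto elim!: eventually_mono simp: less_top)
    have m: "(\<lambda>\<omega>. enn2real (F \<omega>)) \<in> borel_measurable P" using F(1) by measurable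
    show "integrable P (\<lambda>\<omega>. enn2real (F \<omega>))"
      by (rule integrableI_nonneg[OF m]) (use e F(2) in auto)
    show "(\<integral>\<omega>. enn2real (F \<omega>) \<partial>P) = enn2real (\<integral>\<^sup>+\<omega>. F \<omega> \<partial>P)"
      by (subst integral_eq_nn_integral[OF m]) (use e in auto)
  qed
  have "AE \<omega> in P. ?r \<omega> = enn2real (Fp \<omega>) - enn2real (Fm \<omega>)"
    using AEfin
  proof eventually_elim
    fix \<omega> assume "Fp \<omega> \<noteq> \<infinity>" "Fm \<omega> \<noteq> \<infinity>"
    then have "integrable (count_space ?I) (\<lambda>vs. ?g vs \<omega>)"
      by (auto simp: real_integrable_def Fp_def Fm_def)
    from real_lebesgue_integral_def[OF this]
    show "?r \<omega> = enn2real (Fp \<omega>) - enn2real (Fm \<omega>)" unfolding Fp_def Fm_def .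
  qed
  then have "(\<integral>\<omega>. ?r \<omega> \<partial>P) = (\<integral>\<omega>. enn2real (Fp \<omega>) - enn2real (Fm \<omega>) \<partial>P)"
    using r Fp Fm by (intro integral_cong_AE) auto
  also have "\<dots> = enn2real (\<integral>\<^sup>+\<omega>. Fp \<omega> \<partial>P) - enn2real (\<integral>\<^sup>+\<omega>. Fm \<omega> \<partial>P)"
    using part[OF Fp fin(1) AEfin(1)] part[OF Fm fin(2) AEfin(2)] by simp
  also have "\<dots> = (\<integral>\<omega>. Y \<omega> * weight R \<mu> k t \<omega> \<partial>Q)"
    unfolding ip im by (rule real_lebesgue_integral_def[OF int, symmetric])
  finally show "(\<integral>\<omega>. ?r \<omega> \<partial>P) = (\<integral>\<omega>. Y \<omega> * weight R \<mu> k t \<omega> \<partial>Q)" .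
qed

end

section \<open>The formula in its nonnegative and its integrable form\<close>

theorem lemma1:
  fixes J :: "'a measure" and W :: "(real \<Rightarrow> 'a) set"
    and K :: "'a \<Rightarrow> (real \<Rightarrow> 'a) measure"
    and R :: "'a \<Rightarrow> real" and \<mu> :: "'a \<Rightarrow> nat pmf"
    and \<zeta> :: "(real \<Rightarrow> 'a) \<Rightarrow> real \<Rightarrow> real"
    and P Pk Q :: "'a tree measure"
    and x :: 'a and k :: nat and t :: real
    and Y :: "'a tree \<Rightarrow> real" and Yv :: "label option list \<Rightarrow> 'a tree \<Rightarrow> real"
  assumes "markov_family J W K"
    and "branching_mechanism J K R \<mu>"
    and "unit_martingale_functional J W K \<zeta>"
    and "x \<in> space J"
    and "branching_law J W K R \<mu> x P"
    and "1 \<le> k"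
    and "spine_law J W x k P Pk"
    and "tilted_measure J W R \<mu> \<zeta> x k Pk Q"
    and "0 \<le> t"
    and "Y \<in> borel_measurable (spine_filtration J W x k t)"
    and "\<And>vs. length vs = k \<Longrightarrow> None \<notin> set vs \<Longrightarrow>
      Yv vs \<in> borel_measurable (branching_filtration J W x t)"
    and "\<And>\<omega>. \<omega> \<in> trees W x \<Longrightarrow>
      Y \<omega> = (\<Sum>\<^sub>\<infinity>vs\<in>tuples k (Some ` alive \<omega> t \<union> {None}).
                Yv vs \<omega> * of_bool (\<forall>i<k. spine \<omega> i t = vs ! i))"
  shows "((\<forall>\<omega>\<in>trees W x. 0 \<le> Y \<omega>) \<longrightarrow>
      (\<integral>\<^sup>+\<omega>. (\<Sum>\<^sub>\<infinity>vs\<in>tuples k (alive \<omega> t).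
          ennreal (Yv (map Some vs) \<omega> * of_bool (\<forall>i<k. 0 < \<zeta> (position \<omega> (vs ! i)) t))) \<partial>P) =
      (\<integral>\<^sup>+\<omega>. ennreal (Y \<omega> * (\<Prod>v\<in>skeleton \<omega> k t.
          particle_zeta \<zeta> \<omega> v (birth_upto \<omega> t v) / particle_zeta \<zeta> \<omega> v (death_upto \<omega> t v) *
          exp (rate_integral R \<mu> \<omega> k t v))) \<partial>Q)) \<and>
    (integrable Q (\<lambda>\<omega>. Y \<omega> * (\<Prod>v\<in>skeleton \<omega> k t.
          particle_zeta \<zeta> \<omega> v (birth_upto \<omega> t v) / particle_zeta \<zeta> \<omega> v (death_upto \<omega> t v) *
          exp (rate_integral R \<mu> \<omega> k t v))) \<longrightarrow>
      integrable P (\<lambda>\<omega>. \<Sum>\<^sub>\<infinity>vs\<in>tuples k (alive \<omega> t).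
          Yv (map Some vs) \<omega> * of_bool (\<forall>i<k. 0 < \<zeta> (position \<omega> (vs ! i)) t)) \<and>
      (\<integral>\<omega>. (\<Sum>\<^sub>\<infinity>vs\<in>tuples k (alive \<omega> t).
          Yv (map Some vs) \<omega> * of_bool (\<forall>i<k. 0 < \<zeta> (position \<omega> (vs ! i)) t)) \<partial>P) =
      (\<integral>\<omega>. Y \<omega> * (\<Prod>v\<in>skeleton \<omega> k t.
          particle_zeta \<zeta> \<omega> v (birth_upto \<omega> t v) / particle_zeta \<zeta> \<omega> v (death_upto \<omega> t v) *
          exp (rate_integral R \<mu> \<omega> k t v)) \<partial>Q))"
proof -
  interpret markov_motion J W K by unfold_locales (rule assms(1))
  interpret weighted_branching J W K R \<mu> x P \<zeta> Pk Q k t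
  proof unfold_locales
    show "(\<lambda>(s, w). \<zeta> w s) \<in> restrict_space borel {0..t} \<Otimes>\<^sub>M path_filtration J W t \<rightarrow>\<^sub>M borel" if "0 \<le> t" for t
      using assms(3) that unfolding unit_martingale_functional_def by blast
    show "0 \<le> \<zeta> w t" if "w \<in> W" "0 \<le> t" for w t
      using assms(3) that unfolding unit_martingale_functional_def by blast
  qed (fact assms)+
  \<comment> \<open>The representation of \<open>Y\<close> sums over tuples that may contain the
    graveyard; when the marks are at \<open>vs\<close>, only the tuple \<open>map Some vs\<close>
    survives.\<close>
  have YYv: "Y \<omega> = Yv (map Some vs) \<omega>"
    if \<omega>: "\<omega> \<in> trees W x" and vs: "length vs = k" "spines_at \<omega> t vs" for \<omega> vs
  proof -
    have "Y \<omega> = (\<Sum>\<^sub>\<infinity>us\<in>tuples k (Some ` alive \<omega> t \<union> {None}).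
                Yv us \<omega> * of_bool (\<forall>i<k. spine \<omega> i t = us ! i))"
      by (rule assms(12)[OF \<omega>])
    also have "\<dots> = (\<Sum>\<^sub>\<infinity>us\<in>{map Some vs}. Yv us \<omega>)"
    proof (rule infsum_cong_neutral)
      have sp: "spine \<omega> i t = Some (vs ! i)" if "i < k" for i
        using vs that by (simp add: spines_at_def)
      have "map Some vs \<in> tuples k (Some ` alive \<omega> t \<union> {None})"
        using spines_at_alive[OF vs(2)] vs(1) by (auto simp: tuples_def)
      then show "Yv us \<omega> = 0" if "us \<in> {map Some vs} - tuples k (Some ` alive \<omega> t \<union> {None})" for us
        using that by simp
      have uniq: "us = map Some vs" if "length us = k" "\<forall>i<k. spine \<omega> i t = us ! i" for us
        using that sp vs(1) by (intro nth_equalityI) auto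
      show "Yv us \<omega> * of_bool (\<forall>i<k. spine \<omega> i t = us ! i) = 0"
        if "us \<in> tuples k (Some ` alive \<omega> t \<union> {None}) - {map Some vs}" for us
        using that uniq[of us] by (auto simp: tuples_def)
      show "Yv us \<omega> * of_bool (\<forall>i<k. spine \<omega> i t = us ! i) = Yv us \<omega>"
        if "us \<in> tuples k (Some ` alive \<omega> t \<union> {None}) \<inter> {map Some vs}" for us
        using that sp vs(1) by simp
    qed
    finally show ?thesis by simp
  qed
  have 1: "(\<integral>\<^sup>+\<omega>. (\<Sum>\<^sub>\<infinity>vs\<in>tuples k (alive \<omega> t).
          ennreal (Yv (map Some vs) \<omega> * of_bool (\<forall>i<k. 0 < \<zeta> (position \<omega> (vs ! i)) t))) \<partial>P) =
      (\<integral>\<^sup>+\<omega>. ennreal (Y \<omega> * weight R \<mu> k t \<omega>) \<partial>Q)"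
  proof -
    have "(\<integral>\<^sup>+\<omega>. (\<Sum>\<^sub>\<infinity>vs\<in>tuples k (alive \<omega> t).
          ennreal (Yv (map Some vs) \<omega> * of_bool (\<forall>i<k. 0 < \<zeta> (position \<omega> (vs ! i)) t))) \<partial>P) =
      (\<integral>\<^sup>+\<omega>. \<integral>\<^sup>+vs. ennreal (Yv (map Some vs) \<omega>) * indicator (positive_event vs) \<omega> \<partial>count_space {vs. length vs = k} \<partial>P)"
      by (rule nn_integral_cong, rule tuples_sum(1)) simp
    also have "\<dots> = (\<integral>\<^sup>+\<omega>. ennreal (Y \<omega> * weight R \<mu> k t \<omega>) \<partial>Q)"
      by (rule many_to_few_nn[of Y Yv, OF assms(10,11) YYv])
    finally show ?thesis .
  qed
  have 2: "integrable P (\<lambda>\<omega>. \<Sum>\<^sub>\<infinity>vs\<in>tuples k (alive \<omega> t).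
          Yv (map Some vs) \<omega> * of_bool (\<forall>i<k. 0 < \<zeta> (position \<omega> (vs ! i)) t)) \<and>
      (\<integral>\<omega>. (\<Sum>\<^sub>\<infinity>vs\<in>tuples k (alive \<omega> t).
          Yv (map Some vs) \<omega> * of_bool (\<forall>i<k. 0 < \<zeta> (position \<omega> (vs ! i)) t)) \<partial>P) =
      (\<integral>\<omega>. Y \<omega> * weight R \<mu> k t \<omega> \<partial>Q)"
    if int: "integrable Q (\<lambda>\<omega>. Y \<omega> * weight R \<mu> k t \<omega>)"
  proof
    have m1: "integrable P (\<lambda>\<omega>. \<integral>vs. Yv (map Some vs) \<omega> * indicator (positive_event vs) \<omega> \<partial>count_space {vs. length vs = k})"
      by (rule many_to_few_integrable(1)[of Y Yv, OF assms(10,11) YYv int])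
    have m2: "(\<integral>\<omega>. (\<integral>vs. Yv (map Some vs) \<omega> * indicator (positive_event vs) \<omega> \<partial>count_space {vs. length vs = k}) \<partial>P) =
      (\<integral>\<omega>. Y \<omega> * weight R \<mu> k t \<omega> \<partial>Q)"
      by (rule many_to_few_integrable(2)[of Y Yv, OF assms(10,11) YYv int])
    show "integrable P (\<lambda>\<omega>. \<Sum>\<^sub>\<infinity>vs\<in>tuples k (alive \<omega> t).
          Yv (map Some vs) \<omega> * of_bool (\<forall>i<k. 0 < \<zeta> (position \<omega> (vs ! i)) t))"
      using m1 by (rule Bochner_Integration.integrable_cong[OF refl, THEN iffD1, rotated]) (simp add: tuples_sum(2))
    show "(\<integral>\<omega>. (\<Sum>\<^sub>\<infinity>vs\<in>tuples k (alive \<omega> t).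
          Yv (map Some vs) \<omega> * of_bool (\<forall>i<k. 0 < \<zeta> (position \<omega> (vs ! i)) t)) \<partial>P) =
      (\<integral>\<omega>. Y \<omega> * weight R \<mu> k t \<omega> \<partial>Q)"
      unfolding m2[symmetric]
      by (rule Bochner_Integration.integral_cong[OF refl tuples_sum(2)]) simp
  qed
  show ?thesis
    using 1 2 unfolding weight_def by blast
qed

end
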